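(* Let $\Omega\subset\mathbb{R}^n$ ($n\ge 2$) be a bounded open domain, let $p>1$, and let $F,G:[0,\infty)\to\mathbb{R}$ be locally Lipschitz functions such that: (1) $F(0)=0$; (2) $-\infty<\liminf_{s\to\infty}\frac{F(s)}{s^2}$ and $\limsup_{s\to\infty}\frac{F(s)}{s^2}=+\infty$; (3) $l_\infty:=\liminf_{s\to\infty}\frac{\max\{\xi:\xi\in\partial F(s)\}}{s}<0$ (the value $-\infty$ is allowed); (4) $G(0)=0$; (5) there are $\underline c,\overline c\in\mathbb{R}$ such that $$\underline c=\liminf_{s\to\infty}\frac{\min\{\xi:\xi\in\partial G(s)\}}{s^p}\le\limsup_{s\to\infty}\frac{\max\{\xi:\xi\in\partial G(s)\}}{s^p}=\overline c .$$ Then for every $k\in\mathbb{N}=\{1,2,\dots\}$ there exists $\lambda_k^\infty>0$ such that for every $\lambda\in[0,\lambda_k^\infty]$ the differential inclusion problem $$-\Delta u(x)\in\partial F(u(x))+\lambda\,\partial G(u(x))\ \text{ in }\Omega,\qquad u\ge 0\ \text{ in }\Omega,\qquad u=0\ \text{ on }\partial\Omega$$ has at least $k$ distinct weak solutions $u_{1,\lambda},\dots,u_{k,\lambda}\in H_0^1(\Omega)$. Moreover, these satisfy $$\|u_{i,\lambda}\|_{L^\infty}>i-1\qquad\text{for all } i\in\{1,\dots,k\},\ \lambda\in[0,\lambda_k^\infty].$$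
   Context: For a locally Lipschitz function $f$ on $\mathbb{R}$, $\partial f(s)$ denotes the Clarke generalized gradient: $\partial f(s)=\{\xi\in\mathbb{R}:\ \xi v\le f^\circ(s;v)\ \text{for all } v\in\mathbb{R}\}$, where $f^\circ(s;v)=\limsup_{z\to s,\ \tau\to 0^+}\frac{f(z+\tau v)-f(z)}{\tau}$; it is a nonempty compact interval. Functions defined on $[0,\infty)$ and vanishing at $0$ are extended by $0$ to $(-\infty,0)$, which gives meaning to the generalized gradient at $0$. A weak solution of the inclusion problem is a function $u\in H_0^1(\Omega)$ with $u\ge 0$ a.e. in $\Omega$ for which there is a measurable function $\xi:\Omega\to\mathbb{R}$ with $\xi(x)\in\partial F(u(x))+\lambda\,\partial G(u(x))$ for a.e. $x\in\Omega$ and $\int_\Omega\nabla u\cdot\nabla v\,dx=\int_\Omega \xi v\,dx$ for all $v\in H_0^1(\Omega)$. *)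

theory Defs
  imports "HOL-Analysis.Analysis" "HOL-Probability.Essential_Supremum"
begin

subsection \<open>Locally Lipschitz functions and the Clarke generalized gradient\<close>

text \<open>The library notion concerns families of functions with a time parameter; here the family is
  constant in time.\<close>

abbreviation locally_lipschitz_on :: "real set \<Rightarrow> (real \<Rightarrow> real) \<Rightarrow> bool" where
  "locally_lipschitz_on S f \<equiv> local_lipschitz (UNIV :: real set) S (\<lambda>_. f)"

text \<open>A function on \<open>[0, \<infinity>)\<close> is represented by a total function whose values on the
  negative half-line are irrelevant; they are overwritten by \<open>0\<close> before a generalized gradient
  is taken.\<close>

definition zero_extension :: "(real \<Rightarrow> real) \<Rightarrow> real \<Rightarrow> real" where
  "zero_extension f s = (if s < 0 then 0 else f s)"

text \<open>The base point \<open>z\<close> may be equal to \<open>s\<close> in the upper limit, hence \<open>nhds s\<close>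
  and not \<open>at s\<close>.\<close>

definition clarke_derivative :: "(real \<Rightarrow> real) \<Rightarrow> real \<Rightarrow> real \<Rightarrow> ereal" where
  "clarke_derivative f s v =
     Limsup (nhds s \<times>\<^sub>F at_right 0) (\<lambda>(z, \<tau>). ereal ((f (z + \<tau> * v) - f z) / \<tau>))"

definition clarke_gradient :: "(real \<Rightarrow> real) \<Rightarrow> real \<Rightarrow> real set" where
  "clarke_gradient f s = {\<xi>. \<forall>v. ereal (\<xi> * v) \<le> clarke_derivative f s v}"

text \<open>For a locally Lipschitz function the generalized gradient is a nonempty compact interval,
  so that its maximum and minimum exist. (\<open>Max\<close> and \<open>Min\<close> are only meaningful
  for finite sets.)\<close>

definition max_clarke :: "(real \<Rightarrow> real) \<Rightarrow> real \<Rightarrow> real" where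
  "max_clarke f s = (GREATEST \<xi>. \<xi> \<in> clarke_gradient f s)"

definition min_clarke :: "(real \<Rightarrow> real) \<Rightarrow> real \<Rightarrow> real" where
  "min_clarke f s = (LEAST \<xi>. \<xi> \<in> clarke_gradient f s)"


subsection \<open>The Sobolev space \<open>H\<^sup>1\<^sub>0\<close>\<close>

text \<open>Elements of the function spaces are represented by functions on the whole space; their
  values outside of \<open>\<Omega>\<close> are irrelevant, and equality in the spaces is equality almost
  everywhere in \<open>\<Omega>\<close>.\<close>

primrec C_k :: "nat \<Rightarrow> ('a::euclidean_space \<Rightarrow> real) \<Rightarrow> bool" where
  "C_k 0 f \<longleftrightarrow> continuous_on UNIV f"
| "C_k (Suc k) f \<longleftrightarrow>
     (\<forall>x. f differentiable at x) \<and> (\<forall>b\<in>Basis. C_k k (\<lambda>x. frechet_derivative f (at x) b))"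

definition test_function :: "'a::euclidean_space set \<Rightarrow> ('a \<Rightarrow> real) \<Rightarrow> bool" where
  "test_function \<Omega> \<phi> \<longleftrightarrow>
     (\<forall>k. C_k k \<phi>) \<and> compact (closure {x. \<phi> x \<noteq> 0}) \<and> closure {x. \<phi> x \<noteq> 0} \<subseteq> \<Omega>"

definition square_integrable ::
    "'a::euclidean_space set \<Rightarrow> ('a \<Rightarrow> 'b::euclidean_space) \<Rightarrow> bool" where
  "square_integrable \<Omega> f \<longleftrightarrow>
     f \<in> borel_measurable (lebesgue_on \<Omega>) \<and> integrable (lebesgue_on \<Omega>) (\<lambda>x. (norm (f x))\<^sup>2)"

text \<open>Weak gradients are required to be square integrable, as is appropriate for
  \<open>H\<^sup>1\<close>.\<close>

definition is_weak_gradient ::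
    "'a::euclidean_space set \<Rightarrow> ('a \<Rightarrow> real) \<Rightarrow> ('a \<Rightarrow> 'a) \<Rightarrow> bool" where
  "is_weak_gradient \<Omega> u g \<longleftrightarrow>
     square_integrable \<Omega> g \<and>
     (\<forall>\<phi>. test_function \<Omega> \<phi> \<longrightarrow> (\<forall>b\<in>Basis.
        (\<integral>x. u x * frechet_derivative \<phi> (at x) b \<partial>lebesgue_on \<Omega>)
          = - (\<integral>x. (g x \<bullet> b) * \<phi> x \<partial>lebesgue_on \<Omega>)))"

definition H1 :: "'a::euclidean_space set \<Rightarrow> ('a \<Rightarrow> real) set" where
  "H1 \<Omega> = {u. square_integrable \<Omega> u \<and> (\<exists>g. is_weak_gradient \<Omega> u g)}"

text \<open>The weak gradient of a function in \<open>H1 \<Omega>\<close> is determined almost everywhere in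
  \<open>\<Omega>\<close>.\<close>

definition weak_gradient :: "'a::euclidean_space set \<Rightarrow> ('a \<Rightarrow> real) \<Rightarrow> 'a \<Rightarrow> 'a" where
  "weak_gradient \<Omega> u = (SOME g. is_weak_gradient \<Omega> u g)"

definition H1_norm :: "'a::euclidean_space set \<Rightarrow> ('a \<Rightarrow> real) \<Rightarrow> real" where
  "H1_norm \<Omega> u =
     sqrt ((\<integral>x. (u x)\<^sup>2 \<partial>lebesgue_on \<Omega>) + (\<integral>x. (norm (weak_gradient \<Omega> u x))\<^sup>2 \<partial>lebesgue_on \<Omega>))"

definition H10 :: "'a::euclidean_space set \<Rightarrow> ('a \<Rightarrow> real) set" where
  "H10 \<Omega> = {u \<in> H1 \<Omega>. \<exists>\<phi> :: nat \<Rightarrow> 'a \<Rightarrow> real.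
     (\<forall>j. test_function \<Omega> (\<phi> j)) \<and> (\<lambda>j. H1_norm \<Omega> (\<lambda>x. u x - \<phi> j x)) \<longlonglongrightarrow> 0}"

definition Linfty_norm :: "'a::euclidean_space set \<Rightarrow> ('a \<Rightarrow> real) \<Rightarrow> ereal" where
  "Linfty_norm \<Omega> u = esssup (lebesgue_on \<Omega>) (\<lambda>x. ereal \<bar>u x\<bar>)"


subsection \<open>Weak solutions of the differential inclusion\<close>

text \<open>Integrability of \<open>\<xi> v\<close> has to be demanded explicitly, since the Bochner integral of a
  non-integrable function is \<open>0\<close> by convention.\<close>

definition weak_solution ::
    "'a::euclidean_space set \<Rightarrow> (real \<Rightarrow> real) \<Rightarrow> (real \<Rightarrow> real) \<Rightarrow> real \<Rightarrow> ('a \<Rightarrow> real) \<Rightarrow> bool" where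
  "weak_solution \<Omega> F G lam u \<longleftrightarrow>
     u \<in> H10 \<Omega> \<and>
     (AE x in lebesgue_on \<Omega>. 0 \<le> u x) \<and>
     (\<exists>\<xi> \<in> borel_measurable (lebesgue_on \<Omega>).
        (AE x in lebesgue_on \<Omega>. \<xi> x \<in>
           {a + lam * b | a b. a \<in> clarke_gradient (zero_extension F) (u x) \<and>
                             b \<in> clarke_gradient (zero_extension G) (u x)}) \<and>
        (\<forall>v \<in> H10 \<Omega>.
           integrable (lebesgue_on \<Omega>) (\<lambda>x. \<xi> x * v x) \<and>
           (\<integral>x. weak_gradient \<Omega> u x \<bullet> weak_gradient \<Omega> v x \<partial>lebesgue_on \<Omega>)
             = (\<integral>x. \<xi> x * v x \<partial>lebesgue_on \<Omega>)))"

end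

theory Submission
  imports Defs "HOL-Complex_Analysis.Great_Picard"
begin

text \<open>
  For a level \<open>s\<close> at which \<open>max \<partial>F(s) < 0\<close>, truncate \<open>\<Phi> = F + \<lambda> G\<close> to \<open>[0, s]\<close>. The energy
  \<open>1/2 \<integral> |\<nabla>u|\<^sup>2 - \<integral> \<Phi>(u)\<close> of the truncated problem has a minimiser: by Rellich's theorem a
  minimising sequence of test functions has an \<open>L\<^sup>1\<close>-convergent subsequence, along which the gradients
  are Cauchy in \<open>L\<^sup>2\<close> by the parallelogram identity, so no weak topology is needed. The derivative
  of the quadratic part is bounded by an \<open>L\<^sup>1\<close>-norm, hence represented by some \<open>\<xi> \<in> L\<^sup>2\<close>, and
  comparing difference quotients shows \<open>\<xi> \<in> \<partial>\<Phi>(u)\<close> almost everywhere. Since \<open>\<Phi>\<close> decreases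
  just below \<open>s\<close> for small \<open>\<lambda>\<close>, testing with monotone functions of \<open>u\<close> confines \<open>u\<close> to
  \<open>[0, s - \<delta>]\<close>, where the truncation is invisible. As \<open>F(s)/s\<^sup>2\<close> is unbounded above, the minimal
  energies tend to \<open>-\<infinity>\<close> with \<open>s\<close>, whereas functions with values in \<open>[0, a]\<close> have energy
  bounded below; so a sufficiently sparse sequence of levels forces each minimiser to exceed the
  previous level. Only finitely many levels matter, so small \<open>\<lambda>\<close> does not spoil this.
\<close>


section \<open>Smooth functions with compact support\<close>

text \<open>The right-hand side is set valued: the multiplier has to be produced, and it has to lie
  in the sum of two gradients, not merely in the gradient of the sum. Clarke derivatives are
  therefore replaced by the suprema \<open>quot_sup\<close> over a countable shrinking family of
  neighbourhoods. These are real valued and Borel, so testing against nonnegative functions yields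
  countably many inequalities that hold simultaneously almost everywhere, and the rest is pointwise.
  On the line the gradients are intervals, which makes the splitting into a + lam * b elementary.

  The points where F(s)/s^2 is large and those where the gradient of F is negative may be far apart.
  The competitor of low energy has its height \<tau> at a point of the first kind; the truncation
  level is a later point of the second kind. Two margins are fixed before lam enters: a slope of
  decrease just below each level and an energy gap of 1. They determine the admissible lam, since F
  + lam G must still decrease there and the G-terms must not close the gap.\<close>

lemma C_k_Suc_imp: "C_k (Suc k) f \<Longrightarrow> C_k k f"
proof (induction k arbitrary: f)
  case 0
  then show ?case
    by (auto intro!: continuous_at_imp_continuous_on differentiable_imp_continuous_within)
next
  case (Suc k)
  have d: "f differentiable at x" for x
    using Suc.prems by simp
  have "C_k k (\<lambda>x. frechet_derivative f (at x) b)" if "b \<in> Basis" for b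
    using Suc.prems that by (intro Suc.IH) simp
  with d show ?case by simp
qed

lemma C_k_const: "C_k k (\<lambda>x. c)"
  by (induction k arbitrary: c) auto

lemma C_k_affine:
  fixes f :: "'a::euclidean_space \<Rightarrow> real"
  assumes "bounded_linear f"
  shows "C_k k (\<lambda>x. f x + c)"
proof (cases k)
  case 0
  then show ?thesis
    using assms by (simp add: continuous_on_add linear_continuous_on)
next
  case (Suc m)
  have "((\<lambda>x. f x + c) has_derivative f) (at x)" for x
    using assms by (auto intro!: derivative_eq_intros bounded_linear_imp_has_derivative)
  then have "frechet_derivative (\<lambda>x. f x + c) (at x) = f" "(\<lambda>x. f x + c) differentiable at x" for x
    by (auto simp: frechet_derivative_at[symmetric] differentiable_def)
  with Suc show ?thesis by (simp add: C_k_const)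
qed

lemma frechet_derivative_apply:
  "(f has_derivative f') (at x) \<Longrightarrow> frechet_derivative f (at x) b = f' b"
  by (simp add: frechet_derivative_at[symmetric])

lemma C_k_add: "C_k k f \<Longrightarrow> C_k k g \<Longrightarrow> C_k k (\<lambda>x. f x + g x)"
proof (induction k arbitrary: f g)
  case 0
  then show ?case by (auto intro!: continuous_intros)
next
  case (Suc k)
  have "frechet_derivative (\<lambda>x. f x + g x) (at x) b
      = frechet_derivative f (at x) b + frechet_derivative g (at x) b" for x b
    using Suc.prems by (intro frechet_derivative_apply has_derivative_add)
      (simp_all flip: frechet_derivative_works)
  with Suc show ?case by simp
qed

lemma C_k_mult: "C_k k f \<Longrightarrow> C_k k g \<Longrightarrow> C_k k (\<lambda>x. f x * g x)"
proof (induction k arbitrary: f g)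
  case 0
  then show ?case by (auto intro!: continuous_intros)
next
  case (Suc k)
  have "frechet_derivative (\<lambda>x. f x * g x) (at x) b
      = f x * frechet_derivative g (at x) b + frechet_derivative f (at x) b * g x" for x b
    using Suc.prems by (intro frechet_derivative_apply has_derivative_mult)
      (simp_all flip: frechet_derivative_works)
  moreover have "C_k k f" "C_k k g"
    using Suc.prems by (auto intro: C_k_Suc_imp)
  ultimately show ?case using Suc by (simp add: C_k_add)
qed

text \<open>The power of \<open>inverse t\<close> makes this family closed under differentiation up
  to linear combinations, so one induction over the order with \<open>m\<close> arbitrary covers all
  derivatives of the classical function exp(-1/t).\<close>

definition flat_exp :: "nat \<Rightarrow> real \<Rightarrow> real" where
  "flat_exp m t = (if t \<le> 0 then 0 else exp (- inverse t) * inverse t ^ m)"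

lemma flat_exp_tendsto_0: "(flat_exp m \<longlongrightarrow> 0) (at 0)"
proof -
  have "((\<lambda>t. inverse t ^ m / exp (inverse t)) \<longlongrightarrow> (0::real)) (at_right 0)"
    using filterlim_compose[OF tendsto_power_div_exp_0 filterlim_inverse_at_top_right] .
  then have "(flat_exp m \<longlongrightarrow> 0) (at_right 0)"
    by (rule Lim_transform_eventually)
      (auto simp: flat_exp_def eventually_at_filter exp_minus field_simps)
  moreover have "(flat_exp m \<longlongrightarrow> 0) (at_left 0)"
    by (rule Lim_transform_eventually[OF tendsto_const])
      (auto simp: flat_exp_def eventually_at_filter)
  ultimately show ?thesis
    by (simp add: filterlim_split_at)
qed

lemma flat_exp_has_derivative:
  "(flat_exp m has_real_derivative flat_exp (m + 2) t - real m * flat_exp (m + 1) t) (at t)"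
proof -
  consider "t < 0" | "t = 0" | "t > 0" by linarith
  then show ?thesis
  proof cases
    case 1
    have "((\<lambda>_. 0) has_real_derivative 0) (at t)" by simp
    then have "(flat_exp m has_real_derivative 0) (at t)"
      by (rule has_field_derivative_transform_within_open[where S="{..<0}"])
        (use 1 in \<open>auto simp: flat_exp_def\<close>)
    with 1 show ?thesis by (simp add: flat_exp_def)
  next
    case 2
    \<comment> \<open>At the origin the difference quotient of index m is itself
      \<open>flat_exp (Suc m)\<close>, whose limit is already known.\<close>
    have "((\<lambda>h. (flat_exp m (0 + h) - flat_exp m 0) / h) \<longlongrightarrow> 0) (at 0)"
      by (rule Lim_transform_eventually[OF flat_exp_tendsto_0[of "Suc m"]])
        (auto simp: flat_exp_def eventually_at_filter field_simps)
    then have "(flat_exp m has_real_derivative 0) (at 0)"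
      by (simp add: DERIV_def)
    with 2 show ?thesis by (simp add: flat_exp_def)
  next
    case 3
    \<comment> \<open>The derivative of the power carries the truncated exponent
      \<open>m - 1\<close>; for m = 0 the factor \<open>real m\<close> vanishes and makes the
      equation true.\<close>
    have eq: "real m * (inverse t ^ (m - 1) * (inverse t * inverse t)) = real m * inverse t ^ (m + 1)"
      by (cases m) auto
    have "((\<lambda>t. exp (- inverse t) * inverse t ^ m) has_real_derivative
       exp (- inverse t) * inverse t ^ (m + 2) - real m * (exp (- inverse t) * inverse t ^ (m + 1))) (at t)"
      using 3 eq by (auto intro!: derivative_eq_intros simp: power2_eq_square algebra_simps)
    then have "(flat_exp m has_real_derivative
       exp (- inverse t) * inverse t ^ (m + 2) - real m * (exp (- inverse t) * inverse t ^ (m + 1))) (at t)"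
      by (rule has_field_derivative_transform_within_open[where S="{0<..}"])
        (use 3 in \<open>auto simp: flat_exp_def\<close>)
    with 3 show ?thesis by (simp add: flat_exp_def)
  qed
qed

text \<open>The inner function is quadratic, so its partial derivatives are affine, and each
  differentiation yields products of affine functions with members of the same family of larger
  index.\<close>

lemma C_k_flat_exp_comp:
  fixes c :: "'a::euclidean_space"
  shows "C_k k (\<lambda>x. flat_exp m (r - (x - c) \<bullet> (x - c)))"
proof (induction k arbitrary: m)
  case 0
  have "isCont (flat_exp m) t" for t
    using flat_exp_has_derivative DERIV_isCont by blast
  then have "continuous_on UNIV (flat_exp m)"
    by (simp add: continuous_at_imp_continuous_on)
  then show ?case
    by (auto intro!: continuous_on_compose2[where f="\<lambda>x. r - (x - c) \<bullet> (x - c)"] continuous_intros)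
next
  case (Suc k)
  define q where "q x = r - (x - c) \<bullet> (x - c)" for x
  define q' where "q' x = (\<lambda>b. - (2 * ((x - c) \<bullet> b)))" for x
  have "(q has_derivative q' x) (at x)" for x
    unfolding q_def q'_def by (auto intro!: derivative_eq_intros simp: inner_commute)
  then have d: "((\<lambda>x. flat_exp m (q x)) has_derivative
     (\<lambda>b. (flat_exp (m + 2) (q x) + - (real m * flat_exp (m + 1) (q x))) * q' x b)) (at x)" for x
    using has_derivative_compose[of q "q' x" x UNIV "flat_exp m"] flat_exp_has_derivative[of m "q x"]
    unfolding has_field_derivative_def by simp
  have a: "C_k k (\<lambda>x. q' x b)" for b
  proof -
    have "bounded_linear (\<lambda>x. x \<bullet> (- 2 *\<^sub>R b))"
      by (rule bounded_linear_inner_left)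
    from C_k_affine[OF this, of k "2 * (c \<bullet> b)"] show ?thesis
      by (simp add: q'_def inner_diff_left algebra_simps)
  qed
  have IH: "C_k k (\<lambda>x. flat_exp m (q x))" for m
    using Suc.IH[of m] by (simp add: q_def)
  have "C_k k (\<lambda>x. (flat_exp (m + 2) (q x) + - (real m * flat_exp (m + 1) (q x))) * q' x b)" for b
    using C_k_mult[OF C_k_add[OF IH C_k_mult[OF C_k_const[of _ "- real m"] IH]] a] by simp
  then show ?case
    using d unfolding q_def[symmetric] by (auto simp: frechet_derivative_apply[OF d] differentiable_def)
qed

section \<open>The algebra of test functions\<close>

lemma test_function_add:
  assumes "test_function \<Omega> f" "test_function \<Omega> g"
  shows "test_function \<Omega> (\<lambda>x. f x + g x)"
proof -
  have sub: "closure {x. f x + g x \<noteq> 0} \<subseteq> closure {x. f x \<noteq> 0} \<union> closure {x. g x \<noteq> 0}"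
    unfolding closure_Un[symmetric] by (rule closure_mono) auto
  with assms show ?thesis
    using compact_Un[of "closure {x. f x \<noteq> 0}" "closure {x. g x \<noteq> 0}"]
      closed_Int_compact[of "closure {x. f x + g x \<noteq> 0}"
        "closure {x. f x \<noteq> 0} \<union> closure {x. g x \<noteq> 0}"]
    unfolding test_function_def by (auto simp: C_k_add Int_absorb2)
qed

lemma test_function_C_k_mult:
  assumes "test_function \<Omega> f" "\<And>k. C_k k g"
  shows "test_function \<Omega> (\<lambda>x. f x * g x)"
proof -
  have sub: "closure {x. f x * g x \<noteq> 0} \<subseteq> closure {x. f x \<noteq> 0}"
    by (rule closure_mono) auto
  with assms show ?thesis
    using closed_Int_compact[of "closure {x. f x * g x \<noteq> 0}" "closure {x. f x \<noteq> 0}"]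
    unfolding test_function_def by (auto simp: C_k_mult Int_absorb2)
qed

lemma test_function_mult:
  "test_function \<Omega> f \<Longrightarrow> test_function \<Omega> g \<Longrightarrow> test_function \<Omega> (\<lambda>x. f x * g x)"
  by (rule test_function_C_k_mult) (auto simp: test_function_def)

lemma test_function_cmult: "test_function \<Omega> f \<Longrightarrow> test_function \<Omega> (\<lambda>x. c * f x)"
  using test_function_C_k_mult[OF _ C_k_const, of \<Omega> f c] by (simp add: mult.commute)

lemma test_function_diff:
  "test_function \<Omega> f \<Longrightarrow> test_function \<Omega> g \<Longrightarrow> test_function \<Omega> (\<lambda>x. f x - g x)"
  using test_function_add[OF _ test_function_cmult[of _ g "-1"]] by simp

lemma test_function_zero: "test_function \<Omega> (\<lambda>x. 0)"
  by (simp add: test_function_def C_k_const)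

text \<open>That the nonvanishing set is the whole open ball, and not merely contained in it, is
  what later lets countably many bumps detect every point of an open set.\<close>

lemma test_function_bump:
  fixes c :: "'a::euclidean_space"
  assumes "cball c r \<subseteq> \<Omega>" "0 < r"
  obtains \<eta> where "test_function \<Omega> \<eta>" "\<And>x. 0 \<le> \<eta> x" "\<And>x. \<eta> x \<le> 1"
    "{x. \<eta> x \<noteq> 0} = ball c r"
proof
  let ?\<eta> = "\<lambda>x. flat_exp 0 (r\<^sup>2 - (x - c) \<bullet> (x - c))"
  have "(x - c) \<bullet> (x - c) < r\<^sup>2 \<longleftrightarrow> x \<in> ball c r" for x
  proof -
    have "(x - c) \<bullet> (x - c) = (dist c x)\<^sup>2"
      by (simp add: dot_square_norm dist_norm norm_minus_commute)
    moreover have "(dist c x)\<^sup>2 < r\<^sup>2 \<longleftrightarrow> dist c x < r"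
      using assms(2) by (smt (verit) power_mono power_strict_mono zero_le_dist zero_less_numeral)
    ultimately show ?thesis by simp
  qed
  moreover have "?\<eta> x \<noteq> 0 \<longleftrightarrow> (x - c) \<bullet> (x - c) < r\<^sup>2" for x
    by (simp add: flat_exp_def not_le)
  ultimately show *: "{x. ?\<eta> x \<noteq> 0} = ball c r"
    by blast
  show "test_function \<Omega> ?\<eta>"
    unfolding test_function_def * using assms by (simp add: C_k_flat_exp_comp)
  show "0 \<le> ?\<eta> x" "?\<eta> x \<le> 1" for x
    by (simp_all add: flat_exp_def)
qed

section \<open>Square integrable functions\<close>

text \<open>Formulated for an arbitrary measure, because estimates are moved between
  \<open>lborel\<close>, where translations preserve integrals, and the Lebesgue measure restricted
  to the domain.\<close>

definition L2 :: "'a measure \<Rightarrow> ('a \<Rightarrow> 'b::euclidean_space) \<Rightarrow> bool" where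
  "L2 M f \<longleftrightarrow> f \<in> borel_measurable M \<and> integrable M (\<lambda>x. (norm (f x))\<^sup>2)"

abbreviation sqn :: "'a measure \<Rightarrow> ('a \<Rightarrow> 'b::euclidean_space) \<Rightarrow> real" where
  "sqn M f \<equiv> \<integral>x. (norm (f x))\<^sup>2 \<partial>M"

lemma L2_measurable [measurable_dest]: "L2 M f \<Longrightarrow> f \<in> borel_measurable M"
  and L2_integrable: "L2 M f \<Longrightarrow> integrable M (\<lambda>x. (norm (f x))\<^sup>2)"
  by (auto simp: L2_def)

lemma sqn_nonneg [simp]: "0 \<le> sqn M f"
  by (intro integral_nonneg_AE) auto

lemma norm_add_sq_le: "(norm (a + b))\<^sup>2 \<le> 2 * (norm a)\<^sup>2 + 2 * (norm b)\<^sup>2"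
  for a b :: "'a::real_normed_vector"
proof -
  have "(norm (a + b))\<^sup>2 \<le> (norm a + norm b)\<^sup>2"
    by (intro power_mono norm_triangle_ineq) simp
  also have "\<dots> \<le> 2 * (norm a)\<^sup>2 + 2 * (norm b)\<^sup>2"
    by (smt (verit) sum_squares_bound power2_sum)
  finally show ?thesis .
qed

lemma L2_bound:
  assumes "L2 M f" "g \<in> borel_measurable M" "\<And>x. x \<in> space M \<Longrightarrow> norm (g x) \<le> norm (f x)"
  shows "L2 M g"
  unfolding L2_def
proof
  show "integrable M (\<lambda>x. (norm (g x))\<^sup>2)"
    using assms by (intro Bochner_Integration.integrable_bound[OF L2_integrable[OF assms(1)]])
      (auto intro!: power_mono AE_I2)
qed fact

lemma L2_add:
  assumes f: "L2 M f" and g: "L2 M g"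
  shows "L2 M (\<lambda>x. f x + g x)"
  unfolding L2_def
proof
  show "integrable M (\<lambda>x. (norm (f x + g x))\<^sup>2)"
  proof (rule Bochner_Integration.integrable_bound)
    show "integrable M (\<lambda>x. 2 * (norm (f x))\<^sup>2 + 2 * (norm (g x))\<^sup>2)"
      using f g by (auto simp: L2_def)
  qed (use f g in \<open>auto simp: L2_def intro!: AE_I2 norm_add_sq_le\<close>)
qed (use f g in \<open>auto simp: L2_def\<close>)

lemma L2_scaleR: "L2 M f \<Longrightarrow> L2 M (\<lambda>x. c *\<^sub>R f x)"
  by (auto simp: L2_def power_mult_distrib)

lemma L2_cmult: "L2 M f \<Longrightarrow> L2 M (\<lambda>x. c * f x)" for f :: "'a \<Rightarrow> real"
  using L2_scaleR[of M f c] by simp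

lemma L2_diff: "L2 M f \<Longrightarrow> L2 M g \<Longrightarrow> L2 M (\<lambda>x. f x - g x)"
  using L2_add[OF _ L2_scaleR[of M g "-1"]] by simp

lemma L2_inner_const:
  assumes "L2 M f"
  shows "L2 M (\<lambda>x. f x \<bullet> b)"
proof (rule L2_bound[OF L2_scaleR[OF assms, of "norm b"]])
  show "norm (f x \<bullet> b) \<le> norm (norm b *\<^sub>R f x)" for x
    by (simp add: Cauchy_Schwarz_ineq2 mult.commute[of "norm b"])
  show "(\<lambda>x. f x \<bullet> b) \<in> borel_measurable M"
    using L2_measurable[OF assms] by simp
qed

lemma sqn_scaleR: "sqn M (\<lambda>x. c *\<^sub>R f x) = c\<^sup>2 * sqn M f"
  by (simp add: power_mult_distrib)

text \<open>A substitute for the triangle inequality that avoids square roots; the factor 2 is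
  harmless where only convergence to 0 is at stake.\<close>

lemma sqn_add_le:
  assumes f: "L2 M f" and g: "L2 M g"
  shows "sqn M (\<lambda>x. f x + g x) \<le> 2 * sqn M f + 2 * sqn M g"
proof -
  have "sqn M (\<lambda>x. f x + g x) \<le> (\<integral>x. 2 * (norm (f x))\<^sup>2 + 2 * (norm (g x))\<^sup>2 \<partial>M)"
    using f g L2_add[OF f g] by (intro integral_mono) (auto simp: L2_def norm_add_sq_le)
  also have "\<dots> = 2 * sqn M f + 2 * sqn M g"
    using f g by (simp add: L2_def)
  finally show ?thesis .
qed

lemma sqn_diff_le:
  assumes "L2 M f" "L2 M g" "L2 M h"
  shows "sqn M (\<lambda>x. f x - h x) \<le> 2 * sqn M (\<lambda>x. f x - g x) + 2 * sqn M (\<lambda>x. g x - h x)"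
  using sqn_add_le[OF L2_diff[OF assms(1,2)] L2_diff[OF assms(2,3)]] by simp

lemma L2_norm_mult_integrable:
  assumes f: "L2 M f" and g: "L2 M g"
  shows "integrable M (\<lambda>x. norm (f x) * norm (g x))"
proof (rule Bochner_Integration.integrable_bound)
  show "integrable M (\<lambda>x. (norm (f x))\<^sup>2 + (norm (g x))\<^sup>2)"
    using f g by (auto simp: L2_def)
  have "norm (f x) * norm (g x) \<le> (norm (f x))\<^sup>2 + (norm (g x))\<^sup>2" for x
  proof -
    have "2 * (norm (f x) * norm (g x)) \<le> (norm (f x))\<^sup>2 + (norm (g x))\<^sup>2"
      using sum_squares_bound[of "norm (f x)" "norm (g x)"] by (simp only: mult.assoc)
    moreover have "0 \<le> norm (f x) * norm (g x)" by simp
    ultimately show ?thesis by linarith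
  qed
  then show "AE x in M. norm (norm (f x) * norm (g x)) \<le> norm ((norm (f x))\<^sup>2 + (norm (g x))\<^sup>2)"
    by (auto simp: abs_mult)
qed (use f g in \<open>auto simp: L2_def\<close>)

lemma L2_inner_integrable:
  assumes f: "L2 M f" and g: "L2 M g"
  shows "integrable M (\<lambda>x. f x \<bullet> g x)"
proof (rule Bochner_Integration.integrable_bound[OF L2_norm_mult_integrable[OF f g]])
  show "AE x in M. norm (f x \<bullet> g x) \<le> norm (norm (f x) * norm (g x))"
    by (simp add: Cauchy_Schwarz_ineq2 abs_mult)
qed (use f g in \<open>auto simp: L2_def\<close>)

lemma L2_mult_integrable: "L2 M f \<Longrightarrow> L2 M g \<Longrightarrow> integrable M (\<lambda>x. f x * g x)" for f g :: "'a \<Rightarrow> real"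
  using L2_inner_integrable[of M f g] by simp

text \<open>The integral of a square is a nonnegative quadratic polynomial in t, so its discriminant
  cannot be positive.\<close>

lemma L2_Cauchy_Schwarz:
  assumes f: "L2 M f" and g: "L2 M g"
  shows "(\<integral>x. norm (f x) * norm (g x) \<partial>M) \<le> sqrt (sqn M f) * sqrt (sqn M g)"
proof -
  let ?A = "sqn M f" and ?B = "sqn M g" and ?C = "\<integral>x. norm (f x) * norm (g x) \<partial>M"
  have C0: "0 \<le> ?C" by (intro integral_nonneg_AE) auto
  have q: "0 \<le> t\<^sup>2 * ?A - 2 * t * ?C + ?B" for t
  proof -
    have "0 \<le> (\<integral>x. (t * norm (f x) - norm (g x))\<^sup>2 \<partial>M)"
      by (intro integral_nonneg_AE) auto
    also have "\<dots> = (\<integral>x. t\<^sup>2 * (norm (f x))\<^sup>2 - 2 * t * (norm (f x) * norm (g x)) + (norm (g x))\<^sup>2 \<partial>M)"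
      by (intro Bochner_Integration.integral_cong) (auto simp: power2_diff power_mult_distrib)
    also have "\<dots> = t\<^sup>2 * ?A - 2 * t * ?C + ?B"
      using L2_integrable[OF f] L2_integrable[OF g] L2_norm_mult_integrable[OF f g] by simp
    finally show ?thesis .
  qed
  have "?C\<^sup>2 \<le> ?A * ?B"
  proof (cases "?A = 0")
    case True
    have "?C = 0"
    proof (rule ccontr)
      assume "?C \<noteq> 0"
      \<comment> \<open>For \<open>?A = 0\<close> the polynomial is affine in t, and at this t it
        takes the value -1.\<close>
      with q[of "(?B + 1) / (2 * ?C)"] True show False by simp
    qed
    then show ?thesis by simp
  next
    case False
    then have A: "?A > 0" using sqn_nonneg[of M f] by linarith
    have "0 \<le> ?A * ((?C / ?A)\<^sup>2 * ?A - 2 * (?C / ?A) * ?C + ?B)"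
      using q[of "?C / ?A"] A by (intro mult_nonneg_nonneg) auto
    also have "\<dots> = ?A * ?B - ?C\<^sup>2"
      using A by (simp add: field_simps power2_eq_square)
    finally show ?thesis by simp
  qed
  then have "sqrt (?C\<^sup>2) \<le> sqrt (?A * ?B)" by (rule real_sqrt_le_mono)
  with C0 show ?thesis by (simp add: real_sqrt_mult)
qed

lemma L2_inner_le:
  assumes f: "L2 M f" and g: "L2 M g"
  shows "\<bar>\<integral>x. f x \<bullet> g x \<partial>M\<bar> \<le> sqrt (sqn M f) * sqrt (sqn M g)"
proof -
  have "\<bar>\<integral>x. f x \<bullet> g x \<partial>M\<bar> \<le> (\<integral>x. \<bar>f x \<bullet> g x\<bar> \<partial>M)"
    by (rule integral_abs_bound)
  also have "\<dots> \<le> (\<integral>x. norm (f x) * norm (g x) \<partial>M)"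
    using L2_inner_integrable[OF f g] L2_norm_mult_integrable[OF f g]
    by (intro integral_mono) (auto simp: Cauchy_Schwarz_ineq2)
  also note L2_Cauchy_Schwarz[OF f g]
  finally show ?thesis .
qed

text \<open>The pairing is expanded around the limits; Cauchy-Schwarz sends the three terms that
  contain a difference to 0.\<close>

lemma L2_inner_tendsto:
  assumes f: "\<And>n. L2 M (fs n)" "L2 M f" "(\<lambda>n. sqn M (\<lambda>x. fs n x - f x)) \<longlonglongrightarrow> 0"
    and g: "\<And>n. L2 M (gs n)" "L2 M g" "(\<lambda>n. sqn M (\<lambda>x. gs n x - g x)) \<longlonglongrightarrow> 0"
  shows "(\<lambda>n. \<integral>x. fs n x \<bullet> gs n x \<partial>M) \<longlonglongrightarrow> (\<integral>x. f x \<bullet> g x \<partial>M)"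
proof -
  have df: "L2 M (\<lambda>x. fs n x - f x)" and dg: "L2 M (\<lambda>x. gs n x - g x)" for n
    using f g by (auto intro: L2_diff)
  have sf: "(\<lambda>n. sqrt (sqn M (\<lambda>x. fs n x - f x))) \<longlonglongrightarrow> 0"
    and sg: "(\<lambda>n. sqrt (sqn M (\<lambda>x. gs n x - g x))) \<longlonglongrightarrow> 0"
    using tendsto_real_sqrt[OF f(3)] tendsto_real_sqrt[OF g(3)] by simp_all
  have 1: "(\<lambda>n. \<integral>x. (fs n x - f x) \<bullet> (gs n x - g x) \<partial>M) \<longlonglongrightarrow> 0"
    by (rule tendsto_0_le[where K=1, OF tendsto_mult_zero[OF sf sg]])
      (use L2_inner_le[OF df dg] in \<open>simp add: abs_mult\<close>)
  have 2: "(\<lambda>n. \<integral>x. (fs n x - f x) \<bullet> g x \<partial>M) \<longlonglongrightarrow> 0"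
    by (rule tendsto_0_le[where K=1, OF tendsto_mult_left_zero[OF sf, of "sqrt (sqn M g)"]])
      (use L2_inner_le[OF df g(2)] in \<open>simp add: abs_mult\<close>)
  have 3: "(\<lambda>n. \<integral>x. f x \<bullet> (gs n x - g x) \<partial>M) \<longlonglongrightarrow> 0"
    by (rule tendsto_0_le[where K=1, OF tendsto_mult_right_zero[OF sg, of "sqrt (sqn M f)"]])
      (use L2_inner_le[OF f(2) dg] in \<open>simp add: abs_mult\<close>)
  have eq: "(\<integral>x. fs n x \<bullet> gs n x \<partial>M) = (\<integral>x. (fs n x - f x) \<bullet> (gs n x - g x) \<partial>M)
      + (\<integral>x. (fs n x - f x) \<bullet> g x \<partial>M) + (\<integral>x. f x \<bullet> (gs n x - g x) \<partial>M) + (\<integral>x. f x \<bullet> g x \<partial>M)" for n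
  proof -
    have "(\<integral>x. fs n x \<bullet> gs n x \<partial>M) = (\<integral>x. (fs n x - f x) \<bullet> (gs n x - g x)
       + (fs n x - f x) \<bullet> g x + f x \<bullet> (gs n x - g x) + f x \<bullet> g x \<partial>M)"
      by (intro Bochner_Integration.integral_cong) (auto simp: inner_diff_left inner_diff_right)
    also have "\<dots> = (\<integral>x. (fs n x - f x) \<bullet> (gs n x - g x) \<partial>M)
      + (\<integral>x. (fs n x - f x) \<bullet> g x \<partial>M) + (\<integral>x. f x \<bullet> (gs n x - g x) \<partial>M) + (\<integral>x. f x \<bullet> g x \<partial>M)"
      using L2_inner_integrable[OF df dg] L2_inner_integrable[OF df g(2)]
        L2_inner_integrable[OF f(2) dg] L2_inner_integrable[OF f(2) g(2)]
      by (simp only: Bochner_Integration.integral_add Bochner_Integration.integrable_add)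
    finally show ?thesis .
  qed
  show ?thesis
    unfolding eq using tendsto_add[OF tendsto_add[OF tendsto_add[OF 1 2] 3] tendsto_const] by simp
qed

lemma sqn_tendsto:
  assumes "\<And>n. L2 M (fs n)" "L2 M f" "(\<lambda>n. sqn M (\<lambda>x. fs n x - f x)) \<longlonglongrightarrow> 0"
  shows "(\<lambda>n. sqn M (fs n)) \<longlonglongrightarrow> sqn M f"
  using L2_inner_tendsto[OF assms assms] by (simp add: power2_norm_eq_inner)

lemma sqn_tendsto_0_AE_subseq:
  assumes "\<And>n. L2 M (fs n)" "L2 M f" "(\<lambda>n. sqn M (\<lambda>x. fs n x - f x)) \<longlonglongrightarrow> 0"
  obtains r where "strict_mono (r :: nat \<Rightarrow> nat)" "AE x in M. (\<lambda>n. fs (r n) x) \<longlonglongrightarrow> f x"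
proof -
  have d: "L2 M (\<lambda>x. fs n x - f x)" for n
    using assms by (auto intro: L2_diff)
  obtain r where r: "strict_mono (r :: nat \<Rightarrow> nat)"
    "AE x in M. (\<lambda>n. (norm (fs (r n) x - f x))\<^sup>2) \<longlonglongrightarrow> 0"
    using tendsto_L1_AE_subseq[of M "\<lambda>n x. (norm (fs n x - f x))\<^sup>2"] assms(3) L2_integrable[OF d]
    by auto
  have "AE x in M. (\<lambda>n. fs (r n) x) \<longlonglongrightarrow> f x"
    using r(2)
  proof eventually_elim
    case (elim x)
    then have "(\<lambda>n. sqrt ((norm (fs (r n) x - f x))\<^sup>2)) \<longlonglongrightarrow> sqrt 0"
      by (rule tendsto_real_sqrt)
    then have "(\<lambda>n. norm (fs (r n) x - f x)) \<longlonglongrightarrow> 0" by simp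
    then show ?case by (simp add: LIM_zero_cancel tendsto_norm_zero_iff)
  qed
  with r(1) that show ?thesis by blast
qed

text \<open>The Riesz-Fischer argument: a subsequence with geometrically small increments converges
  almost everywhere, and Fatou's lemma turns the pointwise limit into a limit in the square
  norm.\<close>

lemma L2_complete:
  fixes fs :: "nat \<Rightarrow> 'a \<Rightarrow> 'b::euclidean_space"
  assumes L: "\<And>n. L2 M (fs n)"
    and C: "\<And>e. e > 0 \<Longrightarrow> \<exists>N. \<forall>m\<ge>N. \<forall>n\<ge>N. sqn M (\<lambda>x. fs m x - fs n x) < e"
  obtains f where "L2 M f" "(\<lambda>n. sqn M (\<lambda>x. fs n x - f x)) \<longlonglongrightarrow> 0"
proof -
  have dL: "L2 M (\<lambda>x. fs m x - fs n x)" for m n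
    using L by (auto intro: L2_diff)
  have [measurable]: "fs n \<in> borel_measurable M" for n
    using L by (simp add: L2_def)
  have nn: "(\<integral>\<^sup>+x. ennreal ((norm (fs m x - fs n x))\<^sup>2) \<partial>M) = ennreal (sqn M (\<lambda>x. fs m x - fs n x))" for m n
    by (intro nn_integral_eq_integral L2_integrable dL) auto
  have "\<exists>N. \<forall>k. \<forall>m\<ge>N k. \<forall>n\<ge>N k. sqn M (\<lambda>x. fs m x - fs n x) < (1/8) ^ k"
    using C by (intro choice) auto
  then obtain N where N: "\<And>k m n. m \<ge> N k \<Longrightarrow> n \<ge> N k \<Longrightarrow> sqn M (\<lambda>x. fs m x - fs n x) < (1/8) ^ k"
    by blast
  \<comment> \<open>The partial sums make \<open>r\<close> nondecreasing and at least
    \<open>N k\<close>; the added k makes it tend to infinity.\<close>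
  define r where "r k = (\<Sum>i\<le>k. N i) + k" for k
  have rN: "N k \<le> r k" for k
    unfolding r_def using member_le_sum[of k "{..k}" N] by simp
  have rS: "r k \<le> r (Suc k)" for k
    by (simp add: r_def)
  have rk: "k \<le> r k" for k by (simp add: r_def)
  \<comment> \<open>The squared increments have integral below (1/8)^k. The weights 2^k used next
    leave the summable bound (1/4)^k and are still large enough to make the unsquared increments
    summable.\<close>
  define d where "d k x = norm (fs (r (Suc k)) x - fs (r k) x)" for k x
  have [measurable]: "d k \<in> borel_measurable M" for k
    unfolding d_def by measurable
  have "(\<integral>\<^sup>+x. (\<Sum>k. ennreal (2 ^ k * (d k x)\<^sup>2)) \<partial>M) = (\<Sum>k. \<integral>\<^sup>+x. ennreal (2 ^ k * (d k x)\<^sup>2) \<partial>M)"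
    by (rule nn_integral_suminf) measurable
  also have "\<dots> \<le> (\<Sum>k. ennreal ((1/4) ^ k))"
  proof (rule suminf_le[OF _ summableI summableI])
    fix k
    have "(\<integral>\<^sup>+x. ennreal (2 ^ k * (d k x)\<^sup>2) \<partial>M) = ennreal (2 ^ k) * (\<integral>\<^sup>+x. ennreal ((d k x)\<^sup>2) \<partial>M)"
      by (simp add: ennreal_mult nn_integral_cmult)
    also have "\<dots> = ennreal (2 ^ k) * ennreal (sqn M (\<lambda>x. fs (r (Suc k)) x - fs (r k) x))"
      unfolding d_def nn ..
    also have "\<dots> = ennreal (2 ^ k * sqn M (\<lambda>x. fs (r (Suc k)) x - fs (r k) x))"
      by (simp add: ennreal_mult)
    also have "\<dots> \<le> ennreal (2 ^ k * (1/8) ^ k)"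
      using N[of k "r (Suc k)" "r k"] rN[of k] rS[of k] by (intro ennreal_leI mult_left_mono) auto
    also have "2 ^ k * (1/8) ^ k = ((2 * (1/8)) ^ k :: real)"
      by (rule power_mult_distrib[symmetric])
    also have "2 * (1/8) = (1/4 :: real)" by simp
    finally show "(\<integral>\<^sup>+x. ennreal (2 ^ k * (d k x)\<^sup>2) \<partial>M) \<le> ennreal ((1/4) ^ k)" .
  qed
  also have "\<dots> < \<infinity>"
  proof -
    have "(\<Sum>k. ennreal ((1/4) ^ k)) \<noteq> top"
      by (rule ennreal_suminf_neq_top) (auto intro: summable_geometric)
    then show ?thesis by (simp only: infinity_ennreal_def top.not_eq_extremum)
  qed
  finally have fin: "(\<integral>\<^sup>+x. (\<Sum>k. ennreal (2 ^ k * (d k x)\<^sup>2)) \<partial>M) < \<infinity>" .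
  have "AE x in M. (\<Sum>k. ennreal (2 ^ k * (d k x)\<^sup>2)) \<noteq> \<infinity>"
    by (rule nn_integral_noteq_infinite) (use fin in auto)
  then have conv: "AE x in M. convergent (\<lambda>k. fs (r k) x)"
  proof eventually_elim
    case (elim x)
    then have "summable (\<lambda>k. 2 ^ k * (d k x)\<^sup>2)"
      by (intro summable_suminf_not_top) auto
    moreover have "summable (\<lambda>k. (1/2) ^ k :: real)"
      by (rule summable_geometric) simp
    ultimately have s: "summable (\<lambda>k. 2 ^ k * (d k x)\<^sup>2 + (1/2) ^ k)"
      by (rule summable_add)
    have "d k x \<le> 2 ^ k * (d k x)\<^sup>2 + (1/2) ^ k" for k
    proof -
      have d0: "d k x \<ge> 0" by (simp add: d_def)
      have *: "d k x \<le> 2 ^ k * (d k x)\<^sup>2" if "d k x > (1/2) ^ k"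
      proof -
        have "1 \<le> 2 ^ k * d k x"
          using that by (simp add: power_one_over field_simps)
        from mult_left_mono[OF this d0] show ?thesis
          by (simp add: power2_eq_square ac_simps)
      qed
      have "0 \<le> 2 ^ k * (d k x)\<^sup>2" "0 \<le> ((1/2) ^ k :: real)" by auto
      with * show ?thesis by linarith
    qed
    then have "summable (\<lambda>k. d k x)"
      by (intro summable_comparison_test'[OF s, of 0]) (auto simp: d_def)
    then have "summable (\<lambda>k. fs (r (Suc k)) x - fs (r k) x)"
      unfolding d_def by (rule summable_norm_cancel)
    then have "convergent (\<lambda>n. \<Sum>k<n. fs (r (Suc k)) x - fs (r k) x)"
      by (simp add: summable_iff_convergent)
    then have "convergent (\<lambda>n. fs (r n) x - fs (r 0) x)"
      by (simp only: sum_lessThan_telescope[of "\<lambda>k. fs (r k) x"])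
    then show ?case
      using convergent_add[OF _ convergent_const[of "fs (r 0) x"]] by fastforce
  qed
  define f where "f x = lim (\<lambda>k. fs (r k) x)" for x
  have [measurable]: "f \<in> borel_measurable M"
    unfolding f_def by measurable
  have lim: "AE x in M. (\<lambda>k. fs (r k) x) \<longlonglongrightarrow> f x"
    using conv by eventually_elim (simp add: f_def convergent_LIMSEQ_iff)
  \<comment> \<open>Fatou along the subsequence, with the index n of the original sequence fixed;
    the Cauchy property bounds the integrals from \<open>K\<close> on.\<close>
  have key: "(\<integral>\<^sup>+x. ennreal ((norm (fs n x - f x))\<^sup>2) \<partial>M) \<le> ennreal e"
    if e: "e > 0" and n: "\<forall>m\<ge>K. sqn M (\<lambda>x. fs n x - fs m x) < e" for e n K
  proof -
    have "(\<integral>\<^sup>+x. ennreal ((norm (fs n x - f x))\<^sup>2) \<partial>M)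
        = (\<integral>\<^sup>+x. liminf (\<lambda>k. ennreal ((norm (fs n x - fs (r k) x))\<^sup>2)) \<partial>M)"
    proof (rule nn_integral_cong_AE)
      show "AE x in M. ennreal ((norm (fs n x - f x))\<^sup>2) = liminf (\<lambda>k. ennreal ((norm (fs n x - fs (r k) x))\<^sup>2))"
        using lim
      proof eventually_elim
        case (elim x)
        then have "(\<lambda>k. ennreal ((norm (fs n x - fs (r k) x))\<^sup>2)) \<longlonglongrightarrow> ennreal ((norm (fs n x - f x))\<^sup>2)"
          by (intro tendsto_intros) auto
        then show ?case by (intro lim_imp_Liminf[symmetric]) auto
      qed
    qed
    also have "\<dots> \<le> liminf (\<lambda>k. \<integral>\<^sup>+x. ennreal ((norm (fs n x - fs (r k) x))\<^sup>2) \<partial>M)"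
      by (rule nn_integral_liminf) measurable
    also have "\<dots> \<le> ennreal e"
    proof -
      have "eventually (\<lambda>k. (\<integral>\<^sup>+x. ennreal ((norm (fs n x - fs (r k) x))\<^sup>2) \<partial>M) \<le> ennreal e) sequentially"
      proof (rule eventually_sequentiallyI[of K])
        fix k assume "K \<le> k"
        then have "K \<le> r k" using rk[of k] by simp
        with n e show "(\<integral>\<^sup>+x. ennreal ((norm (fs n x - fs (r k) x))\<^sup>2) \<partial>M) \<le> ennreal e"
          unfolding nn by (intro ennreal_leI) auto
      qed
      then show ?thesis
        by (intro Liminf_le) auto
    qed
    finally show ?thesis .
  qed
  have intd: "integrable M (\<lambda>x. (norm (fs n x - f x))\<^sup>2) \<and> sqn M (\<lambda>x. fs n x - f x) \<le> e"
    if e: "e > 0" and n: "\<forall>m\<ge>K. sqn M (\<lambda>x. fs n x - fs m x) < e" for e n K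
  proof -
    have "(\<integral>\<^sup>+x. ennreal (norm ((norm (fs n x - f x))\<^sup>2)) \<partial>M) < \<infinity>"
      using key[OF e n] by (simp add: order_le_less_trans)
    then have i: "integrable M (\<lambda>x. (norm (fs n x - f x))\<^sup>2)"
      by (intro integrableI_bounded) auto
    moreover have "ennreal (sqn M (\<lambda>x. fs n x - f x)) \<le> ennreal e"
      using key[OF e n] nn_integral_eq_integral[OF i] by simp
    ultimately show ?thesis using e by simp
  qed
  obtain N1 where N1: "\<forall>m\<ge>N1. \<forall>n\<ge>N1. sqn M (\<lambda>x. fs m x - fs n x) < 1"
    using C[of 1] by auto
  have "L2 M (\<lambda>x. fs N1 x - f x)"
    using intd[of 1 N1 N1] N1 by (auto simp: L2_def)
  from L2_diff[OF L[of N1] this] have f: "L2 M f" by simp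
  have "(\<lambda>n. sqn M (\<lambda>x. fs n x - f x)) \<longlonglongrightarrow> 0"
  proof (rule LIMSEQ_I)
    fix e :: real assume "e > 0"
    then obtain K where K: "\<forall>m\<ge>K. \<forall>n\<ge>K. sqn M (\<lambda>x. fs m x - fs n x) < e / 2"
      using C[of "e/2"] by auto
    show "\<exists>no. \<forall>n\<ge>no. norm (sqn M (\<lambda>x. fs n x - f x) - 0) < e"
    proof (intro exI allI impI)
      fix n assume "n \<ge> K"
      then have "sqn M (\<lambda>x. fs n x - f x) \<le> e / 2"
        using intd[of "e/2" K n] K \<open>e > 0\<close> by auto
      with \<open>e > 0\<close> show "norm (sqn M (\<lambda>x. fs n x - f x) - 0) < e" by simp
    qed
  qed
  with f that show ?thesis by blast
qed

lemma (in finite_measure) L2_imp_integrable: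
  assumes "L2 M f"
  shows "integrable M f"
proof (rule Bochner_Integration.integrable_bound)
  show "integrable M (\<lambda>x. 1 + (norm (f x))\<^sup>2)"
    using L2_integrable[OF assms] by simp
  have "norm (f x) \<le> 1 + (norm (f x))\<^sup>2" for x
    using sum_squares_bound[of 1 "norm (f x)"] norm_ge_zero[of "f x"]
    by (simp del: norm_ge_zero)
  then show "AE x in M. norm (f x) \<le> norm (1 + (norm (f x))\<^sup>2)"
    by (auto simp: add_nonneg_nonneg abs_of_nonneg)
qed (use assms in \<open>simp add: L2_def\<close>)

lemma (in finite_measure) L1_le_L2:
  assumes "L2 M f"
  shows "(\<integral>x. norm (f x) \<partial>M) \<le> sqrt (sqn M f) * sqrt (measure M (space M))"
proof -
  have "L2 M (\<lambda>x. 1::real)" by (simp add: L2_def)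
  from L2_Cauchy_Schwarz[OF assms this] show ?thesis by simp
qed

section \<open>Translations and gradients\<close>

definition grad :: "('a::euclidean_space \<Rightarrow> real) \<Rightarrow> 'a \<Rightarrow> 'a" where
  "grad f x = (\<Sum>b\<in>Basis. frechet_derivative f (at x) b *\<^sub>R b)"

lemma grad_inner_Basis: "b \<in> Basis \<Longrightarrow> grad f x \<bullet> b = frechet_derivative f (at x) b"
  by (simp add: grad_def inner_sum_left inner_Basis if_distrib cong: if_cong)

lemma grad_inner:
  assumes "f differentiable at x"
  shows "grad f x \<bullet> h = frechet_derivative f (at x) h"
proof -
  have lin: "linear (frechet_derivative f (at x))"
    using assms by (rule linear_frechet_derivative)
  have "frechet_derivative f (at x) h = frechet_derivative f (at x) (\<Sum>b\<in>Basis. (h \<bullet> b) *\<^sub>R b)"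
    by (simp add: euclidean_representation)
  also have "\<dots> = (\<Sum>b\<in>Basis. (h \<bullet> b) * frechet_derivative f (at x) b)"
    using lin by (simp add: linear_sum linear_scale)
  also have "\<dots> = grad f x \<bullet> h"
    by (simp add: grad_def inner_sum_left inner_sum_right inner_commute[of _ h] mult.commute)
  finally show ?thesis ..
qed

lemma grad_has_derivative:
  assumes "f differentiable at x"
  shows "(f has_derivative (\<lambda>h. grad f x \<bullet> h)) (at x)"
proof -
  have "frechet_derivative f (at x) = (\<lambda>h. grad f x \<bullet> h)"
    by (simp add: grad_inner[OF assms])
  with frechet_derivative_works[THEN iffD1, OF assms] show ?thesis by simp
qed

lemma grad_unique:
  assumes "(f has_derivative (\<lambda>h. v \<bullet> h)) (at x)"
  shows "grad f x = v"
  by (rule euclidean_eqI) (simp add: grad_inner_Basis frechet_derivative_apply[OF assms])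

text \<open>No domain occurs here, because a translate of a test function need not be supported in
  the domain.\<close>

definition cont_csupp :: "('a::euclidean_space \<Rightarrow> 'b::euclidean_space) \<Rightarrow> bool" where
  "cont_csupp f \<longleftrightarrow> continuous_on UNIV f \<and> (\<exists>R. \<forall>x. R < norm x \<longrightarrow> f x = 0)"

lemma cont_csuppD_cont: "cont_csupp f \<Longrightarrow> continuous_on UNIV f"
  by (simp add: cont_csupp_def)

lemma cont_csupp_measurable: "cont_csupp f \<Longrightarrow> f \<in> borel_measurable borel"
  by (simp add: cont_csupp_def borel_measurable_continuous_onI)

lemma cont_csupp_integrable: 
  assumes "cont_csupp f"
  shows "integrable lborel f"
proof -
  obtain R where R: "\<And>x. R < norm x \<Longrightarrow> f x = 0"
    using assms by (auto simp: cont_csupp_def)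
  have "integrable lborel (\<lambda>x. indicator (cball 0 R) x *\<^sub>R f x)"
    using assms by (intro borel_integrable_compact) (auto simp: cont_csupp_def intro: continuous_on_subset)
  also have "(\<lambda>x. indicator (cball 0 R) x *\<^sub>R f x) = f"
    using R by (auto simp: fun_eq_iff indicator_def not_le)
  finally show ?thesis .
qed

lemma cont_csupp_bounded:
  assumes "cont_csupp f"
  obtains B where "0 < B" "\<And>x. norm (f x) \<le> B"
proof -
  obtain R where R: "\<And>x. R < norm x \<Longrightarrow> f x = 0"
    using assms by (auto simp: cont_csupp_def)
  have "compact (f ` cball 0 R)"
    using assms by (intro compact_continuous_image) (auto simp: cont_csupp_def intro: continuous_on_subset)
  then obtain B where B: "0 < B" "\<And>y. y \<in> f ` cball 0 R \<Longrightarrow> norm y \<le> B"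
    using bounded_pos compact_imp_bounded by metis
  have "norm (f x) \<le> B" for x
  proof (cases "R < norm x")
    case True
    then show ?thesis using R B(1) by auto
  next
    case False
    then show ?thesis by (intro B(2)) auto
  qed
  with B(1) that show ?thesis by blast
qed

lemma cont_csupp_shift:
  assumes "cont_csupp f"
  shows "cont_csupp (\<lambda>x. f (x + h))"
proof -
  obtain R where R: "\<And>x. R < norm x \<Longrightarrow> f x = 0"
    using assms by (auto simp: cont_csupp_def)
  have "continuous_on UNIV (\<lambda>x. f (x + h))"
    by (rule continuous_on_compose2[OF cont_csuppD_cont[OF assms], of UNIV "\<lambda>x. x + h"])
      (auto intro: continuous_on_add continuous_on_const continuous_on_id)
  moreover have "f (x + h) = 0" if "R + norm h < norm x" for x
    using that norm_triangle_ineq4[of "x + h" h] by (intro R) simp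
  ultimately show ?thesis unfolding cont_csupp_def by blast
qed

lemma cont_csupp_diff:
  assumes "cont_csupp f" "cont_csupp g"
  shows "cont_csupp (\<lambda>x. f x - g x)"
proof -
  obtain R R' where R: "\<And>x. R < norm x \<Longrightarrow> f x = 0" "\<And>x. R' < norm x \<Longrightarrow> g x = 0"
    using assms by (auto simp: cont_csupp_def)
  then have "\<exists>R. \<forall>x. R < norm x \<longrightarrow> f x - g x = 0"
    by (intro exI[of _ "max R R'"]) simp
  moreover have "continuous_on UNIV (\<lambda>x. f x - g x)"
    using assms by (intro continuous_on_diff cont_csuppD_cont)
  ultimately show ?thesis
    unfolding cont_csupp_def by blast
qed

lemma cont_csupp_norm: "cont_csupp f \<Longrightarrow> cont_csupp (\<lambda>x. norm (f x))"
  unfolding cont_csupp_def by (auto intro!: continuous_intros)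

lemma lborel_integral_shift:
  fixes f :: "'a::euclidean_space \<Rightarrow> 'b::euclidean_space"
  assumes "f \<in> borel_measurable borel"
  shows "(\<integral>x. f (x + h) \<partial>lborel) = (\<integral>x. f x \<partial>lborel)"
proof -
  have "(\<integral>x. f x \<partial>lborel) = (\<integral>x. f x \<partial>distr lborel borel ((+) h))"
    by (simp add: lborel_distr_plus)
  also have "\<dots> = (\<integral>x. f (h + x) \<partial>lborel)"
    using assms by (subst integral_distr) auto
  finally show ?thesis by (simp add: add.commute)
qed

section \<open>Gradients and difference quotients of test functions\<close>

lemma test_function_differentiable: "test_function \<Omega> \<phi> \<Longrightarrow> \<phi> differentiable at x"
  unfolding test_function_def by (metis C_k.simps(2))

lemma test_function_C_k_deriv:
  "test_function \<Omega> \<phi> \<Longrightarrow> b \<in> Basis \<Longrightarrow> C_k k (\<lambda>x. frechet_derivative \<phi> (at x) b)"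
  unfolding test_function_def by (metis C_k.simps(2))

lemma test_function_zero_outside: "test_function \<Omega> \<phi> \<Longrightarrow> x \<notin> \<Omega> \<Longrightarrow> \<phi> x = 0"
  unfolding test_function_def using closure_subset by (metis (mono_tags, lifting) mem_Collect_eq subsetD)

lemma test_function_grad_eq_0:
  assumes "test_function \<Omega> \<phi>" "x \<notin> closure {x. \<phi> x \<noteq> 0}"
  shows "grad \<phi> x = 0"
proof (rule grad_unique)
  have "((\<lambda>x. 0) has_derivative (\<lambda>h. 0)) (at x)" by simp
  then have "(\<phi> has_derivative (\<lambda>h. 0)) (at x)"
    by (rule has_derivative_transform_within_open[of _ _ _ _ "- closure {x. \<phi> x \<noteq> 0}"])
      (use assms(2) closure_subset[of "{x. \<phi> x \<noteq> 0}"] in \<open>auto simp: subset_iff\<close>)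
  then show "(\<phi> has_derivative (\<lambda>h. 0 \<bullet> h)) (at x)" by simp
qed

lemma test_function_grad_zero_outside: "test_function \<Omega> \<phi> \<Longrightarrow> x \<notin> \<Omega> \<Longrightarrow> grad \<phi> x = 0"
  using test_function_grad_eq_0[of \<Omega> \<phi> x] by (auto simp: test_function_def)

lemma test_function_cont_csupp:
  assumes "test_function \<Omega> \<phi>"
  shows "cont_csupp \<phi>" "cont_csupp (grad \<phi>)"
proof -
  have "bounded (closure {x. \<phi> x \<noteq> 0})"
    using assms by (auto simp: test_function_def intro: compact_imp_bounded)
  then obtain R where R: "\<And>x. x \<in> closure {x. \<phi> x \<noteq> 0} \<Longrightarrow> norm x \<le> R"
    by (auto simp: bounded_iff)
  have "C_k 0 \<phi>" using assms unfolding test_function_def by blast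
  moreover have "\<phi> x = 0" if "R < norm x" for x
    using R[of x] that closure_subset[of "{x. \<phi> x \<noteq> 0}"] by force
  ultimately show "cont_csupp \<phi>" by (auto simp: cont_csupp_def)
  have "continuous_on UNIV (\<lambda>x. frechet_derivative \<phi> (at x) b)" if "b \<in> Basis" for b
    using test_function_C_k_deriv[OF assms that, of 0] by simp
  then have "continuous_on UNIV (grad \<phi>)"
    unfolding grad_def by (intro continuous_intros)
  moreover have "grad \<phi> x = 0" if "R < norm x" for x
    using R[of x] that test_function_grad_eq_0[OF assms, of x] by force
  ultimately show "cont_csupp (grad \<phi>)" by (auto simp: cont_csupp_def)
qed

lemma test_function_has_derivative:
  "test_function \<Omega> \<phi> \<Longrightarrow> (\<phi> has_derivative (\<lambda>h. grad \<phi> x \<bullet> h)) (at x)"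
  by (intro grad_has_derivative test_function_differentiable)

lemma grad_add: "test_function \<Omega> \<phi> \<Longrightarrow> test_function \<Omega> \<psi> \<Longrightarrow> grad (\<lambda>x. \<phi> x + \<psi> x) x = grad \<phi> x + grad \<psi> x"
  by (intro grad_unique)
    (auto intro!: derivative_eq_intros test_function_has_derivative simp: inner_add_left)

lemma grad_cmult: "test_function \<Omega> \<phi> \<Longrightarrow> grad (\<lambda>x. c * \<phi> x) x = c *\<^sub>R grad \<phi> x"
  by (intro grad_unique) (auto intro!: derivative_eq_intros test_function_has_derivative)

lemma grad_diff: "test_function \<Omega> \<phi> \<Longrightarrow> test_function \<Omega> \<psi> \<Longrightarrow> grad (\<lambda>x. \<phi> x - \<psi> x) x = grad \<phi> x - grad \<psi> x"
  by (intro grad_unique)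
    (auto intro!: derivative_eq_intros test_function_has_derivative simp: inner_diff_left)

lemma grad_mult:
  "test_function \<Omega> \<phi> \<Longrightarrow> test_function \<Omega> \<psi> \<Longrightarrow>
    grad (\<lambda>x. \<phi> x * \<psi> x) x = \<phi> x *\<^sub>R grad \<psi> x + \<psi> x *\<^sub>R grad \<phi> x"
  by (intro grad_unique)
    (auto intro!: derivative_eq_intros test_function_has_derivative simp: inner_add_left)

lemma test_function_lipschitz:
  assumes \<phi>: "test_function \<Omega> \<phi>" and B: "\<And>x. norm (grad \<phi> x) \<le> B"
  shows "\<bar>\<phi> x - \<phi> y\<bar> \<le> B * norm (x - y)"
proof -
  have "onorm (\<lambda>h. grad \<phi> x \<bullet> h) \<le> B" for x
    using B[of x] by (intro onorm_bound order_trans[OF norm_ge_zero B])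
      (auto intro!: order_trans[OF Cauchy_Schwarz_ineq2] mult_right_mono)
  then show ?thesis
    using differentiable_bound[of UNIV \<phi> "\<lambda>x h. grad \<phi> x \<bullet> h" B x y] test_function_has_derivative[OF \<phi>]
    by auto
qed

lemma quotient_pointwise:
  assumes "test_function \<Omega> \<phi>"
  shows "(\<lambda>n. real (Suc n) * (\<phi> (x + h /\<^sub>R real (Suc n)) - \<phi> x)) \<longlonglongrightarrow> grad \<phi> x \<bullet> h"
proof -
  have "((\<lambda>t. \<phi> (x + t *\<^sub>R h)) has_derivative (\<lambda>t. grad \<phi> x \<bullet> (t *\<^sub>R h))) (at 0)"
  proof (rule has_derivative_compose[of "\<lambda>t. x + t *\<^sub>R h" "\<lambda>t. t *\<^sub>R h" 0 UNIV \<phi> "\<lambda>h. grad \<phi> x \<bullet> h"])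
    show "((\<lambda>t. x + t *\<^sub>R h) has_derivative (\<lambda>t. t *\<^sub>R h)) (at 0)"
      by (auto intro!: derivative_eq_intros)
  qed (use test_function_has_derivative[OF assms, of x] in simp)
  then have "((\<lambda>t. \<phi> (x + t *\<^sub>R h)) has_real_derivative (grad \<phi> x \<bullet> h)) (at 0)"
    by (rule has_derivative_imp_has_field_derivative) simp
  then have "((\<lambda>t. (\<phi> (x + t *\<^sub>R h) - \<phi> x) / t) \<longlongrightarrow> grad \<phi> x \<bullet> h) (at 0)"
    by (simp add: DERIV_def)
  moreover have "filterlim (\<lambda>n. inverse (real (Suc n))) (at 0) sequentially"
    using LIMSEQ_inverse_real_of_nat by (simp add: filterlim_at)
  ultimately have "(\<lambda>n. (\<phi> (x + inverse (real (Suc n)) *\<^sub>R h) - \<phi> x) / inverse (real (Suc n))) \<longlonglongrightarrow> grad \<phi> x \<bullet> h"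
    by (rule filterlim_compose)
  then show ?thesis
    by (simp add: divide_inverse mult.commute)
qed

text \<open>The steps h/(n+1) are no longer than h, so all quotients vanish outside one ball, and
  inside it the Lipschitz bound gives the constant B * norm h. This is the majorant for dominated
  convergence in the next two lemmas.\<close>

lemma quotient_dominated:
  assumes \<phi>: "test_function \<Omega> \<phi>"
  obtains w :: "'a::euclidean_space \<Rightarrow> real" where "integrable lborel w"
    "\<And>n x. \<bar>real (Suc n) * (\<phi> (x + h /\<^sub>R real (Suc n)) - \<phi> x)\<bar> \<le> w x"
proof -
  obtain R where R: "\<And>x. R < norm x \<Longrightarrow> \<phi> x = 0"
    using test_function_cont_csupp(1)[OF \<phi>] by (auto simp: cont_csupp_def)
  obtain B where B: "0 < B" "\<And>x. norm (grad \<phi> x) \<le> B"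
    using cont_csupp_bounded[OF test_function_cont_csupp(2)[OF \<phi>]] by metis
  define w :: "'a \<Rightarrow> real" where "w x = indicator (cball 0 (R + norm h)) x *\<^sub>R (B * norm h)" for x
  have "integrable lborel w"
    unfolding w_def by (intro borel_integrable_compact) auto
  moreover have "\<bar>real (Suc n) * (\<phi> (x + h /\<^sub>R real (Suc n)) - \<phi> x)\<bar> \<le> w x" for n x
  proof (cases "norm x \<le> R + norm h")
    case True
    have "\<bar>\<phi> (x + h /\<^sub>R real (Suc n)) - \<phi> x\<bar> \<le> B * norm (h /\<^sub>R real (Suc n))"
      using test_function_lipschitz[OF \<phi> B(2), of "x + h /\<^sub>R real (Suc n)" x] by (simp only: add_diff_cancel_left')
    then have "real (Suc n) * \<bar>\<phi> (x + h /\<^sub>R real (Suc n)) - \<phi> x\<bar> \<le> real (Suc n) * (B * norm (h /\<^sub>R real (Suc n)))"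
      by (intro mult_left_mono) auto
    also have "\<dots> = B * norm h" by (simp add: field_simps)
    finally show ?thesis using True by (simp only: abs_mult) (simp add: w_def)
  next
    case False
    have "norm (h /\<^sub>R real (Suc n)) \<le> norm h"
      using mult_left_le_one_le[of "norm h" "inverse (real (Suc n))"]
      by (simp add: inverse_le_1_iff)
    then have "R < norm (x + h /\<^sub>R real (Suc n))"
      using False norm_triangle_ineq4[of "x + h /\<^sub>R real (Suc n)" "h /\<^sub>R real (Suc n)"] by simp
    moreover have "R < norm x" using False norm_ge_zero[of h] by linarith
    ultimately show ?thesis using R False by (simp add: w_def)
  qed
  ultimately show ?thesis using that by blast
qed

text \<open>Translation invariance makes the integral of every difference quotient vanish, and the
  integral of the derivative is their limit.\<close>

lemma integral_grad_eq_0: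
  assumes \<phi>: "test_function \<Omega> \<phi>"
  shows "(\<integral>x. grad \<phi> x \<bullet> h \<partial>lborel) = 0"
proof -
  have cs: "cont_csupp \<phi>" "cont_csupp (grad \<phi>)" using test_function_cont_csupp[OF \<phi>] by auto
  note [measurable] = cont_csupp_measurable[OF cs(1)] cont_csupp_measurable[OF cs(2)]
  obtain w where w: "integrable lborel w"
    "\<And>n x. \<bar>real (Suc n) * (\<phi> (x + h /\<^sub>R real (Suc n)) - \<phi> x)\<bar> \<le> w x"
    using quotient_dominated[OF \<phi>, of h] by metis
  have "(\<lambda>n. \<integral>x. real (Suc n) * (\<phi> (x + h /\<^sub>R real (Suc n)) - \<phi> x) \<partial>lborel)
      \<longlonglongrightarrow> (\<integral>x. grad \<phi> x \<bullet> h \<partial>lborel)"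
    using w quotient_pointwise[OF \<phi>] by (intro integral_dominated_convergence[where w=w]) auto
  moreover have "(\<integral>x. real (Suc n) * (\<phi> (x + h /\<^sub>R real (Suc n)) - \<phi> x) \<partial>lborel) = 0" for n
  proof -
    have "(\<integral>x. real (Suc n) * (\<phi> (x + h /\<^sub>R real (Suc n)) - \<phi> x) \<partial>lborel)
        = real (Suc n) * (\<integral>x. \<phi> (x + h /\<^sub>R real (Suc n)) - \<phi> x \<partial>lborel)"
      by (rule integral_mult_right_zero)
    also have "(\<integral>x. \<phi> (x + h /\<^sub>R real (Suc n)) - \<phi> x \<partial>lborel) = 0"
      by (subst Bochner_Integration.integral_diff[OF cont_csupp_integrable[OF cont_csupp_shift[OF cs(1)]]
            cont_csupp_integrable[OF cs(1)]], subst lborel_integral_shift)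
        (use cs(1) cont_csupp_measurable in auto)
    finally show ?thesis by (simp only: mult_zero_right)
  qed
  ultimately have "(\<lambda>n::nat. 0::real) \<longlonglongrightarrow> (\<integral>x. grad \<phi> x \<bullet> h \<partial>lborel)"
    by (simp only:)
  then show ?thesis by (simp only: LIMSEQ_const_iff)
qed

text \<open>The L^1 modulus of translation \<open>D\<close> is subadditive, so \<open>D h\<close> is
  at most n times the modulus at h/n for every n; these multiples converge to the integral of the
  absolute directional derivative.\<close>

lemma translation_L1:
  assumes \<phi>: "test_function \<Omega> \<phi>"
  shows "(\<integral>x. \<bar>\<phi> (x + h) - \<phi> x\<bar> \<partial>lborel) \<le> norm h * (\<integral>x. norm (grad \<phi> x) \<partial>lborel)"
proof -
  have cs: "cont_csupp \<phi>" "cont_csupp (grad \<phi>)" using test_function_cont_csupp[OF \<phi>] by auto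
  note [measurable] = cont_csupp_measurable[OF cs(1)] cont_csupp_measurable[OF cs(2)]
  define D where "D h = (\<integral>x. \<bar>\<phi> (x + h) - \<phi> x\<bar> \<partial>lborel)" for h
  have int: "integrable lborel (\<lambda>x. \<bar>\<phi> (x + h) - \<phi> (x + k)\<bar>)" for h k
    using cont_csupp_integrable[OF cont_csupp_norm[OF cont_csupp_diff[OF cont_csupp_shift[OF cs(1)] cont_csupp_shift[OF cs(1)]]]]
    by simp
  have sub: "D (h + k) \<le> D h + D k" for h k
  proof -
    have "D (h + k) \<le> (\<integral>x. \<bar>\<phi> (x + h + k) - \<phi> (x + h)\<bar> + \<bar>\<phi> (x + h) - \<phi> x\<bar> \<partial>lborel)"
      unfolding D_def using int[of "h + k" 0] int[of "h + k" h] int[of h 0]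
      by (intro integral_mono) (auto simp: add.assoc)
    also have "\<dots> = (\<integral>x. \<bar>\<phi> (x + h + k) - \<phi> (x + h)\<bar> \<partial>lborel) + D h"
      unfolding D_def using int[of "h + k" h] int[of h 0]
      by (subst Bochner_Integration.integral_add) (simp_all only: add.assoc add_0_right)
    also have "(\<integral>x. \<bar>\<phi> (x + h + k) - \<phi> (x + h)\<bar> \<partial>lborel) = D k"
      unfolding D_def by (rule lborel_integral_shift[of "\<lambda>x. \<bar>\<phi> (x + k) - \<phi> x\<bar>"]) measurable
    finally show ?thesis by simp
  qed
  have mul: "D (real n *\<^sub>R h) \<le> real n * D h" for n h
  proof (induction n)
    case 0
    show ?case by (simp add: D_def)
  next
    case (Suc n)
    have "D (real (Suc n) *\<^sub>R h) \<le> D (real n *\<^sub>R h) + D h"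
      using sub[of "real n *\<^sub>R h" h] by (simp add: scaleR_add_left add.commute)
    with Suc show ?case by (simp add: algebra_simps)
  qed
  obtain w where w: "integrable lborel w"
    "\<And>n x. \<bar>real (Suc n) * (\<phi> (x + h /\<^sub>R real (Suc n)) - \<phi> x)\<bar> \<le> w x"
    using quotient_dominated[OF \<phi>, of h] by metis
  have "(\<lambda>n. \<integral>x. \<bar>real (Suc n) * (\<phi> (x + h /\<^sub>R real (Suc n)) - \<phi> x)\<bar> \<partial>lborel)
      \<longlonglongrightarrow> (\<integral>x. \<bar>grad \<phi> x \<bullet> h\<bar> \<partial>lborel)"
    using w tendsto_rabs[OF quotient_pointwise[OF \<phi>]] by (intro integral_dominated_convergence[where w=w]) auto
  moreover have "(\<integral>x. \<bar>real (Suc n) * (\<phi> (x + h /\<^sub>R real (Suc n)) - \<phi> x)\<bar> \<partial>lborel) \<ge> D h" for n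
  proof -
    have "(\<integral>x. \<bar>real (Suc n) * (\<phi> (x + h /\<^sub>R real (Suc n)) - \<phi> x)\<bar> \<partial>lborel) = real (Suc n) * D (h /\<^sub>R real (Suc n))"
      unfolding D_def abs_mult by (simp only: integral_mult_right_zero abs_of_nat)
    also have "\<dots> \<ge> D (real (Suc n) *\<^sub>R (h /\<^sub>R real (Suc n)))" by (rule mul)
    finally show ?thesis by simp
  qed
  ultimately have "D h \<le> (\<integral>x. \<bar>grad \<phi> x \<bullet> h\<bar> \<partial>lborel)"
    by (intro LIMSEQ_le_const) auto
  also have "\<dots> \<le> (\<integral>x. norm h * norm (grad \<phi> x) \<partial>lborel)"
  proof (rule integral_mono)
    show "integrable lborel (\<lambda>x. \<bar>grad \<phi> x \<bullet> h\<bar>)"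
      using cont_csupp_integrable[OF cs(2)] by auto
    show "integrable lborel (\<lambda>x. norm h * norm (grad \<phi> x))"
      using cont_csupp_integrable[OF cs(2)] by auto
  qed (simp add: Cauchy_Schwarz_ineq2 mult.commute[of "norm h"])
  finally show ?thesis by (simp add: D_def)
qed

section \<open>Poincare and Rellich inequalities\<close>

text \<open>A shift by the diameter 2R moves the domain off itself. A test function and its
  translate then have disjoint supports, and their L^1 distance is twice the norm of the
  function.\<close>

lemma poincare_L1:
  fixes \<Omega> :: "'a::euclidean_space set"
  assumes \<phi>: "test_function \<Omega> \<phi>" and R: "\<Omega> \<subseteq> ball 0 R" "0 < R"
  shows "(\<integral>x. \<bar>\<phi> x\<bar> \<partial>lborel) \<le> R * (\<integral>x. norm (grad \<phi> x) \<partial>lborel)"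
proof -
  obtain b :: 'a where b: "b \<in> Basis" using nonempty_Basis by blast
  define h where "h = (2 * R) *\<^sub>R b"
  have nh: "norm h = 2 * R" using b R by (simp add: h_def)
  have cs: "cont_csupp \<phi>" using test_function_cont_csupp[OF \<phi>] by auto
  note [measurable] = cont_csupp_measurable[OF cs]
  have int: "integrable lborel (\<lambda>x. \<bar>\<phi> x\<bar>)" "integrable lborel (\<lambda>x. \<bar>\<phi> (x + h)\<bar>)"
    using cont_csupp_integrable[OF cs] cont_csupp_integrable[OF cont_csupp_shift[OF cs]] by auto
  have "\<phi> x = 0 \<or> \<phi> (x + h) = 0" for x
  proof (rule ccontr)
    assume "\<not> ?thesis"
    then have "x \<in> \<Omega>" "x + h \<in> \<Omega>"
      using test_function_zero_outside[OF \<phi>] by blast+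
    then have "norm x < R" "norm (x + h) < R" using R by auto
    with nh norm_triangle_ineq4[of "x + h" x] show False by simp
  qed
  then have "\<bar>\<phi> (x + h) - \<phi> x\<bar> = \<bar>\<phi> (x + h)\<bar> + \<bar>\<phi> x\<bar>" for x
    by (metis abs_minus_cancel abs_zero add_0_left add_0_right diff_0 diff_0_right)
  then have "(\<integral>x. \<bar>\<phi> (x + h)\<bar> + \<bar>\<phi> x\<bar> \<partial>lborel) \<le> 2 * R * (\<integral>x. norm (grad \<phi> x) \<partial>lborel)"
    using translation_L1[OF \<phi>, of h] by (simp add: nh)
  also have "(\<integral>x. \<bar>\<phi> (x + h)\<bar> + \<bar>\<phi> x\<bar> \<partial>lborel) = 2 * (\<integral>x. \<bar>\<phi> x\<bar> \<partial>lborel)"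
    using int lborel_integral_shift[of "\<lambda>x. \<bar>\<phi> x\<bar>" h] by simp
  finally show ?thesis by simp
qed

lemma cont_csupp_L2: 
  assumes "cont_csupp f"
  shows "L2 lborel f"
proof -
  have "cont_csupp (\<lambda>x. (norm (f x))\<^sup>2)"
    using assms unfolding cont_csupp_def by (auto intro!: continuous_intros)
  then show ?thesis
    using cont_csupp_measurable[OF assms] cont_csupp_integrable by (auto simp: L2_def)
qed

text \<open>The L^1 inequality is applied to the square of the function; after Cauchy-Schwarz one
  factor of the norm cancels.\<close>

lemma poincare_L2:
  assumes \<phi>: "test_function \<Omega> \<phi>" and R: "\<Omega> \<subseteq> ball 0 R" "0 < R"
  shows "sqn lborel \<phi> \<le> 4 * R\<^sup>2 * sqn lborel (grad \<phi>)"
proof -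
  let ?a = "sqrt (sqn lborel \<phi>)" and ?g = "sqrt (sqn lborel (grad \<phi>))"
  have L: "L2 lborel \<phi>" "L2 lborel (grad \<phi>)"
    using test_function_cont_csupp[OF \<phi>] by (auto intro: cont_csupp_L2)
  have "sqn lborel \<phi> = (\<integral>x. \<bar>\<phi> x * \<phi> x\<bar> \<partial>lborel)"
    by (simp add: power2_eq_square)
  also have "\<dots> \<le> R * (\<integral>x. norm (grad (\<lambda>x. \<phi> x * \<phi> x) x) \<partial>lborel)"
    by (rule poincare_L1[OF test_function_mult[OF \<phi> \<phi>] R])
  also have "(\<integral>x. norm (grad (\<lambda>x. \<phi> x * \<phi> x) x) \<partial>lborel) = (\<integral>x. 2 * (norm (\<phi> x) * norm (grad \<phi> x)) \<partial>lborel)"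
    by (intro Bochner_Integration.integral_cong)
      (simp_all add: grad_mult[OF \<phi> \<phi>] abs_mult flip: scaleR_2)
  also have "\<dots> = 2 * (\<integral>x. norm (\<phi> x) * norm (grad \<phi> x) \<partial>lborel)"
    by simp
  also have "R * \<dots> \<le> R * (2 * (?a * ?g))"
    using R L2_Cauchy_Schwarz[OF L] by (intro mult_left_mono) auto
  finally have "?a * ?a \<le> ?a * (2 * R * ?g)"
    by (simp add: mult_ac)
  then have "?a \<le> 2 * R * ?g"
  proof (cases "?a = 0")
    case True
    then show ?thesis using R(2) by (simp only:) simp
  next
    case False
    moreover have "0 \<le> ?a" by (intro real_sqrt_ge_zero sqn_nonneg)
    ultimately have "0 < ?a" by linarith
    with \<open>?a * ?a \<le> ?a * (2 * R * ?g)\<close> show ?thesis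
      by (simp only: mult_le_cancel_left_pos)
  qed
  then have "?a\<^sup>2 \<le> (2 * R * ?g)\<^sup>2"
    by (intro power_mono) auto
  then show ?thesis by (simp add: power_mult_distrib)
qed

section \<open>Compactness in L^1 by local averages\<close>

lemma shift_L1:
  assumes \<phi>: "test_function \<Omega> \<phi>"
  shows "(\<integral>z. \<bar>\<phi> (x + z) - \<phi> (y + z)\<bar> \<partial>lborel) \<le> norm (x - y) * (\<integral>x. norm (grad \<phi> x) \<partial>lborel)"
proof -
  have cs: "cont_csupp \<phi>" using test_function_cont_csupp[OF \<phi>] by auto
  note [measurable] = cont_csupp_measurable[OF cs]
  have "(\<integral>z. \<bar>\<phi> (x + z) - \<phi> (y + z)\<bar> \<partial>lborel) = (\<integral>z. \<bar>\<phi> ((z + y) + (x - y)) - \<phi> (z + y)\<bar> \<partial>lborel)"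
    by (simp add: add.commute)
  also have "\<dots> = (\<integral>z. \<bar>\<phi> (z + (x - y)) - \<phi> z\<bar> \<partial>lborel)"
    by (rule lborel_integral_shift[of "\<lambda>z. \<bar>\<phi> (z + (x - y)) - \<phi> z\<bar>"]) measurable
  also note translation_L1[OF \<phi>, of "x - y"]
  finally show ?thesis .
qed

text \<open>The integral over a ball of radius 1/(m+1) without normalisation; the volume of the ball
  is carried separately as \<open>V m\<close>.\<close>

definition local_avg :: "nat \<Rightarrow> ('a::euclidean_space \<Rightarrow> real) \<Rightarrow> 'a \<Rightarrow> real" where
  "local_avg m \<phi> x = (\<integral>z. indicator (cball 0 (1 / real (Suc m))) z * \<phi> (x + z) \<partial>lborel)"

text \<open>Enlarging the ball to the whole space turns the difference of two averages into a
  translation estimate, so the Lipschitz constant does not depend on m. Averages of functions with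
  bounded gradients in L^1 are thus equicontinuous.\<close>

lemma
  assumes \<phi>: "test_function \<Omega> \<phi>"
  shows local_avg_integrable: "integrable lborel (\<lambda>z. indicator (cball 0 (1 / real (Suc m))) z * \<phi> (x + z))"
    and local_avg_bound: "\<bar>local_avg m \<phi> x\<bar> \<le> (\<integral>x. \<bar>\<phi> x\<bar> \<partial>lborel)"
    and local_avg_lipschitz: "\<bar>local_avg m \<phi> x - local_avg m \<phi> y\<bar> \<le> norm (x - y) * (\<integral>x. norm (grad \<phi> x) \<partial>lborel)"
proof -
  have cs: "cont_csupp \<phi>" using test_function_cont_csupp[OF \<phi>] by auto
  note [measurable] = cont_csupp_measurable[OF cs]
  let ?I = "indicator (cball 0 (1 / real (Suc m))) :: 'a \<Rightarrow> real"
  have sh: "integrable lborel (\<lambda>z. \<phi> (x + z))" for x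
    using cont_csupp_integrable[OF cont_csupp_shift[OF cs, of x]] by (simp add: add.commute)
  show int: "integrable lborel (\<lambda>z. ?I z * \<phi> (x + z))" for x
    using integrable_mult_indicator[OF _ sh, of "cball 0 (1 / real (Suc m))" x] by simp
  have "\<bar>local_avg m \<phi> x\<bar> \<le> (\<integral>z. \<bar>?I z * \<phi> (x + z)\<bar> \<partial>lborel)"
    unfolding local_avg_def by (rule integral_abs_bound)
  also have "\<dots> \<le> (\<integral>z. \<bar>\<phi> (x + z)\<bar> \<partial>lborel)"
    using int[of x] sh[of x] by (intro integral_mono) (auto simp: indicator_def)
  also have "\<dots> = (\<integral>x. \<bar>\<phi> x\<bar> \<partial>lborel)"
    using lborel_integral_shift[of "\<lambda>z. \<bar>\<phi> z\<bar>" x] by (simp add: add.commute)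
  finally show "\<bar>local_avg m \<phi> x\<bar> \<le> (\<integral>x. \<bar>\<phi> x\<bar> \<partial>lborel)" .
  have "local_avg m \<phi> x - local_avg m \<phi> y = (\<integral>z. ?I z * \<phi> (x + z) - ?I z * \<phi> (y + z) \<partial>lborel)"
    unfolding local_avg_def using int by simp
  also have "\<bar>\<dots>\<bar> \<le> (\<integral>z. \<bar>?I z * \<phi> (x + z) - ?I z * \<phi> (y + z)\<bar> \<partial>lborel)"
    by (rule integral_abs_bound)
  also have "\<dots> \<le> (\<integral>z. \<bar>\<phi> (x + z) - \<phi> (y + z)\<bar> \<partial>lborel)"
    using int[of x] int[of y] sh[of x] sh[of y] by (intro integral_mono) (auto simp: indicator_def)
  also note shift_L1[OF \<phi>]
  finally show "\<bar>local_avg m \<phi> x - local_avg m \<phi> y\<bar> \<le> norm (x - y) * (\<integral>x. norm (grad \<phi> x) \<partial>lborel)" .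
qed

lemma local_avg_measurable:
  assumes \<phi>: "test_function \<Omega> \<phi>"
  shows "local_avg m \<phi> \<in> borel_measurable borel"
proof (rule borel_measurable_continuous_onI)
  let ?C = "\<integral>x. norm (grad \<phi> x) \<partial>lborel"
  have "0 \<le> ?C" by (intro integral_nonneg_AE) auto
  then have "?C-lipschitz_on UNIV (local_avg m \<phi>)"
    using local_avg_lipschitz[OF \<phi>] by (intro lipschitz_onI) (auto simp: dist_norm mult.commute)
  then show "continuous_on UNIV (local_avg m \<phi>)"
    by (rule lipschitz_on_continuous_on)
qed

text \<open>After exchanging the integrals, each offset z in the ball contributes a translation
  estimate with norm z at most 1/(m+1).\<close>

lemma local_avg_approx:
  fixes \<phi> :: "'a::euclidean_space \<Rightarrow> real"
  assumes \<phi>: "test_function \<Omega> \<phi>" and C: "(\<integral>x. norm (grad \<phi> x) \<partial>lborel) \<le> C"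
  defines "V m \<equiv> measure lborel (cball 0 (1 / real (Suc m)) :: 'a set)"
  shows "integrable lborel (\<lambda>x. local_avg m \<phi> x - V m * \<phi> x)"
    and "(\<integral>x. \<bar>local_avg m \<phi> x - V m * \<phi> x\<bar> \<partial>lborel) \<le> V m * (C / real (Suc m))"
proof -
  have cs: "cont_csupp \<phi>" using test_function_cont_csupp[OF \<phi>] by auto
  note [measurable] = cont_csupp_measurable[OF cs] local_avg_measurable[OF \<phi>]
  let ?Q = "cball 0 (1 / real (Suc m)) :: 'a set"
  let ?I = "indicator ?Q :: 'a \<Rightarrow> real"
  let ?c = "C / real (Suc m)"
  have "0 \<le> (\<integral>x. norm (grad \<phi> x) \<partial>lborel)" by (intro integral_nonneg_AE) auto
  with C have C0: "0 \<le> C" by linarith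
  have eQ: "emeasure lborel ?Q = ennreal (V m)"
    unfolding V_def using emeasure_lborel_cball_finite[of "0::'a" "1 / real (Suc m)"]
    by (intro emeasure_eq_ennreal_measure) (metis infinity_ennreal_def order_less_irrefl)
  have Iint: "integrable lborel ?I"
    using emeasure_lborel_cball_finite by (intro integrable_real_indicator) auto
  have [measurable]: "?Q \<in> sets borel" by simp
  have V0: "0 \<le> V m" by (simp add: V_def)
  have diff_int: "integrable lborel (\<lambda>z. ?I z * (\<phi> (x + z) - \<phi> x))" for x
    using local_avg_integrable[OF \<phi>] Iint by (simp add: right_diff_distrib)
  have "local_avg m \<phi> x - V m * \<phi> x = (\<integral>z. ?I z * (\<phi> (x + z) - \<phi> x) \<partial>lborel)" for x
    using local_avg_integrable[OF \<phi>] Iint by (simp add: local_avg_def V_def right_diff_distrib)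
  then have le: "ennreal \<bar>local_avg m \<phi> x - V m * \<phi> x\<bar> \<le> (\<integral>\<^sup>+z. ennreal (?I z * \<bar>\<phi> (x + z) - \<phi> x\<bar>) \<partial>lborel)" for x
    using integral_norm_bound_ennreal[OF diff_int, of x] by (simp add: abs_mult)
  have ds: "integrable lborel (\<lambda>x. \<bar>\<phi> (x + z) - \<phi> x\<bar>)" for z
    using cont_csupp_integrable[OF cont_csupp_norm[OF cont_csupp_diff[OF cont_csupp_shift[OF cs] cs]]] by simp
  have "(\<integral>\<^sup>+x. ennreal \<bar>local_avg m \<phi> x - V m * \<phi> x\<bar> \<partial>lborel)
      \<le> (\<integral>\<^sup>+x. (\<integral>\<^sup>+z. ennreal (?I z * \<bar>\<phi> (x + z) - \<phi> x\<bar>) \<partial>lborel) \<partial>lborel)"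
    by (intro nn_integral_mono le)
  also have "\<dots> = (\<integral>\<^sup>+z. (\<integral>\<^sup>+x. ennreal (?I z * \<bar>\<phi> (x + z) - \<phi> x\<bar>) \<partial>lborel) \<partial>lborel)"
    by (rule lborel_pair.Fubini') measurable
  also have "\<dots> \<le> (\<integral>\<^sup>+z. ennreal (?I z * ?c) \<partial>lborel)"
  proof (rule nn_integral_mono)
    fix z :: 'a
    have "(\<integral>\<^sup>+x. ennreal (?I z * \<bar>\<phi> (x + z) - \<phi> x\<bar>) \<partial>lborel) = ennreal (?I z * (\<integral>x. \<bar>\<phi> (x + z) - \<phi> x\<bar> \<partial>lborel))"
      using ds[of z] by (subst nn_integral_eq_integral) auto
    also have "\<dots> \<le> ennreal (?I z * ?c)"
    proof (cases "z \<in> ?Q")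
      case True
      then have "norm z * (\<integral>x. norm (grad \<phi> x) \<partial>lborel) \<le> (1 / real (Suc m)) * C"
        using C by (intro mult_mono) auto
      with translation_L1[OF \<phi>, of z] True show ?thesis
        by (intro ennreal_leI) auto
    qed simp
    finally show "(\<integral>\<^sup>+x. ennreal (?I z * \<bar>\<phi> (x + z) - \<phi> x\<bar>) \<partial>lborel) \<le> ennreal (?I z * ?c)" .
  qed
  also have "\<dots> = ennreal (\<integral>z. ?I z * ?c \<partial>lborel)"
    using Iint C0 by (intro nn_integral_eq_integral) auto
  also have "(\<integral>z. ?I z * ?c \<partial>lborel) = V m * ?c"
    by (simp add: V_def)
  finally have fin: "(\<integral>\<^sup>+x. ennreal \<bar>local_avg m \<phi> x - V m * \<phi> x\<bar> \<partial>lborel) \<le> ennreal (V m * ?c)" .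
  then show i: "integrable lborel (\<lambda>x. local_avg m \<phi> x - V m * \<phi> x)"
    by (intro integrableI_bounded) (auto simp: order_le_less_trans)
  have "ennreal (\<integral>x. \<bar>local_avg m \<phi> x - V m * \<phi> x\<bar> \<partial>lborel) \<le> ennreal (V m * ?c)"
    using fin i by (subst nn_integral_eq_integral[symmetric]) auto
  then show "(\<integral>x. \<bar>local_avg m \<phi> x - V m * \<phi> x\<bar> \<partial>lborel) \<le> V m * ?c"
    using V0 C0 by (subst (asm) ennreal_le_iff) auto
qed

text \<open>For fixed m the averages are bounded and equi-Lipschitz, so convergence on a countable
  dense set spreads to all points, and dominated convergence makes it L^1 convergence on the
  bounding ball. Divided by the volume, the averages differ from the functions by at most C/(m+1) in
  L^1, uniformly in j.\<close>

lemma rellich_L1: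
  fixes \<phi> :: "nat \<Rightarrow> 'a::euclidean_space \<Rightarrow> real"
  assumes R: "\<Omega> \<subseteq> ball 0 R" "0 < R"
    and \<phi>: "\<And>j. test_function \<Omega> (\<phi> j)"
    and C: "\<And>j. (\<integral>x. norm (grad (\<phi> j) x) \<partial>lborel) \<le> C"
  obtains r where "strict_mono (r :: nat \<Rightarrow> nat)"
    "\<forall>e>0. \<exists>N. \<forall>i\<ge>N. \<forall>j\<ge>N. (\<integral>x. \<bar>\<phi> (r i) x - \<phi> (r j) x\<bar> \<partial>lborel) < e"
proof -
  define V where "V m = measure lborel (cball 0 (1 / real (Suc m)) :: 'a set)" for m
  have V: "0 < V m" for m
    unfolding V_def using content_cball_pos[of "1 / real (Suc m)" "0 :: 'a"] by simp
  have "0 \<le> (\<integral>x. norm (grad (\<phi> 0) x) \<partial>lborel)" by (intro integral_nonneg_AE) auto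
  with C[of 0] have C0: "0 \<le> C" by linarith
  have bound: "\<bar>local_avg m (\<phi> j) x\<bar> \<le> R * C" for m j x
  proof -
    have "\<bar>local_avg m (\<phi> j) x\<bar> \<le> R * (\<integral>x. norm (grad (\<phi> j) x) \<partial>lborel)"
      using local_avg_bound[OF \<phi>] poincare_L1[OF \<phi> R] order_trans by blast
    also have "\<dots> \<le> R * C" using C R by (intro mult_left_mono) auto
    finally show ?thesis .
  qed
  have lip: "\<bar>local_avg m (\<phi> j) x - local_avg m (\<phi> j) y\<bar> \<le> norm (x - y) * C" for m j x y
    using local_avg_lipschitz[OF \<phi>] mult_left_mono[OF C norm_ge_zero] order_trans by blast
  obtain D :: "'a set" where D: "countable D" "\<And>X. open X \<Longrightarrow> X \<noteq> {} \<Longrightarrow> \<exists>d\<in>D. d \<in> X"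
    using countable_dense_setE by blast
  \<comment> \<open>The dense set is paired with the radius index, so that a single diagonal
    extraction serves all radii.\<close>
  have "countable ((UNIV :: nat set) \<times> D)" using D(1) by auto
  then obtain r where r: "strict_mono (r :: nat \<Rightarrow> nat)"
    "\<And>p. p \<in> UNIV \<times> D \<Longrightarrow> \<exists>l. (\<lambda>j. local_avg (fst p) (\<phi> (r j)) (snd p)) \<longlonglongrightarrow> l"
    using function_convergent_subsequence[of "UNIV \<times> D" "\<lambda>j p. local_avg (fst p) (\<phi> j) (snd p)" "R * C"] bound
    by auto
  have conv: "convergent (\<lambda>j. local_avg m (\<phi> (r j)) x)" for m x
  proof -
    have "Cauchy (\<lambda>j. local_avg m (\<phi> (r j)) x)"
    proof (rule CauchyI)
      fix e :: real assume e: "0 < e"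
      \<comment> \<open>Each of the three errors gets e/3; adding 1 to C keeps the quotient defined
        when C = 0.\<close>
      define d where "d = e / (3 * (C + 1))"
      have "0 < d" using e C0 by (simp add: d_def)
      then obtain q where q: "q \<in> D" "q \<in> ball x d"
        using D(2)[of "ball x d"] by auto
      have "norm (x - q) * C \<le> d * C"
        using q C0 by (intro mult_right_mono) (auto simp: dist_norm)
      also have "\<dots> < e / 3" using e C0 by (simp add: d_def field_simps)
      finally have s: "norm (x - q) * C < e / 3" .
      have "convergent (\<lambda>j. local_avg m (\<phi> (r j)) q)"
        using r(2)[of "(m, q)"] q by (auto simp: convergent_def)
      then have "Cauchy (\<lambda>j. local_avg m (\<phi> (r j)) q)" by (rule convergent_Cauchy)
      then obtain N where N: "\<And>i j. i \<ge> N \<Longrightarrow> j \<ge> N \<Longrightarrow>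
          norm (local_avg m (\<phi> (r i)) q - local_avg m (\<phi> (r j)) q) < e / 3"
        using CauchyD[of _ "e / 3"] e by fastforce
      show "\<exists>M. \<forall>i\<ge>M. \<forall>j\<ge>M. norm (local_avg m (\<phi> (r i)) x - local_avg m (\<phi> (r j)) x) < e"
      proof (intro exI allI impI)
        fix i j assume "N \<le> i" "N \<le> j"
        from N[OF this] lip[of m "r i" x q] lip[of m "r j" x q] s
        show "norm (local_avg m (\<phi> (r i)) x - local_avg m (\<phi> (r j)) x) < e"
          by (simp only: real_norm_def)
      qed
    qed
    then show ?thesis by (rule Cauchy_convergent)
  qed
  define a where "a m x = lim (\<lambda>j. local_avg m (\<phi> (r j)) x)" for m x
  have lima: "(\<lambda>j. local_avg m (\<phi> (r j)) x) \<longlonglongrightarrow> a m x" for m x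
    using conv by (simp add: a_def convergent_LIMSEQ_iff)
  note [measurable] = local_avg_measurable[OF \<phi>]
  have [measurable]: "a m \<in> borel_measurable borel" for m
    by (rule borel_measurable_LIMSEQ_real[OF lima]) measurable
  have abound: "\<bar>a m x\<bar> \<le> R * C" for m x
    by (rule LIMSEQ_le_const2[OF tendsto_rabs[OF lima]]) (use bound in auto)
  \<comment> \<open>Averages need not vanish outside the domain. Restricting them to the bounding
    ball makes their constant bound integrable and loses nothing, since the functions themselves
    vanish outside it.\<close>
  let ?B = "ball 0 R :: 'a set"
  have [measurable]: "?B \<in> sets borel" by simp
  have Bint: "integrable lborel (\<lambda>x. indicator ?B x * c)" for c :: real
    using emeasure_lborel_ball_finite by (intro integrable_mult_left integrable_real_indicator) auto
  have dom: "\<bar>indicator ?B x * \<bar>local_avg m (\<phi> j) x - a m x\<bar>\<bar> \<le> indicator ?B x * (2 * (R * C))" for m j x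
  proof -
    have "\<bar>local_avg m (\<phi> j) x - a m x\<bar> \<le> 2 * (R * C)"
      using bound[of m j x] abound[of m x] by linarith
    then show ?thesis by (simp add: indicator_def)
  qed
  have aint: "integrable lborel (\<lambda>x. indicator ?B x * \<bar>local_avg m (\<phi> j) x - a m x\<bar>)" for m j
  proof (rule Bochner_Integration.integrable_bound[OF Bint[of "2 * (R * C)"]])
    show "AE x in lborel. norm (indicator ?B x * \<bar>local_avg m (\<phi> j) x - a m x\<bar>) \<le> norm (indicator ?B x * (2 * (R * C)))"
      using dom[of _ m j] by (auto intro: order_trans abs_ge_self)
  qed measurable
  have aconv: "(\<lambda>j. \<integral>x. indicator ?B x * \<bar>local_avg m (\<phi> (r j)) x - a m x\<bar> \<partial>lborel) \<longlonglongrightarrow> 0" for m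
  proof -
    have "(\<lambda>j. \<integral>x. indicator ?B x * \<bar>local_avg m (\<phi> (r j)) x - a m x\<bar> \<partial>lborel) \<longlonglongrightarrow> (\<integral>x. (0::real) \<partial>(lborel :: 'a measure))"
    proof (rule integral_dominated_convergence[where w="\<lambda>x. indicator ?B x * (2 * (R * C))"])
      show "AE x in lborel. (\<lambda>j. indicator ?B x * \<bar>local_avg m (\<phi> (r j)) x - a m x\<bar>) \<longlonglongrightarrow> 0"
        using tendsto_mult_right_zero[OF tendsto_rabs_zero[OF LIM_zero[OF lima]]] by auto
    qed (use Bint dom in \<open>auto\<close>)
    then show ?thesis by simp
  qed
  \<comment> \<open>Both functions are compared with their averages and these with the limit
    \<open>a m\<close>; dividing by \<open>V m\<close> supplies the normalisation.\<close>
  have main: "(\<integral>x. \<bar>\<phi> i x - \<phi> j x\<bar> \<partial>lborel) \<le> 2 * (C / real (Suc m))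
      + ((\<integral>x. indicator ?B x * \<bar>local_avg m (\<phi> i) x - a m x\<bar> \<partial>lborel)
       + (\<integral>x. indicator ?B x * \<bar>local_avg m (\<phi> j) x - a m x\<bar> \<partial>lborel)) / V m" for i j m
  proof -
    let ?d = "\<lambda>k x. \<bar>local_avg m (\<phi> k) x - V m * \<phi> k x\<bar>"
    let ?e = "\<lambda>k x. indicator ?B x * \<bar>local_avg m (\<phi> k) x - a m x\<bar>"
    have di: "integrable lborel (?d k)" and dl: "(\<integral>x. ?d k x \<partial>lborel) \<le> V m * (C / real (Suc m))" for k
      using local_avg_approx[OF \<phi> C, of m k] by (auto simp: V_def)
    have aux: "I \<le> a + E / v" if "v * I \<le> v * a + E" "0 < v" for I a E v :: real
      using that by (simp add: field_simps)
    have pt: "V m * \<bar>\<phi> i x - \<phi> j x\<bar> \<le> (?d i x + ?e i x) + (?d j x + ?e j x)" for x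
    proof (cases "x \<in> ?B")
      case True
      have "V m * \<bar>\<phi> i x - \<phi> j x\<bar> = \<bar>V m * \<phi> i x - V m * \<phi> j x\<bar>"
        using V[of m] by (simp add: abs_mult flip: right_diff_distrib)
      with True show ?thesis by simp
    next
      case False
      then have "x \<notin> \<Omega>" using R by auto
      then have "\<phi> i x = 0" "\<phi> j x = 0" using test_function_zero_outside[OF \<phi>] by auto
      then show ?thesis using False by simp
    qed
    have pint: "integrable lborel (\<lambda>x. \<bar>\<phi> i x - \<phi> j x\<bar>)"
      using cont_csupp_integrable[OF test_function_cont_csupp(1)[OF \<phi>]] by auto
    have "V m * (\<integral>x. \<bar>\<phi> i x - \<phi> j x\<bar> \<partial>lborel) = (\<integral>x. V m * \<bar>\<phi> i x - \<phi> j x\<bar> \<partial>lborel)"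
      by simp
    also have "\<dots> \<le> (\<integral>x. (?d i x + ?e i x) + (?d j x + ?e j x) \<partial>lborel)"
      using pt pint di aint by (intro integral_mono) auto
    also have "\<dots> = ((\<integral>x. ?d i x \<partial>lborel) + (\<integral>x. ?e i x \<partial>lborel)) + ((\<integral>x. ?d j x \<partial>lborel) + (\<integral>x. ?e j x \<partial>lborel))"
      using di aint by simp
    also have "\<dots> \<le> V m * (2 * (C / real (Suc m))) + ((\<integral>x. ?e i x \<partial>lborel) + (\<integral>x. ?e j x \<partial>lborel))"
      using dl[of i] dl[of j] by (simp only: mult_2 distrib_left)
    finally show ?thesis
      by (rule aux[OF _ V])
  qed
  have "\<exists>N. \<forall>i\<ge>N. \<forall>j\<ge>N. (\<integral>x. \<bar>\<phi> (r i) x - \<phi> (r j) x\<bar> \<partial>lborel) < e" if e: "e > 0" for e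
  proof -
    \<comment> \<open>The averaging errors of both functions take e/2; the averages then have to be
      within e * V m / 4 of their limit.\<close>
    obtain m :: nat where "4 * C / e < real m" using reals_Archimedean2 by blast
    then have m: "2 * (C / real (Suc m)) < e / 2" using e C0 by (simp add: field_simps)
    have "\<exists>N. \<forall>i\<ge>N. norm ((\<integral>x. indicator ?B x * \<bar>local_avg m (\<phi> (r i)) x - a m x\<bar> \<partial>lborel) - 0) < e * V m / 4"
      using e V[of m] by (intro LIMSEQ_D[OF aconv]) auto
    then obtain N where N: "\<And>i. i \<ge> N \<Longrightarrow> (\<integral>x. indicator ?B x * \<bar>local_avg m (\<phi> (r i)) x - a m x\<bar> \<partial>lborel) < e * V m / 4"
      by auto
    show ?thesis
    proof (intro exI allI impI)
      fix i j assume ij: "i \<ge> N" "j \<ge> N"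
      have "((\<integral>x. indicator ?B x * \<bar>local_avg m (\<phi> (r i)) x - a m x\<bar> \<partial>lborel)
       + (\<integral>x. indicator ?B x * \<bar>local_avg m (\<phi> (r j)) x - a m x\<bar> \<partial>lborel)) / V m \<le> e / 2"
        using N[OF ij(1)] N[OF ij(2)] V[of m] by (simp add: field_simps)
      with main[of "r i" "r j" m] m
      show "(\<integral>x. \<bar>\<phi> (r i) x - \<phi> (r j) x\<bar> \<partial>lborel) < e" by linarith
    qed
  qed
  with r(1) that show ?thesis by blast
qed

section \<open>The fundamental lemma of the calculus of variations\<close>

lemma square_integrable_iff_L2: "square_integrable \<Omega> f \<longleftrightarrow> L2 (lebesgue_on \<Omega>) f"
  by (simp add: square_integrable_def L2_def)

locale bounded_domain =
  fixes \<Omega> :: "'a::euclidean_space set"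
  assumes open_dom: "open \<Omega>" and bounded_dom: "bounded \<Omega>"
begin

abbreviation M :: "'a measure" where "M \<equiv> lebesgue_on \<Omega>"

lemma sets_dom [measurable, simp]: "\<Omega> \<in> sets lebesgue"
  using open_dom by auto

sublocale finite_measure M
  using bounded_dom sets_dom by (intro finite_measure_lebesgue_on bounded_set_imp_lmeasurable)

text \<open>On Borel functions that vanish off the domain the restricted Lebesgue measure agrees
  with \<open>lborel\<close>; translation arguments on the whole space thereby become statements
  about the domain.\<close>

lemma
  fixes f :: "'a \<Rightarrow> 'b::euclidean_space"
  assumes f: "f \<in> borel_measurable borel" and z: "\<And>x. x \<notin> \<Omega> \<Longrightarrow> f x = 0"
  shows integral_dom: "(\<integral>x. f x \<partial>M) = (\<integral>x. f x \<partial>lborel)"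
    and integrable_dom: "integrable M f \<longleftrightarrow> integrable lborel f"
    and measurable_dom: "f \<in> borel_measurable M"
proof -
  have eq: "(\<lambda>x. indicator \<Omega> x *\<^sub>R f x) = f"
    using z by (auto simp: indicator_def)
  have [measurable]: "f \<in> borel_measurable lborel" using f by simp
  show "(\<integral>x. f x \<partial>M) = (\<integral>x. f x \<partial>lborel)"
    by (simp add: integral_restrict_space eq integral_completion)
  show "integrable M f \<longleftrightarrow> integrable lborel f"
    by (simp add: integrable_restrict_space eq integrable_completion)
  show "f \<in> borel_measurable M"
    using f by (intro measurable_restrict_space1 measurable_completion) simp
qed

lemma test_measurable [measurable]: "test_function \<Omega> \<phi> \<Longrightarrow> \<phi> \<in> borel_measurable M"
  using test_function_cont_csupp cont_csupp_measurable test_function_zero_outside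
  by (intro measurable_dom) blast+

lemma grad_measurable [measurable]: "test_function \<Omega> \<phi> \<Longrightarrow> grad \<phi> \<in> borel_measurable M"
  using test_function_cont_csupp cont_csupp_measurable test_function_grad_zero_outside
  by (intro measurable_dom) blast+

lemma sqn_test:
  assumes "test_function \<Omega> \<phi>"
  shows "sqn M \<phi> = sqn lborel \<phi>" "sqn M (grad \<phi>) = sqn lborel (grad \<phi>)"
    "L2 M \<phi>" "L2 M (grad \<phi>)"
proof -
  note cs = test_function_cont_csupp[OF assms]
  note [measurable] = cont_csupp_measurable[OF cs(1)] cont_csupp_measurable[OF cs(2)]
  note z = test_function_zero_outside[OF assms] test_function_grad_zero_outside[OF assms]
  show "sqn M \<phi> = sqn lborel \<phi>"
    by (intro integral_dom) (use z in auto)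
  show "sqn M (grad \<phi>) = sqn lborel (grad \<phi>)"
    by (intro integral_dom) (use z in auto)
  have "integrable M (\<lambda>x. (norm (\<phi> x))\<^sup>2)"
    using cont_csupp_L2[OF cs(1)] z by (subst integrable_dom) (auto simp: L2_def)
  then show "L2 M \<phi>" using assms by (simp add: L2_def test_measurable)
  have "integrable M (\<lambda>x. (norm (grad \<phi> x))\<^sup>2)"
    using cont_csupp_L2[OF cs(2)] z by (subst integrable_dom) (auto simp: L2_def)
  then show "L2 M (grad \<phi>)" using assms by (simp add: L2_def grad_measurable)
qed

lemma dom_radius: obtains R where "0 < R" "\<Omega> \<subseteq> ball 0 R"
  using bounded_dom bounded_subset_ballD by blast

lemma poincare_test:
  obtains c where "0 < c" "\<And>\<phi>. test_function \<Omega> \<phi> \<Longrightarrow> sqn M \<phi> \<le> c * sqn M (grad \<phi>)"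
proof -
  obtain R where R: "0 < R" "\<Omega> \<subseteq> ball 0 R" by (rule dom_radius)
  show ?thesis
  proof
    show "0 < 4 * R\<^sup>2" using R by simp
    show "sqn M \<phi> \<le> 4 * R\<^sup>2 * sqn M (grad \<phi>)" if "test_function \<Omega> \<phi>" for \<phi>
      using poincare_L2[OF that R(2,1)] sqn_test[OF that] by simp
  qed
qed

lemma rellich:
  assumes \<phi>: "\<And>j. test_function \<Omega> (\<phi> j)" and C: "\<And>j. sqn M (grad (\<phi> j)) \<le> C"
  obtains r where "strict_mono (r :: nat \<Rightarrow> nat)"
    "\<forall>e>0. \<exists>N. \<forall>i\<ge>N. \<forall>j\<ge>N. (\<integral>x. \<bar>\<phi> (r i) x - \<phi> (r j) x\<bar> \<partial>M) < e"
proof -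
  obtain R where R: "0 < R" "\<Omega> \<subseteq> ball 0 R" by (rule dom_radius)
  have "(\<integral>x. norm (grad (\<phi> j) x) \<partial>lborel) \<le> sqrt C * sqrt (measure M (space M))" for j
  proof -
    note [measurable] = cont_csupp_measurable[OF test_function_cont_csupp(2)[OF \<phi>[of j]]]
    have "(\<integral>x. norm (grad (\<phi> j) x) \<partial>lborel) = (\<integral>x. norm (grad (\<phi> j) x) \<partial>M)"
      using test_function_grad_zero_outside[OF \<phi>] by (intro integral_dom[symmetric]) auto
    also have "\<dots> \<le> sqrt (sqn M (grad (\<phi> j))) * sqrt (measure M (space M))"
      by (rule L1_le_L2[OF sqn_test(4)[OF \<phi>]])
    also have "\<dots> \<le> sqrt C * sqrt (measure M (space M))"
      using C by (intro mult_right_mono) auto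
    finally show ?thesis .
  qed
  then obtain r where r: "strict_mono (r :: nat \<Rightarrow> nat)"
    "\<forall>e>0. \<exists>N. \<forall>i\<ge>N. \<forall>j\<ge>N. (\<integral>x. \<bar>\<phi> (r i) x - \<phi> (r j) x\<bar> \<partial>lborel) < e"
    by (rule rellich_L1[where \<phi>=\<phi>, OF R(2,1) \<phi>]) (rule that)
  have "(\<integral>x. \<bar>\<phi> i x - \<phi> j x\<bar> \<partial>M) = (\<integral>x. \<bar>\<phi> i x - \<phi> j x\<bar> \<partial>lborel)" for i j
  proof -
    note [measurable] = cont_csupp_measurable[OF test_function_cont_csupp(1)[OF \<phi>]]
    show ?thesis
      using test_function_zero_outside[OF \<phi>] by (intro integral_dom) auto
  qed
  with r that show ?thesis by simp
qed

text \<open>The product is again a test function, so the integral of its gradient vanishes.\<close>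

lemma integration_by_parts:
  assumes \<phi>: "test_function \<Omega> \<phi>" and \<psi>: "test_function \<Omega> \<psi>"
  shows "(\<integral>x. \<phi> x * (grad \<psi> x \<bullet> b) \<partial>M) = - (\<integral>x. (grad \<phi> x \<bullet> b) * \<psi> x \<partial>M)"
proof -
  note L = sqn_test[OF \<phi>] sqn_test[OF \<psi>]
  have i: "integrable M (\<lambda>x. \<phi> x * (grad \<psi> x \<bullet> b))" "integrable M (\<lambda>x. (grad \<phi> x \<bullet> b) * \<psi> x)"
    using L by (auto intro!: L2_mult_integrable L2_inner_const)
  note t = test_function_mult[OF \<phi> \<psi>]
  note [measurable] = cont_csupp_measurable[OF test_function_cont_csupp(2)[OF t]]
  have "(\<integral>x. \<phi> x * (grad \<psi> x \<bullet> b) \<partial>M) + (\<integral>x. (grad \<phi> x \<bullet> b) * \<psi> x \<partial>M)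
     = (\<integral>x. grad (\<lambda>x. \<phi> x * \<psi> x) x \<bullet> b \<partial>M)"
    using i by (subst Bochner_Integration.integral_add[symmetric])
      (auto simp: grad_mult[OF \<phi> \<psi>] inner_add_left mult_ac intro!: Bochner_Integration.integral_cong)
  also have "\<dots> = (\<integral>x. grad (\<lambda>x. \<phi> x * \<psi> x) x \<bullet> b \<partial>lborel)"
    using test_function_grad_zero_outside[OF t] by (intro integral_dom) auto
  also have "\<dots> = 0" by (rule integral_grad_eq_0[OF t])
  finally show ?thesis by simp
qed

text \<open>The identity 1 - (1-a)(1-b) = a + b - ab stays inside the algebra of test functions,
  although 1 - a does not belong to it. The same identity drives the next lemma.\<close>

lemma test_one_minus_power:
  assumes "test_function \<Omega> f"
  shows "test_function \<Omega> (\<lambda>x. 1 - (1 - f x) ^ n)"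
proof (induction n)
  case (Suc n)
  have "(\<lambda>x. 1 - (1 - f x) ^ Suc n) = (\<lambda>x. (f x + (1 - (1 - f x) ^ n)) - f x * (1 - (1 - f x) ^ n))"
    by (auto simp: algebra_simps)
  with test_function_diff[OF test_function_add[OF assms Suc] test_function_mult[OF assms Suc]]
  show ?case by (simp only:)
qed (simp add: test_function_zero)

lemma test_one_minus_prod:
  fixes f :: "nat \<Rightarrow> 'a \<Rightarrow> real"
  assumes "\<And>i. test_function \<Omega> (\<lambda>x. 1 - f i x)"
  shows "test_function \<Omega> (\<lambda>x. 1 - (\<Prod>i<n. f i x))"
proof (induction n)
  case (Suc n)
  have "(\<lambda>x. 1 - (\<Prod>i<Suc n. f i x)) = (\<lambda>x. ((1 - f n x) + (1 - (\<Prod>i<n. f i x))) - (1 - f n x) * (1 - (\<Prod>i<n. f i x)))"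
    by (auto simp: algebra_simps)
  with test_function_diff[OF test_function_add[OF assms Suc] test_function_mult[OF assms Suc]]
  show ?case by (simp only:)
qed (simp add: test_function_zero)

text \<open>By Lindelof, U is a countable union of balls whose closures lie in U, each carrying a
  bump. The product of the n-th powers of 1 - bump tends to 0 as soon as one factor is below 1, and
  it is constantly 1 off U.\<close>

lemma indicator_limit_of_tests:
  assumes U: "open U" "U \<subseteq> \<Omega>"
  obtains v :: "nat \<Rightarrow> 'a \<Rightarrow> real" where "\<And>n. test_function \<Omega> (v n)" "\<And>n x. 0 \<le> v n x" "\<And>n x. v n x \<le> 1"
    "\<And>x. (\<lambda>n. v n x) \<longlonglongrightarrow> indicator U x"
proof (cases "U = {}")
  case True
  show ?thesis
    by (rule that[of "\<lambda>n x. 0"]) (use True in \<open>auto simp: test_function_zero\<close>)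
next
  case False
  define F where "F = {ball x r |x r. 0 < r \<and> cball x r \<subseteq> U}"
  have "\<Union>F = U"
  proof
    show "U \<subseteq> \<Union>F"
    proof
      fix x assume "x \<in> U"
      then obtain r where "0 < r" "cball x r \<subseteq> U" using U open_contains_cball by blast
      then show "x \<in> \<Union>F" unfolding F_def by (auto intro!: exI[of _ "ball x r"])
    qed
  qed (auto simp: F_def)
  moreover have "\<And>S. S \<in> F \<Longrightarrow> open S" by (auto simp: F_def)
  ultimately obtain F' where F': "F' \<subseteq> F" "countable F'" "\<Union>F' = U"
    using Lindelof[of F] by metis
  with False have "F' \<noteq> {}" by auto
  define B where "B = from_nat_into F'"
  have B: "range B = F'" using F' \<open>F' \<noteq> {}\<close> by (simp add: B_def range_from_nat_into)
  have "\<exists>\<eta>. test_function \<Omega> \<eta> \<and> (\<forall>x. 0 \<le> \<eta> x) \<and> (\<forall>x. \<eta> x \<le> 1) \<and> {x. \<eta> x \<noteq> 0} = B n" for n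
  proof -
    have "B n \<in> F" using B F' by auto
    then obtain x r where xr: "0 < r" "cball x r \<subseteq> U" "B n = ball x r" by (auto simp: F_def)
    then have "cball x r \<subseteq> \<Omega>" using U by blast
    from test_function_bump[OF this xr(1)] xr(3) show ?thesis by metis
  qed
  then obtain \<eta> where \<eta>: "\<And>n. test_function \<Omega> (\<eta> n)" "\<And>n x. 0 \<le> \<eta> n x" "\<And>n x. \<eta> n x \<le> 1"
    "\<And>n. {x. \<eta> n x \<noteq> 0} = B n"
    by metis
  define v where "v n x = 1 - (\<Prod>i<n. (1 - \<eta> i x) ^ n)" for n x
  have p: "0 \<le> (\<Prod>i<n. (1 - \<eta> i x) ^ n)" "(\<Prod>i<n. (1 - \<eta> i x) ^ n) \<le> 1" for n x
    using \<eta>(2,3) by (auto intro!: prod_nonneg prod_le_1 power_le_one)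
  show ?thesis
  proof
    show "test_function \<Omega> (v n)" for n
      unfolding v_def by (intro test_one_minus_prod test_one_minus_power \<eta>)
    show "0 \<le> v n x" "v n x \<le> 1" for n x using p by (auto simp: v_def)
    fix x
    show "(\<lambda>n. v n x) \<longlonglongrightarrow> indicator U x"
    proof (cases "x \<in> U")
      case False
      then have "\<eta> i x = 0" for i using \<eta>(4)[of i] B F' by blast
      then have "v n x = 0" for n by (simp add: v_def)
      with False show ?thesis by simp
    next
      case True
      then obtain k where k: "\<eta> k x \<noteq> 0" using \<eta>(4) B F' by blast
      define q where "q = 1 - \<eta> k x"
      have q: "0 \<le> q" "q < 1" using k \<eta>(2)[of k x] \<eta>(3)[of k x] by (auto simp: q_def)
      have "(\<lambda>n. \<Prod>i<n. (1 - \<eta> i x) ^ n) \<longlonglongrightarrow> 0"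
      proof (rule tendsto_sandwich[OF _ _ tendsto_const])
        show "(\<lambda>n. q ^ n) \<longlonglongrightarrow> 0" using q by (intro LIMSEQ_power_zero) auto
        show "\<forall>\<^sub>F n in sequentially. (\<Prod>i<n. (1 - \<eta> i x) ^ n) \<le> q ^ n"
        proof (rule eventually_sequentiallyI[of "Suc k"])
          fix n assume "Suc k \<le> n"
          then have "(\<Prod>i<n. (1 - \<eta> i x) ^ n) = (1 - \<eta> k x) ^ n * (\<Prod>i\<in>{..<n} - {k}. (1 - \<eta> i x) ^ n)"
            by (intro prod.remove) auto
          also have "\<dots> \<le> q ^ n * 1"
            unfolding q_def using \<eta>(2,3)
            by (intro mult_left_mono prod_le_1) (auto intro!: power_le_one)
          finally show "(\<Prod>i<n. (1 - \<eta> i x) ^ n) \<le> q ^ n" by simp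
        qed
      qed (use p in auto)
      from tendsto_diff[OF tendsto_const this, of 1] True show ?thesis by (simp add: v_def)
    qed
  qed
qed

text \<open>Positivity passes from test functions to indicators of open sets, and from these to a
  decreasing intersection G of open sets that contains {f < 0} and exceeds it by a null set. There f
  times the indicator of G is nonpositive almost everywhere but has nonnegative integral.\<close>

lemma fundamental_nonneg:
  fixes f :: "'a \<Rightarrow> real"
  assumes f: "integrable M f"
    and pos: "\<And>\<phi>. test_function \<Omega> \<phi> \<Longrightarrow> (\<And>x. 0 \<le> \<phi> x) \<Longrightarrow> 0 \<le> (\<integral>x. f x * \<phi> x \<partial>M)"
  shows "AE x in M. 0 \<le> f x"
proof -
  have [measurable]: "f \<in> borel_measurable M" using f by simp
  have U0: "0 \<le> (\<integral>x. f x * indicator U x \<partial>M)" if U: "open U" "U \<subseteq> \<Omega>" for U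
  proof -
    obtain v :: "nat \<Rightarrow> 'a \<Rightarrow> real" where v: "\<And>n. test_function \<Omega> (v n)" "\<And>n x. 0 \<le> v n x" "\<And>n x. v n x \<le> 1"
      "\<And>x. (\<lambda>n. v n x) \<longlonglongrightarrow> indicator U x"
      using indicator_limit_of_tests[OF U] by metis
    note [measurable] = test_measurable[OF v(1)]
    have [measurable]: "U \<in> sets M"
      using U by (auto simp: sets_restrict_space intro!: image_eqI[of _ _ U])
    have "(\<lambda>n. \<integral>x. f x * v n x \<partial>M) \<longlonglongrightarrow> (\<integral>x. f x * indicator U x \<partial>M)"
    proof (rule integral_dominated_convergence[where w="\<lambda>x. \<bar>f x\<bar>"])
      show "AE x in M. (\<lambda>n. f x * v n x) \<longlonglongrightarrow> f x * indicator U x"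
        using v(4) by (auto intro!: tendsto_mult)
      show "AE x in M. norm (f x * v n x) \<le> \<bar>f x\<bar>" for n
        using v(2,3) by (auto simp: abs_mult mult_left_le)
    qed (use f in auto)
    then show ?thesis
      by (rule LIMSEQ_le_const) (use pos v in auto)
  qed
  define A where "A = {x \<in> space M. f x < 0}"
  have "A \<in> sets M" unfolding A_def by measurable
  then have A: "A \<in> sets lebesgue" "A \<subseteq> \<Omega>"
    using sets_restrict_space_subset[of \<Omega> lebesgue] by (auto simp: sets_restrict_space)
  have "\<exists>T. open T \<and> A \<subseteq> T \<and> T - A \<in> lmeasurable \<and> emeasure lebesgue (T - A) < ennreal (1 / real (Suc n))" for n
    using sets_lebesgue_outer_open[OF A(1), of "1 / real (Suc n)"] by (metis of_nat_0_less_iff zero_less_Suc zero_less_divide_1_iff)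
  then obtain T where T: "\<And>n. open (T n)" "\<And>n. A \<subseteq> T n" "\<And>n. T n - A \<in> lmeasurable"
      "\<And>n. emeasure lebesgue (T n - A) < ennreal (1 / real (Suc n))"
    by metis
  \<comment> \<open>Finite intersections make the open sets decreasing, as the convergence of their
    indicators requires.\<close>
  define U where "U n = \<Omega> \<inter> (\<Inter>i\<le>n. T i)" for n
  define G where "G = \<Omega> \<inter> (\<Inter>i. T i)"
  have G: "G = (\<Inter>n. U n)" by (force simp: G_def U_def)
  have openU: "open (U n)" for n using T(1) open_dom by (auto simp: U_def)
  have [measurable]: "U n \<in> sets M" for n
    using openU[of n] by (auto simp: sets_restrict_space U_def intro!: image_eqI[of _ _ "U n"])
  have Gm [measurable]: "G \<in> sets M" unfolding G by measurable
  have "(\<lambda>n. \<integral>x. f x * indicator (U n) x \<partial>M) \<longlonglongrightarrow> (\<integral>x. f x * indicator G x \<partial>M)"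
  proof (rule integral_dominated_convergence[where w="\<lambda>x. \<bar>f x\<bar>"])
    show "AE x in M. (\<lambda>n. f x * indicator (U n) x) \<longlonglongrightarrow> f x * indicator G x"
    proof (intro AE_I2 tendsto_mult tendsto_const)
      fix x
      have dec: "decseq U" by (auto simp: decseq_def U_def)
      show "(\<lambda>n. indicator (U n) x) \<longlonglongrightarrow> (indicator G x :: real)"
        unfolding G by (rule LIMSEQ_indicator_decseq[OF dec])
    qed
    show "(\<lambda>x. f x * indicator G x) \<in> borel_measurable M" by measurable
  qed (use f in \<open>auto simp: indicator_def\<close>)
  then have G0: "0 \<le> (\<integral>x. f x * indicator G x \<partial>M)"
    by (rule LIMSEQ_le_const) (use U0[OF openU] in \<open>auto simp: U_def\<close>)
  have null: "G - A \<in> null_sets lebesgue"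
  proof -
    have GA: "G - A \<in> sets lebesgue"
      using A T(1) open_dom unfolding G_def by (intro sets.Diff sets.Int sets.countable_INT) auto
    have "emeasure lebesgue (G - A) \<le> ennreal (1 / real (Suc n))" for n
    proof -
      have "emeasure lebesgue (G - A) \<le> emeasure lebesgue (T n - A)"
        using T(3)[of n] by (intro emeasure_mono) (auto simp: G_def fmeasurableD)
      with T(4)[of n] show ?thesis by simp
    qed
    then have "emeasure lebesgue (G - A) \<le> 0"
      by (intro LIMSEQ_le_const[OF tendsto_ennrealI[OF LIMSEQ_inverse_real_of_nat, simplified]])
        (auto simp: inverse_eq_divide)
    with GA show ?thesis by auto
  qed
  have "AE x in lebesgue. x \<notin> G - A" using null by (rule AE_not_in)
  then have ae: "AE x in M. x \<notin> G - A"
    by (auto simp: AE_restrict_space_iff)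
  then have ae_le: "AE x in M. f x * indicator G x \<le> 0"
    by eventually_elim (auto simp: indicator_def A_def)
  have iG: "integrable M (\<lambda>x. f x * indicator G x)"
    using integrable_mult_indicator[OF Gm f] by (simp add: mult.commute)
  have "(\<integral>x. - (f x * indicator G x) \<partial>M) = 0"
  proof (rule antisym)
    show "(\<integral>x. - (f x * indicator G x) \<partial>M) \<le> 0" using G0 by simp
    show "0 \<le> (\<integral>x. - (f x * indicator G x) \<partial>M)"
      using ae_le by (intro integral_nonneg_AE) (auto elim: eventually_mono)
  qed
  moreover have "integrable M (\<lambda>x. - (f x * indicator G x))" using iG by simp
  moreover have "AE x in M. 0 \<le> - (f x * indicator G x)" using ae_le by (auto elim: eventually_mono)
  ultimately have ae_0: "AE x in M. - (f x * indicator G x) = 0"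
    using integral_nonneg_eq_0_iff_AE by blast
  have AG: "A \<subseteq> G" using A T(2) by (auto simp: G_def)
  show ?thesis
    using ae_0 AE_space
  proof eventually_elim
    case (elim x)
    show ?case
    proof (rule ccontr)
      assume "\<not> 0 \<le> f x"
      then have "x \<in> G" using AG elim by (auto simp: A_def)
      with elim \<open>\<not> 0 \<le> f x\<close> show False by simp
    qed
  qed
qed

end

section \<open>The space of functions with zero boundary values\<close>

context bounded_domain
begin

text \<open>The closure of the graph of \<open>grad\<close> in L^2 x L^2. Carrying the gradient
  along keeps the choice operator of \<open>weak_gradient\<close> out of the estimates;
  \<open>H10_iff_pair\<close> returns to \<open>H10\<close>.\<close>

definition H10_pair :: "('a \<Rightarrow> real) \<Rightarrow> ('a \<Rightarrow> 'a) \<Rightarrow> bool" where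
  "H10_pair u g \<longleftrightarrow> L2 M u \<and> L2 M g \<and>
     (\<exists>\<phi>. (\<forall>j. test_function \<Omega> (\<phi> j)) \<and> (\<lambda>j. sqn M (\<lambda>x. u x - \<phi> j x)) \<longlonglongrightarrow> 0 \<and>
       (\<lambda>j. sqn M (\<lambda>x. g x - grad (\<phi> j) x)) \<longlonglongrightarrow> 0)"

lemma H10_pair_L2: "H10_pair u g \<Longrightarrow> L2 M u" "H10_pair u g \<Longrightarrow> L2 M g"
  by (auto simp: H10_pair_def)

lemma H10_pairE:
  assumes "H10_pair u g"
  obtains \<phi> where "\<And>j. test_function \<Omega> (\<phi> j)" "(\<lambda>j. sqn M (\<lambda>x. \<phi> j x - u x)) \<longlonglongrightarrow> 0"
    "(\<lambda>j. sqn M (\<lambda>x. grad (\<phi> j) x - g x)) \<longlonglongrightarrow> 0"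
  using assms unfolding H10_pair_def by (auto simp: norm_minus_commute abs_minus_commute)

lemma H10_pairI:
  assumes "L2 M u" "L2 M g" "\<And>j. test_function \<Omega> (\<phi> j)"
    "(\<lambda>j. sqn M (\<lambda>x. \<phi> j x - u x)) \<longlonglongrightarrow> 0" "(\<lambda>j. sqn M (\<lambda>x. grad (\<phi> j) x - g x)) \<longlonglongrightarrow> 0"
  shows "H10_pair u g"
  unfolding H10_pair_def using assms
  by (auto simp: norm_minus_commute abs_minus_commute intro!: exI[of _ \<phi>])

lemma H10_pair_test: "test_function \<Omega> \<phi> \<Longrightarrow> H10_pair \<phi> (grad \<phi>)"
  by (rule H10_pairI[where \<phi>="\<lambda>_. \<phi>"]) (auto simp: sqn_test)

text \<open>A diagonal sequence: the n-th test function approximates the n-th pair up to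
  1/(n+1).\<close>

lemma H10_pair_closed:
  assumes p: "\<And>n. H10_pair (us n) (gs n)" and L: "L2 M u" "L2 M g"
    and u: "(\<lambda>n. sqn M (\<lambda>x. us n x - u x)) \<longlonglongrightarrow> 0"
    and g: "(\<lambda>n. sqn M (\<lambda>x. gs n x - g x)) \<longlonglongrightarrow> 0"
  shows "H10_pair u g"
proof -
  have "\<exists>\<phi>. test_function \<Omega> \<phi> \<and> sqn M (\<lambda>x. \<phi> x - us n x) < 1 / real (Suc n) \<and>
      sqn M (\<lambda>x. grad \<phi> x - gs n x) < 1 / real (Suc n)" for n
  proof -
    obtain \<phi> where \<phi>: "\<And>j. test_function \<Omega> (\<phi> j)" "(\<lambda>j. sqn M (\<lambda>x. \<phi> j x - us n x)) \<longlonglongrightarrow> 0"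
      "(\<lambda>j. sqn M (\<lambda>x. grad (\<phi> j) x - gs n x)) \<longlonglongrightarrow> 0"
      using p[of n] by (rule H10_pairE) (rule that)
    have e: "0 < 1 / real (Suc n)" by simp
    have "\<forall>\<^sub>F j in sequentially. sqn M (\<lambda>x. \<phi> j x - us n x) < 1 / real (Suc n) \<and>
      sqn M (\<lambda>x. grad (\<phi> j) x - gs n x) < 1 / real (Suc n)"
      using order_tendstoD(2)[OF \<phi>(2) e] order_tendstoD(2)[OF \<phi>(3) e] by (rule eventually_conj)
    then obtain j where "sqn M (\<lambda>x. \<phi> j x - us n x) < 1 / real (Suc n) \<and>
      sqn M (\<lambda>x. grad (\<phi> j) x - gs n x) < 1 / real (Suc n)"
      using eventually_happens trivial_limit_sequentially by blast
    with \<phi>(1) show ?thesis by blast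
  qed
  then have "\<forall>n. \<exists>\<phi>. test_function \<Omega> \<phi> \<and> sqn M (\<lambda>x. \<phi> x - us n x) < 1 / real (Suc n) \<and>
      sqn M (\<lambda>x. grad \<phi> x - gs n x) < 1 / real (Suc n)" ..
  from choice[OF this] obtain \<phi> where *: "\<forall>n. test_function \<Omega> (\<phi> n) \<and>
      sqn M (\<lambda>x. \<phi> n x - us n x) < 1 / real (Suc n) \<and>
      sqn M (\<lambda>x. grad (\<phi> n) x - gs n x) < 1 / real (Suc n)" ..
  then have \<phi>: "\<And>n. test_function \<Omega> (\<phi> n)" "\<And>n. sqn M (\<lambda>x. \<phi> n x - us n x) < 1 / real (Suc n)"
      "\<And>n. sqn M (\<lambda>x. grad (\<phi> n) x - gs n x) < 1 / real (Suc n)"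
    by simp_all
  have lim: "(\<lambda>n. 2 * (1 / real (Suc n)) + 2 * s n) \<longlonglongrightarrow> 0" if "s \<longlonglongrightarrow> 0" for s :: "nat \<Rightarrow> real"
    using tendsto_add[OF tendsto_mult_right_zero[OF LIMSEQ_inverse_real_of_nat, of 2] tendsto_mult_right_zero[OF that, of 2]]
    by (simp add: inverse_eq_divide)
  show ?thesis
  proof (rule H10_pairI[OF L \<phi>(1)])
    show "(\<lambda>n. sqn M (\<lambda>x. \<phi> n x - u x)) \<longlonglongrightarrow> 0"
    proof (rule tendsto_sandwich[OF _ _ tendsto_const lim[OF u]])
      show "\<forall>\<^sub>F n in sequentially. sqn M (\<lambda>x. \<phi> n x - u x) \<le> 2 * (1 / real (Suc n)) + 2 * sqn M (\<lambda>x. us n x - u x)"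
      proof (rule always_eventually, rule allI)
        fix n
        show "sqn M (\<lambda>x. \<phi> n x - u x) \<le> 2 * (1 / real (Suc n)) + 2 * sqn M (\<lambda>x. us n x - u x)"
          using sqn_diff_le[OF sqn_test(3)[OF \<phi>(1)] H10_pair_L2(1)[OF p[of n]] L(1), of n] \<phi>(2)[of n] by linarith
      qed
    qed (simp only: sqn_nonneg eventually_True)
    show "(\<lambda>n. sqn M (\<lambda>x. grad (\<phi> n) x - g x)) \<longlonglongrightarrow> 0"
    proof (rule tendsto_sandwich[OF _ _ tendsto_const lim[OF g]])
      show "\<forall>\<^sub>F n in sequentially. sqn M (\<lambda>x. grad (\<phi> n) x - g x) \<le> 2 * (1 / real (Suc n)) + 2 * sqn M (\<lambda>x. gs n x - g x)"
      proof (rule always_eventually, rule allI)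
        fix n
        show "sqn M (\<lambda>x. grad (\<phi> n) x - g x) \<le> 2 * (1 / real (Suc n)) + 2 * sqn M (\<lambda>x. gs n x - g x)"
          using sqn_diff_le[OF sqn_test(4)[OF \<phi>(1)] H10_pair_L2(2)[OF p[of n]] L(2), of n] \<phi>(3)[of n] by linarith
      qed
    qed (simp only: sqn_nonneg eventually_True)
  qed
qed

lemma H10_pair_add_cmult:
  assumes "H10_pair u g" "H10_pair v h"
  shows "H10_pair (\<lambda>x. u x + t * v x) (\<lambda>x. g x + t *\<^sub>R h x)"
proof -
  note Lu = H10_pair_L2[OF assms(1)] and Lv = H10_pair_L2[OF assms(2)]
  obtain \<phi> where \<phi>: "\<And>j. test_function \<Omega> (\<phi> j)" "(\<lambda>j. sqn M (\<lambda>x. \<phi> j x - u x)) \<longlonglongrightarrow> 0"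
      "(\<lambda>j. sqn M (\<lambda>x. grad (\<phi> j) x - g x)) \<longlonglongrightarrow> 0"
    using assms(1) by (rule H10_pairE) (rule that)
  obtain \<psi> where \<psi>: "\<And>j. test_function \<Omega> (\<psi> j)" "(\<lambda>j. sqn M (\<lambda>x. \<psi> j x - v x)) \<longlonglongrightarrow> 0"
      "(\<lambda>j. sqn M (\<lambda>x. grad (\<psi> j) x - h x)) \<longlonglongrightarrow> 0"
    using assms(2) by (rule H10_pairE) (rule that)
  have lim: "(\<lambda>n. 2 * a n + 2 * (t\<^sup>2 * s n)) \<longlonglongrightarrow> 0" if "a \<longlonglongrightarrow> 0" "s \<longlonglongrightarrow> 0" for a s :: "nat \<Rightarrow> real"
    using tendsto_add[OF tendsto_mult_right_zero[OF that(1), of 2] tendsto_mult_right_zero[OF tendsto_mult_right_zero[OF that(2), of "t\<^sup>2"], of 2]]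
    by simp
  show ?thesis
  proof (rule H10_pairI)
    show "L2 M (\<lambda>x. u x + t * v x)" "L2 M (\<lambda>x. g x + t *\<^sub>R h x)"
      using Lu Lv by (auto intro!: L2_add L2_cmult L2_scaleR)
    show T: "test_function \<Omega> (\<lambda>x. \<phi> j x + t * \<psi> j x)" for j
      using \<phi> \<psi> by (intro test_function_add test_function_cmult)
    show "(\<lambda>j. sqn M (\<lambda>x. \<phi> j x + t * \<psi> j x - (u x + t * v x))) \<longlonglongrightarrow> 0"
    proof (rule tendsto_sandwich[OF _ _ tendsto_const lim[OF \<phi>(2) \<psi>(2)]])
      show "\<forall>\<^sub>F j in sequentially. sqn M (\<lambda>x. \<phi> j x + t * \<psi> j x - (u x + t * v x))
          \<le> 2 * sqn M (\<lambda>x. \<phi> j x - u x) + 2 * (t\<^sup>2 * sqn M (\<lambda>x. \<psi> j x - v x))"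
      proof (rule always_eventually, rule allI)
        fix j
        have "L2 M (\<lambda>x. \<phi> j x - u x)" "L2 M (\<lambda>x. t * (\<psi> j x - v x))"
          using sqn_test(3)[OF \<phi>(1)] sqn_test(3)[OF \<psi>(1)] Lu Lv by (auto intro!: L2_diff L2_cmult)
        note le = sqn_add_le[OF this, unfolded sqn_scaleR[of M t "\<lambda>x. \<psi> j x - v x", unfolded real_scaleR_def]]
        have eq: "\<phi> j x + t * \<psi> j x - (u x + t * v x) = (\<phi> j x - u x) + t * (\<psi> j x - v x)" for x
          by (simp add: algebra_simps)
        show "sqn M (\<lambda>x. \<phi> j x + t * \<psi> j x - (u x + t * v x))
          \<le> 2 * sqn M (\<lambda>x. \<phi> j x - u x) + 2 * (t\<^sup>2 * sqn M (\<lambda>x. \<psi> j x - v x))"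
          unfolding eq by (rule le)
      qed
    qed (simp only: sqn_nonneg eventually_True)
    show "(\<lambda>j. sqn M (\<lambda>x. grad (\<lambda>x. \<phi> j x + t * \<psi> j x) x - (g x + t *\<^sub>R h x))) \<longlonglongrightarrow> 0"
    proof (rule tendsto_sandwich[OF _ _ tendsto_const lim[OF \<phi>(3) \<psi>(3)]])
      show "\<forall>\<^sub>F j in sequentially. sqn M (\<lambda>x. grad (\<lambda>x. \<phi> j x + t * \<psi> j x) x - (g x + t *\<^sub>R h x))
          \<le> 2 * sqn M (\<lambda>x. grad (\<phi> j) x - g x) + 2 * (t\<^sup>2 * sqn M (\<lambda>x. grad (\<psi> j) x - h x))"
      proof (rule always_eventually, rule allI)
        fix j
        have "L2 M (\<lambda>x. grad (\<phi> j) x - g x)" "L2 M (\<lambda>x. t *\<^sub>R (grad (\<psi> j) x - h x))"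
          using sqn_test(4)[OF \<phi>(1)] sqn_test(4)[OF \<psi>(1)] Lu Lv by (auto intro!: L2_diff L2_scaleR)
        note le = sqn_add_le[OF this, unfolded sqn_scaleR[of M t "\<lambda>x. grad (\<psi> j) x - h x"]]
        have eq: "grad (\<lambda>x. \<phi> j x + t * \<psi> j x) x - (g x + t *\<^sub>R h x)
            = (grad (\<phi> j) x - g x) + t *\<^sub>R (grad (\<psi> j) x - h x)" for x
          by (simp add: grad_add[OF \<phi>(1) test_function_cmult[OF \<psi>(1)]] grad_cmult[OF \<psi>(1)] algebra_simps)
        show "sqn M (\<lambda>x. grad (\<lambda>x. \<phi> j x + t * \<psi> j x) x - (g x + t *\<^sub>R h x))
          \<le> 2 * sqn M (\<lambda>x. grad (\<phi> j) x - g x) + 2 * (t\<^sup>2 * sqn M (\<lambda>x. grad (\<psi> j) x - h x))"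
          unfolding eq by (rule le)
      qed
    qed (simp only: sqn_nonneg eventually_True)
  qed
qed

text \<open>The Poincare inequality for test functions survives the passage to the limit. This is
  how vanishing gradients are turned into vanishing truncations of a minimiser.\<close>

lemma H10_pair_poincare:
  assumes "H10_pair u g" "sqn M g = 0"
  shows "AE x in M. u x = 0"
proof -
  obtain c where c: "0 < c" "\<And>\<phi>. test_function \<Omega> \<phi> \<Longrightarrow> sqn M \<phi> \<le> c * sqn M (grad \<phi>)"
    by (rule poincare_test) (rule that)
  obtain \<phi> where \<phi>: "\<And>j. test_function \<Omega> (\<phi> j)" "(\<lambda>j. sqn M (\<lambda>x. \<phi> j x - u x)) \<longlonglongrightarrow> 0"
      "(\<lambda>j. sqn M (\<lambda>x. grad (\<phi> j) x - g x)) \<longlonglongrightarrow> 0"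
    using assms(1) by (rule H10_pairE) (rule that)
  note L = H10_pair_L2[OF assms(1)]
  have "(\<lambda>j. sqn M (\<phi> j)) \<longlonglongrightarrow> sqn M u"
    by (rule sqn_tendsto[OF sqn_test(3)[OF \<phi>(1)] L(1) \<phi>(2)])
  moreover have "(\<lambda>j. c * sqn M (grad (\<phi> j))) \<longlonglongrightarrow> c * sqn M g"
    by (intro tendsto_mult tendsto_const sqn_tendsto[OF sqn_test(4)[OF \<phi>(1)] L(2) \<phi>(3)])
  ultimately have "sqn M u \<le> c * sqn M g"
    by (rule LIMSEQ_le) (use c(2)[OF \<phi>(1)] in blast)
  then have "sqn M u = 0"
    by (intro antisym sqn_nonneg) (simp only: assms(2) mult_zero_right)
  then have "AE x in M. (norm (u x))\<^sup>2 = 0"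
    using integral_nonneg_eq_0_iff_AE[OF L2_integrable[OF L(1)]] by simp
  then show ?thesis by simp
qed

lemma H10_pair_weak_gradient:
  assumes "H10_pair u g"
  shows "is_weak_gradient \<Omega> u g"
  unfolding is_weak_gradient_def square_integrable_iff_L2
proof (intro conjI allI impI ballI)
  note L = H10_pair_L2[OF assms]
  show "L2 M g" by (rule L)
  fix \<psi> :: "'a \<Rightarrow> real" and b :: 'a assume \<psi>: "test_function \<Omega> \<psi>" and b: "b \<in> Basis"
  obtain \<phi> where \<phi>: "\<And>j. test_function \<Omega> (\<phi> j)" "(\<lambda>j. sqn M (\<lambda>x. \<phi> j x - u x)) \<longlonglongrightarrow> 0"
      "(\<lambda>j. sqn M (\<lambda>x. grad (\<phi> j) x - g x)) \<longlonglongrightarrow> 0"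
    using assms by (rule H10_pairE) (rule that)
  have Lb: "L2 M (\<lambda>x. grad \<psi> x \<bullet> b)"
    by (rule L2_inner_const[OF sqn_test(4)[OF \<psi>]])
  have Lb': "L2 M (\<lambda>x. \<psi> x *\<^sub>R b)"
    using b by (intro L2_bound[OF sqn_test(3)[OF \<psi>]]) (auto intro!: borel_measurable_scaleR test_measurable[OF \<psi>])
  have "(\<lambda>j. \<integral>x. \<phi> j x \<bullet> (grad \<psi> x \<bullet> b) \<partial>M) \<longlonglongrightarrow> (\<integral>x. u x \<bullet> (grad \<psi> x \<bullet> b) \<partial>M)"
    by (rule L2_inner_tendsto[OF sqn_test(3)[OF \<phi>(1)] L(1) \<phi>(2) Lb Lb]) simp
  moreover have "(\<lambda>j. - (\<integral>x. grad (\<phi> j) x \<bullet> (\<psi> x *\<^sub>R b) \<partial>M)) \<longlonglongrightarrow> - (\<integral>x. g x \<bullet> (\<psi> x *\<^sub>R b) \<partial>M)"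
    by (rule tendsto_minus, rule L2_inner_tendsto[OF sqn_test(4)[OF \<phi>(1)] L(2) \<phi>(3) Lb' Lb']) simp
  moreover have "(\<integral>x. \<phi> j x \<bullet> (grad \<psi> x \<bullet> b) \<partial>M) = - (\<integral>x. grad (\<phi> j) x \<bullet> (\<psi> x *\<^sub>R b) \<partial>M)" for j
    using integration_by_parts[OF \<phi>(1) \<psi>, of j b] by (simp add: mult.commute)
  ultimately have "(\<integral>x. u x \<bullet> (grad \<psi> x \<bullet> b) \<partial>M) = - (\<integral>x. g x \<bullet> (\<psi> x *\<^sub>R b) \<partial>M)"
    using LIMSEQ_unique by (simp only:)
  then show "(\<integral>x. u x * frechet_derivative \<psi> (at x) b \<partial>M) = - (\<integral>x. g x \<bullet> b * \<psi> x \<partial>M)"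
    by (simp add: grad_inner_Basis[OF b] mult.commute)
qed

text \<open>Each coordinate of g - h and of h - g integrates to 0 against every test function, so
  \<open>fundamental_nonneg\<close> gives both inequalities.\<close>

lemma weak_gradient_unique:
  assumes "is_weak_gradient \<Omega> u g" "is_weak_gradient \<Omega> u h"
  shows "AE x in M. g x = h x"
proof -
  have L: "L2 M g" "L2 M h"
    using assms by (auto simp: is_weak_gradient_def square_integrable_iff_L2)
  note [measurable] = L2_measurable[OF L(1)] L2_measurable[OF L(2)]
  have *: "AE x in M. 0 \<le> (g x - h x) \<bullet> b"
    if b: "b \<in> Basis" and wg: "is_weak_gradient \<Omega> u g" "is_weak_gradient \<Omega> u h" for b g h
  proof (rule fundamental_nonneg)
    have L: "L2 M g" "L2 M h"
      using wg by (auto simp: is_weak_gradient_def square_integrable_iff_L2)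
    have Lg: "L2 M (\<lambda>x. g x \<bullet> b)" "L2 M (\<lambda>x. h x \<bullet> b)"
      using L by (auto intro: L2_inner_const)
    show "integrable M (\<lambda>x. (g x - h x) \<bullet> b)"
      by (intro L2_imp_integrable L2_inner_const L2_diff L)
    fix \<phi> :: "'a \<Rightarrow> real" assume \<phi>: "test_function \<Omega> \<phi>"
    have "(\<integral>x. (g x - h x) \<bullet> b * \<phi> x \<partial>M) = (\<integral>x. g x \<bullet> b * \<phi> x \<partial>M) - (\<integral>x. h x \<bullet> b * \<phi> x \<partial>M)"
      using L2_mult_integrable[OF Lg(1) sqn_test(3)[OF \<phi>]] L2_mult_integrable[OF Lg(2) sqn_test(3)[OF \<phi>]]
      by (simp add: inner_diff_left left_diff_distrib)
    also have "\<dots> = 0"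
    proof -
      have "(\<integral>x. u x * frechet_derivative \<phi> (at x) b \<partial>M) = - (\<integral>x. g x \<bullet> b * \<phi> x \<partial>M)"
        "(\<integral>x. u x * frechet_derivative \<phi> (at x) b \<partial>M) = - (\<integral>x. h x \<bullet> b * \<phi> x \<partial>M)"
        using wg \<phi> b by (auto simp: is_weak_gradient_def)
      then show ?thesis by linarith
    qed
    finally show "0 \<le> (\<integral>x. (g x - h x) \<bullet> b * \<phi> x \<partial>M)" by simp
  qed
  have "AE x in M. \<forall>b\<in>Basis. g x \<bullet> b = h x \<bullet> b"
  proof (rule AE_finite_allI)
    fix b :: 'a assume b: "b \<in> Basis"
    from *[OF b assms] *[OF b assms(2,1)] show "AE x in M. g x \<bullet> b = h x \<bullet> b"
      by eventually_elim (simp add: inner_diff_left)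
  qed simp
  then show ?thesis
    by (rule eventually_mono) (rule euclidean_eqI, blast)
qed

lemma weak_gradient_AE:
  assumes "is_weak_gradient \<Omega> u g"
  shows "AE x in M. weak_gradient \<Omega> u x = g x"
proof -
  have "is_weak_gradient \<Omega> u (weak_gradient \<Omega> u)"
    unfolding weak_gradient_def using someI[of "is_weak_gradient \<Omega> u" g] assms by blast
  with assms show ?thesis by (rule weak_gradient_unique[rotated])
qed

text \<open>Two weak gradients agree almost everywhere, so the one selected in
  \<open>H1_norm\<close> may be replaced by any known one.\<close>

lemma H1_norm_eq:
  assumes "L2 M u" "is_weak_gradient \<Omega> u g"
  shows "H1_norm \<Omega> u = sqrt (sqn M u + sqn M g)"
proof -
  have wg: "is_weak_gradient \<Omega> u (weak_gradient \<Omega> u)"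
    unfolding weak_gradient_def using someI[of "is_weak_gradient \<Omega> u" g] assms by blast
  have L: "L2 M g" "L2 M (weak_gradient \<Omega> u)"
    using assms wg by (auto simp: is_weak_gradient_def square_integrable_iff_L2)
  have "sqn M (weak_gradient \<Omega> u) = sqn M g"
    using weak_gradient_AE[OF assms(2)] L
    by (intro integral_cong_AE) (auto simp: L2_def elim: eventually_mono)
  then show ?thesis by (simp add: H1_norm_def)
qed

lemma is_weak_gradient_diff_test:
  assumes u: "L2 M u" "is_weak_gradient \<Omega> u g" and \<phi>: "test_function \<Omega> \<phi>"
  shows "is_weak_gradient \<Omega> (\<lambda>x. u x - \<phi> x) (\<lambda>x. g x - grad \<phi> x)"
  unfolding is_weak_gradient_def square_integrable_iff_L2
proof (intro conjI allI impI ballI)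
  have Lg: "L2 M g" using u by (simp add: is_weak_gradient_def square_integrable_iff_L2)
  show "L2 M (\<lambda>x. g x - grad \<phi> x)" using Lg sqn_test[OF \<phi>] by (intro L2_diff)
  fix \<psi> :: "'a \<Rightarrow> real" and b :: 'a assume \<psi>: "test_function \<Omega> \<psi>" and b: "b \<in> Basis"
  have Lb: "L2 M (\<lambda>x. h x \<bullet> b)" if "L2 M h" for h :: "'a \<Rightarrow> 'a"
    using that by (rule L2_inner_const)
  note i = L2_mult_integrable[OF u(1) Lb[OF sqn_test(4)[OF \<psi>]]] L2_mult_integrable[OF sqn_test(3)[OF \<phi>] Lb[OF sqn_test(4)[OF \<psi>]]]
    L2_mult_integrable[OF Lb[OF Lg] sqn_test(3)[OF \<psi>]] L2_mult_integrable[OF Lb[OF sqn_test(4)[OF \<phi>]] sqn_test(3)[OF \<psi>]]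
  have "(\<integral>x. u x * (grad \<psi> x \<bullet> b) \<partial>M) = - (\<integral>x. g x \<bullet> b * \<psi> x \<partial>M)"
    using u \<psi> b by (simp add: is_weak_gradient_def grad_inner_Basis)
  with i integration_by_parts[OF \<phi> \<psi>, of b]
  have "(\<integral>x. (u x - \<phi> x) * (grad \<psi> x \<bullet> b) \<partial>M) = - (\<integral>x. (g x - grad \<phi> x) \<bullet> b * \<psi> x \<partial>M)"
    by (simp add: left_diff_distrib inner_diff_left)
  then show "(\<integral>x. (u x - \<phi> x) * frechet_derivative \<psi> (at x) b \<partial>M) = - (\<integral>x. (g x - grad \<phi> x) \<bullet> b * \<psi> x \<partial>M)"
    by (simp add: grad_inner_Basis[OF b])
qed

text \<open>The H^1 distance to a test function can be computed with g - grad (\<phi> j), so its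
  convergence to 0 is the convergence of both L^2 distances.\<close>

lemma H10_iff_pair: "u \<in> H10 \<Omega> \<longleftrightarrow> (\<exists>g. H10_pair u g)"
proof
  assume "u \<in> H10 \<Omega>"
  then obtain g \<phi> where g: "L2 M u" "is_weak_gradient \<Omega> u g" and \<phi>: "\<And>j. test_function \<Omega> (\<phi> j)"
    and lim: "(\<lambda>j. H1_norm \<Omega> (\<lambda>x. u x - \<phi> j x)) \<longlonglongrightarrow> 0"
    by (auto simp: H10_def H1_def square_integrable_iff_L2)
  have Lg: "L2 M g" using g by (simp add: is_weak_gradient_def square_integrable_iff_L2)
  have "H1_norm \<Omega> (\<lambda>x. u x - \<phi> j x) = sqrt (sqn M (\<lambda>x. u x - \<phi> j x) + sqn M (\<lambda>x. g x - grad (\<phi> j) x))" for j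
    by (intro H1_norm_eq is_weak_gradient_diff_test L2_diff g \<phi> sqn_test)
  with lim have "(\<lambda>j. (sqrt (sqn M (\<lambda>x. u x - \<phi> j x) + sqn M (\<lambda>x. g x - grad (\<phi> j) x)))\<^sup>2) \<longlonglongrightarrow> 0\<^sup>2"
    by (intro tendsto_power) (simp only:)
  moreover have "(sqrt (sqn M (\<lambda>x. u x - \<phi> j x) + sqn M (\<lambda>x. g x - grad (\<phi> j) x)))\<^sup>2
      = sqn M (\<lambda>x. u x - \<phi> j x) + sqn M (\<lambda>x. g x - grad (\<phi> j) x)" for j
    by (intro real_sqrt_pow2 add_nonneg_nonneg sqn_nonneg)
  ultimately have l: "(\<lambda>j. sqn M (\<lambda>x. u x - \<phi> j x) + sqn M (\<lambda>x. g x - grad (\<phi> j) x)) \<longlonglongrightarrow> 0"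
    by simp
  have "(\<lambda>j. sqn M (\<lambda>x. u x - \<phi> j x)) \<longlonglongrightarrow> 0" "(\<lambda>j. sqn M (\<lambda>x. g x - grad (\<phi> j) x)) \<longlonglongrightarrow> 0"
    by (rule tendsto_sandwich[OF _ _ tendsto_const l], simp_all)+
  then show "\<exists>g. H10_pair u g"
    using g Lg \<phi> unfolding H10_pair_def by blast
next
  assume "\<exists>g. H10_pair u g"
  then obtain g where g: "H10_pair u g" ..
  note L = H10_pair_L2[OF g] and wg = H10_pair_weak_gradient[OF g]
  obtain \<phi> where \<phi>: "\<And>j. test_function \<Omega> (\<phi> j)" and l: "(\<lambda>j. sqn M (\<lambda>x. u x - \<phi> j x)) \<longlonglongrightarrow> 0"
      "(\<lambda>j. sqn M (\<lambda>x. g x - grad (\<phi> j) x)) \<longlonglongrightarrow> 0"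
    using g unfolding H10_pair_def by blast
  have "H1_norm \<Omega> (\<lambda>x. u x - \<phi> j x) = sqrt (sqn M (\<lambda>x. u x - \<phi> j x) + sqn M (\<lambda>x. g x - grad (\<phi> j) x))" for j
    by (intro H1_norm_eq is_weak_gradient_diff_test L2_diff L wg \<phi> sqn_test)
  moreover have "(\<lambda>j. sqrt (sqn M (\<lambda>x. u x - \<phi> j x) + sqn M (\<lambda>x. g x - grad (\<phi> j) x))) \<longlonglongrightarrow> sqrt (0 + 0)"
    by (intro tendsto_real_sqrt tendsto_add l)
  ultimately have "(\<lambda>j. H1_norm \<Omega> (\<lambda>x. u x - \<phi> j x)) \<longlonglongrightarrow> 0" by simp
  then show "u \<in> H10 \<Omega>"
    using L wg \<phi> by (auto simp: H10_def H1_def square_integrable_iff_L2)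
qed

end

section \<open>Chain rule\<close>

text \<open>Squaring removes the kink of the positive part. This is the C^1 building block of the
  cut-off functions below, to which the chain rule applies.\<close>

lemma DERIV_max_0_power2: "((\<lambda>t. (max 0 t)\<^sup>2) has_real_derivative 2 * max 0 t) (at t)"
proof -
  consider "t < 0" | "t = 0" | "t > 0" by linarith
  then show ?thesis
  proof cases
    case 1
    have "((\<lambda>_. 0) has_real_derivative 0) (at t)" by simp
    then have "((\<lambda>t. (max 0 t)\<^sup>2) has_real_derivative 0) (at t)"
      by (rule has_field_derivative_transform_within_open[where S="{..<0}"]) (use 1 in auto)
    with 1 show ?thesis by simp
  next
    case 2
    have "((\<lambda>h. ((max 0 (0 + h))\<^sup>2 - (max 0 0)\<^sup>2) / h) \<longlongrightarrow> 0) (at (0::real))"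
    proof (rule Lim_transform_eventually)
      show "((\<lambda>h::real. max 0 h) \<longlongrightarrow> 0) (at 0)"
        by (rule tendsto_eq_intros refl | simp)+
      show "\<forall>\<^sub>F h in at (0::real). max 0 h = ((max 0 (0 + h))\<^sup>2 - (max 0 0)\<^sup>2) / h"
        by (auto simp: eventually_at_filter max_def power2_eq_square)
    qed
    with 2 show ?thesis by (simp add: DERIV_def)
  next
    case 3
    have "((\<lambda>t. t\<^sup>2) has_real_derivative 2 * t) (at t)"
      by (auto intro!: derivative_eq_intros)
    then have "((\<lambda>t. (max 0 t)\<^sup>2) has_real_derivative 2 * t) (at t)"
      by (rule has_field_derivative_transform_within_open[where S="{0<..}"]) (use 3 in auto)
    with 3 show ?thesis by simp
  qed
qed

lemma sqn_le:
  assumes "L2 M g" "f \<in> borel_measurable M" "\<And>x. norm (f x) \<le> c * norm (g x)"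
  shows "sqn M f \<le> c\<^sup>2 * sqn M g"
proof -
  have le: "(norm (f x))\<^sup>2 \<le> c\<^sup>2 * (norm (g x))\<^sup>2" for x
    using power_mono[OF assms(3)[of x], of 2] by (simp add: power_mult_distrib)
  have "integrable M (\<lambda>x. c\<^sup>2 * (norm (g x))\<^sup>2)"
    using assms(1) by (auto simp: L2_def)
  moreover from this have "integrable M (\<lambda>x. (norm (f x))\<^sup>2)"
    by (rule Bochner_Integration.integrable_bound) (use assms(2) le in auto)
  ultimately have "sqn M f \<le> (\<integral>x. c\<^sup>2 * (norm (g x))\<^sup>2 \<partial>M)"
    using le by (intro integral_mono) auto
  then show ?thesis by simp
qed

lemma L2_bound_mult:
  assumes "L2 M g" "f \<in> borel_measurable M" "\<And>x. norm (f x) \<le> c * norm (g x)"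
  shows "L2 M f"
proof (rule L2_bound[OF L2_scaleR[OF assms(1), of c] assms(2)])
  show "norm (f x) \<le> norm (c *\<^sub>R g x)" for x
    using assms(3)[of x] order_trans[OF _ mult_right_mono[OF abs_ge_self norm_ge_zero]] by auto
qed

text \<open>Weierstrass approximation is applied to the derivative, and the polynomial is integrated
  from 0. The primitive has no constant term, so it maps test functions to test functions, and its
  error is proportional to |t|, hence controlled by the function it is composed with.\<close>

lemma polynomial_C1_approx:
  fixes \<psi> \<psi>' :: "real \<Rightarrow> real"
  assumes d: "\<And>t. (\<psi> has_real_derivative \<psi>' t) (at t)" and c: "continuous_on UNIV \<psi>'"
    and "\<psi> 0 = 0" "0 < R" "0 < e"
  obtains a n where
    "\<forall>t. \<bar>t\<bar> \<le> R \<longrightarrow> \<bar>(\<Sum>i\<le>n. a i * t ^ i) - \<psi>' t\<bar> \<le> e"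
    "\<forall>t. \<bar>t\<bar> \<le> R \<longrightarrow> \<bar>(\<Sum>i\<le>n. a i / real (Suc i) * t ^ Suc i) - \<psi> t\<bar> \<le> e * \<bar>t\<bar>"
    "\<forall>t. ((\<lambda>t. \<Sum>i\<le>n. a i / real (Suc i) * t ^ Suc i) has_real_derivative (\<Sum>i\<le>n. a i * t ^ i)) (at t)"
proof -
  obtain p where p: "real_polynomial_function p" "\<And>t. t \<in> {-R..R} \<Longrightarrow> \<bar>\<psi>' t - p t\<bar> < e"
    using Stone_Weierstrass_real_polynomial_function[of "{-R..R}" \<psi>' e] continuous_on_subset[OF c] assms by auto
  obtain a n where a: "p = (\<lambda>t. \<Sum>i\<le>n. a i * t ^ i)"
    using p(1) unfolding real_polynomial_function_iff_sum by blast
  let ?P = "\<lambda>t. \<Sum>i\<le>n. a i / real (Suc i) * t ^ Suc i"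
  have D: "(?P has_real_derivative p t) (at t)" for t
    unfolding a
  proof (rule DERIV_sum)
    fix i
    show "((\<lambda>t. a i / real (Suc i) * t ^ Suc i) has_real_derivative a i * t ^ i) (at t)"
      using DERIV_cmult[OF DERIV_pow[of "Suc i" t], of "a i / real (Suc i)"]
      by (simp del: power_Suc of_nat_Suc)
  qed
  define h where "h t = ?P t - \<psi> t" for t
  have dh: "(h has_field_derivative p t - \<psi>' t) (at t within {-R..R})" for t
    unfolding h_def by (rule has_field_derivative_at_within[OF DERIV_diff[OF D d]])
  have bh: "norm (p t - \<psi>' t) \<le> e" if "t \<in> {-R..R}" for t
    using p(2)[OF that] by (simp add: abs_minus_commute)
  have "\<bar>?P t - \<psi> t\<bar> \<le> e * \<bar>t\<bar>" if t: "\<bar>t\<bar> \<le> R" for t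
  proof -
    have "h 0 = 0" using assms(3) by (simp add: h_def)
    moreover have "norm (h t - h 0) \<le> e * norm (t - 0)"
      by (rule field_differentiable_bound[OF convex_real_interval(5) dh bh]) (use t assms in auto)
    ultimately show ?thesis by (simp add: h_def)
  qed
  moreover have "\<bar>p t - \<psi>' t\<bar> \<le> e" if "\<bar>t\<bar> \<le> R" for t
    using p(2)[of t] that by (simp add: abs_minus_commute abs_le_iff less_imp_le)
  ultimately show ?thesis
    using D unfolding a by (intro that[of a n]) blast+
qed

context bounded_domain
begin

lemma test_power_Suc: "test_function \<Omega> \<phi> \<Longrightarrow> test_function \<Omega> (\<lambda>x. \<phi> x ^ Suc n)"
proof (induction n)
  case (Suc n)
  then show ?case using test_function_mult[OF Suc.prems Suc.IH[OF Suc.prems]] by simp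
qed simp

lemma test_polynomial: "test_function \<Omega> \<phi> \<Longrightarrow> test_function \<Omega> (\<lambda>x. \<Sum>i\<le>n::nat. a i * \<phi> x ^ Suc i)"
proof (induction n)
  case 0
  show ?case using test_function_cmult[OF test_power_Suc[OF 0, of 0]] by simp
next
  case (Suc n)
  show ?case
    using test_function_add[OF Suc.IH[OF Suc.prems] test_function_cmult[OF test_power_Suc[OF Suc.prems, of "Suc n"]]]
    by simp
qed

text \<open>The composition need not be smooth, so it is reached as a limit of polynomials in
  \<phi>; the errors of function and gradient are at most 1/(n+1) times \<phi> and its
  gradient.\<close>

lemma H10_pair_chain_test:
  fixes \<psi> \<psi>' :: "real \<Rightarrow> real"
  assumes \<phi>: "test_function \<Omega> \<phi>"
    and d: "\<And>t. (\<psi> has_real_derivative \<psi>' t) (at t)" and c: "continuous_on UNIV \<psi>'" and z: "\<psi> 0 = 0"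
  shows "H10_pair (\<lambda>x. \<psi> (\<phi> x)) (\<lambda>x. \<psi>' (\<phi> x) *\<^sub>R grad \<phi> x)"
proof -
  obtain R where R: "0 < R" "\<And>x. \<bar>\<phi> x\<bar> \<le> R"
    using cont_csupp_bounded[OF test_function_cont_csupp(1)[OF \<phi>]] by auto
  define Q where "Q n p \<longleftrightarrow> (\<forall>t. \<bar>t\<bar> \<le> R \<longrightarrow> \<bar>snd p t - \<psi>' t\<bar> \<le> 1 / real (Suc n)) \<and>
      (\<forall>t. \<bar>t\<bar> \<le> R \<longrightarrow> \<bar>fst p t - \<psi> t\<bar> \<le> 1 / real (Suc n) * \<bar>t\<bar>) \<and>
      (\<forall>t. (fst p has_real_derivative snd p t) (at t)) \<and> test_function \<Omega> (\<lambda>x. fst p (\<phi> x))"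
    for n :: nat and p :: "(real \<Rightarrow> real) \<times> (real \<Rightarrow> real)"
  have "\<exists>p. Q n p" for n
  proof -
    have "0 < 1 / real (Suc n)" by simp
    then obtain a m where a:
      "\<forall>t. \<bar>t\<bar> \<le> R \<longrightarrow> \<bar>(\<Sum>i\<le>m. a i * t ^ i) - \<psi>' t\<bar> \<le> 1 / real (Suc n)"
      "\<forall>t. \<bar>t\<bar> \<le> R \<longrightarrow> \<bar>(\<Sum>i\<le>m. a i / real (Suc i) * t ^ Suc i) - \<psi> t\<bar> \<le> 1 / real (Suc n) * \<bar>t\<bar>"
      "\<forall>t. ((\<lambda>t. \<Sum>i\<le>m. a i / real (Suc i) * t ^ Suc i) has_real_derivative (\<Sum>i\<le>m. a i * t ^ i)) (at t)"
      by (rule polynomial_C1_approx[OF d c z R(1)]) (rule that)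
    have "Q n (\<lambda>t. \<Sum>i\<le>m. a i / real (Suc i) * t ^ Suc i, \<lambda>t. \<Sum>i\<le>m. a i * t ^ i)"
      unfolding Q_def fst_conv snd_conv using a test_polynomial[OF \<phi>, of "\<lambda>i. a i / real (Suc i)" m] by blast
    then show ?thesis ..
  qed
  then have "\<forall>n. \<exists>p. Q n p" ..
  from choice[OF this] obtain q where q: "\<forall>n. Q n (q n)" ..
  define P where "P n = fst (q n)" for n
  define p where "p n = snd (q n)" for n
  have P: "\<And>n t. \<bar>t\<bar> \<le> R \<Longrightarrow> \<bar>p n t - \<psi>' t\<bar> \<le> 1 / real (Suc n)"
    "\<And>n t. \<bar>t\<bar> \<le> R \<Longrightarrow> \<bar>P n t - \<psi> t\<bar> \<le> 1 / real (Suc n) * \<bar>t\<bar>"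
    "\<And>n t. (P n has_real_derivative p n t) (at t)" "\<And>n. test_function \<Omega> (\<lambda>x. P n (\<phi> x))"
    using q by (auto simp: Q_def P_def p_def)
  have gP: "grad (\<lambda>x. P n (\<phi> x)) x = p n (\<phi> x) *\<^sub>R grad \<phi> x" for n x
    using DERIV_compose_FDERIV[OF P(3) test_function_has_derivative[OF \<phi>]]
    by (intro grad_unique) (simp add: mult.commute)
  have cont: "continuous_on UNIV \<psi>"
    using d DERIV_isCont by (blast intro: continuous_at_imp_continuous_on)
  have [measurable]: "\<psi> \<in> borel_measurable borel" "\<psi>' \<in> borel_measurable borel"
    using c cont by (auto intro: borel_measurable_continuous_onI)
  note [measurable] = test_measurable[OF \<phi>] grad_measurable[OF \<phi>] test_measurable[OF P(4)] grad_measurable[OF P(4)]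
  have "compact (\<psi>' ` {-R..R})"
    using c by (intro compact_continuous_image) (auto intro: continuous_on_subset)
  then obtain K where K: "\<And>t. \<bar>t\<bar> \<le> R \<Longrightarrow> \<bar>\<psi>' t\<bar> \<le> K"
    using compact_imp_bounded[of "\<psi>' ` {-R..R}"] by (fastforce simp: bounded_iff abs_le_iff)
  note L = sqn_test(3,4)[OF \<phi>] and LP = sqn_test(3,4)[OF P(4)]
  have b1: "norm (P n (\<phi> x) - \<psi> (\<phi> x)) \<le> 1 / real (Suc n) * norm (\<phi> x)" for n x
    using P(2)[OF R(2)] by simp
  have b2: "norm (grad (\<lambda>x. P n (\<phi> x)) x - \<psi>' (\<phi> x) *\<^sub>R grad \<phi> x) \<le> 1 / real (Suc n) * norm (grad \<phi> x)" for n x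
    unfolding gP scaleR_left_diff_distrib[symmetric] norm_scaleR using P(1)[OF R(2)]
    by (intro mult_right_mono) auto
  have lim: "(\<lambda>n. (1 / real (Suc n))\<^sup>2 * s) \<longlonglongrightarrow> 0" for s
  proof (rule tendsto_mult_left_zero)
    show "(\<lambda>n. (1 / real (Suc n))\<^sup>2) \<longlonglongrightarrow> 0"
      using tendsto_power[OF LIMSEQ_inverse_real_of_nat, of 2]
      by (simp only: inverse_eq_divide power_zero_numeral)
  qed
  show ?thesis
  proof (rule H10_pairI[OF _ _ P(4)])
    have "L2 M (\<lambda>x. P 0 (\<phi> x) - \<psi> (\<phi> x))"
      using b1[of 0] by (intro L2_bound_mult[OF L(1), of _ 1]) auto
    from L2_diff[OF LP(1)[of 0] this] show "L2 M (\<lambda>x. \<psi> (\<phi> x))" by simp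
    show "L2 M (\<lambda>x. \<psi>' (\<phi> x) *\<^sub>R grad \<phi> x)"
      by (intro L2_bound_mult[OF L(2), of _ K]) (auto intro!: mult_right_mono K R)
    show "(\<lambda>n. sqn M (\<lambda>x. P n (\<phi> x) - \<psi> (\<phi> x))) \<longlonglongrightarrow> 0"
    proof (rule tendsto_sandwich[OF _ _ tendsto_const lim])
      show "\<forall>\<^sub>F n in sequentially. sqn M (\<lambda>x. P n (\<phi> x) - \<psi> (\<phi> x)) \<le> (1 / real (Suc n))\<^sup>2 * sqn M \<phi>"
        by (intro always_eventually allI sqn_le L b1) measurable
    qed (simp only: sqn_nonneg eventually_True)
    show "(\<lambda>n. sqn M (\<lambda>x. grad (\<lambda>x. P n (\<phi> x)) x - \<psi>' (\<phi> x) *\<^sub>R grad \<phi> x)) \<longlonglongrightarrow> 0"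
    proof (rule tendsto_sandwich[OF _ _ tendsto_const lim])
      show "\<forall>\<^sub>F n in sequentially. sqn M (\<lambda>x. grad (\<lambda>x. P n (\<phi> x)) x - \<psi>' (\<phi> x) *\<^sub>R grad \<phi> x)
          \<le> (1 / real (Suc n))\<^sup>2 * sqn M (grad \<phi>)"
        by (intro always_eventually allI sqn_le L b2) measurable
    qed (simp only: sqn_nonneg eventually_True)
  qed
qed

text \<open>Both factors of the approximating gradients vary. The gradients of \<phi> n converge in
  L^2 and are multiplied by bounded factors; these factors converge almost everywhere along a
  subsequence and are handled by dominated convergence.\<close>

lemma H10_pair_chain:
  fixes \<psi> \<psi>' :: "real \<Rightarrow> real"
  assumes ug: "H10_pair u g"
    and d: "\<And>t. (\<psi> has_real_derivative \<psi>' t) (at t)" and c: "continuous_on UNIV \<psi>'" and z: "\<psi> 0 = 0"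
    and K: "\<And>t. \<bar>\<psi>' t\<bar> \<le> K"
  shows "H10_pair (\<lambda>x. \<psi> (u x)) (\<lambda>x. \<psi>' (u x) *\<^sub>R g x)"
proof -
  note L = H10_pair_L2[OF ug]
  obtain \<phi>0 where \<phi>0: "\<And>j. test_function \<Omega> (\<phi>0 j)" "(\<lambda>j. sqn M (\<lambda>x. \<phi>0 j x - u x)) \<longlonglongrightarrow> 0"
      "(\<lambda>j. sqn M (\<lambda>x. grad (\<phi>0 j) x - g x)) \<longlonglongrightarrow> 0"
    using ug by (rule H10_pairE) (rule that)
  obtain r where r: "strict_mono (r :: nat \<Rightarrow> nat)" "AE x in M. (\<lambda>n. \<phi>0 (r n) x) \<longlonglongrightarrow> u x"
    by (rule sqn_tendsto_0_AE_subseq[OF sqn_test(3)[OF \<phi>0(1)] L(1) \<phi>0(2)]) (rule that)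
  define \<phi> where "\<phi> n = \<phi>0 (r n)" for n
  have \<phi>: "\<And>j. test_function \<Omega> (\<phi> j)" "(\<lambda>j. sqn M (\<lambda>x. \<phi> j x - u x)) \<longlonglongrightarrow> 0"
      "(\<lambda>j. sqn M (\<lambda>x. grad (\<phi> j) x - g x)) \<longlonglongrightarrow> 0" "AE x in M. (\<lambda>n. \<phi> n x) \<longlonglongrightarrow> u x"
    using \<phi>0(1) LIMSEQ_subseq_LIMSEQ[OF \<phi>0(2) r(1)] LIMSEQ_subseq_LIMSEQ[OF \<phi>0(3) r(1)] r(2)
    by (simp_all add: \<phi>_def o_def)
  have cont: "continuous_on UNIV \<psi>"
    using d DERIV_isCont by (blast intro: continuous_at_imp_continuous_on)
  have [measurable]: "\<psi> \<in> borel_measurable borel" "\<psi>' \<in> borel_measurable borel"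
    using c cont by (auto intro: borel_measurable_continuous_onI)
  note [measurable] = test_measurable[OF \<phi>(1)] grad_measurable[OF \<phi>(1)] L2_measurable[OF L(1)] L2_measurable[OF L(2)]
  have lip: "norm (\<psi> s - \<psi> t) \<le> K * norm (s - t)" for s t
    using field_differentiable_bound[of UNIV \<psi> \<psi>' K s t] d K by auto
  have lip0: "norm (\<psi> s) \<le> K * norm s" for s
    using lip[of s 0] z by simp
  have LG: "L2 M (\<lambda>x. \<psi>' (v x) *\<^sub>R h x)"
    if "L2 M h" and [measurable]: "v \<in> borel_measurable M" for v :: "'a \<Rightarrow> real" and h :: "'a \<Rightarrow> 'a"
    using that K L2_measurable[OF that(1)] by (intro L2_bound_mult[OF that(1), of _ K]) (auto intro!: mult_right_mono)
  show ?thesis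
  proof (rule H10_pair_closed[where us="\<lambda>n x. \<psi> (\<phi> n x)" and gs="\<lambda>n x. \<psi>' (\<phi> n x) *\<^sub>R grad (\<phi> n) x"])
    show "H10_pair (\<lambda>x. \<psi> (\<phi> n x)) (\<lambda>x. \<psi>' (\<phi> n x) *\<^sub>R grad (\<phi> n) x)" for n
      by (rule H10_pair_chain_test[OF \<phi>(1) d c z])
    show "L2 M (\<lambda>x. \<psi> (u x))"
      by (rule L2_bound_mult[OF L(1) _ lip0]) measurable
    show "L2 M (\<lambda>x. \<psi>' (u x) *\<^sub>R g x)" by (rule LG[OF L(2)]) measurable
    show "(\<lambda>n. sqn M (\<lambda>x. \<psi> (\<phi> n x) - \<psi> (u x))) \<longlonglongrightarrow> 0"
    proof (rule tendsto_sandwich[OF _ _ tendsto_const tendsto_mult_right_zero[OF \<phi>(2), of "K\<^sup>2"]])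
      show "\<forall>\<^sub>F n in sequentially. sqn M (\<lambda>x. \<psi> (\<phi> n x) - \<psi> (u x)) \<le> K\<^sup>2 * sqn M (\<lambda>x. \<phi> n x - u x)"
        by (intro always_eventually allI sqn_le L2_diff sqn_test \<phi> L lip) measurable
    qed (simp only: sqn_nonneg eventually_True)
    have l1: "(\<lambda>n. sqn M (\<lambda>x. (\<psi>' (\<phi> n x) - \<psi>' (u x)) *\<^sub>R g x)) \<longlonglongrightarrow> (\<integral>x. 0 \<partial>M)"
    proof (rule integral_dominated_convergence[where w="\<lambda>x. (2 * K)\<^sup>2 * (norm (g x))\<^sup>2"])
      show "integrable M (\<lambda>x. (2 * K)\<^sup>2 * (norm (g x))\<^sup>2)"
        using L2_integrable[OF L(2)] by simp
      show "AE x in M. (\<lambda>n. (norm ((\<psi>' (\<phi> n x) - \<psi>' (u x)) *\<^sub>R g x))\<^sup>2) \<longlonglongrightarrow> 0"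
        using \<phi>(4)
      proof eventually_elim
        case (elim x)
        have "isCont \<psi>' (u x)" using c by (simp add: continuous_on_eq_continuous_at)
        from isCont_tendsto_compose[OF this elim]
        have "(\<lambda>n. (norm ((\<psi>' (\<phi> n x) - \<psi>' (u x)) *\<^sub>R g x))\<^sup>2) \<longlonglongrightarrow> (norm ((\<psi>' (u x) - \<psi>' (u x)) *\<^sub>R g x))\<^sup>2"
          by (intro tendsto_intros)
        then show ?case by simp
      qed
      show "AE x in M. norm ((norm ((\<psi>' (\<phi> n x) - \<psi>' (u x)) *\<^sub>R g x))\<^sup>2) \<le> (2 * K)\<^sup>2 * (norm (g x))\<^sup>2" for n
      proof (rule AE_I2)
        fix x
        have "\<bar>\<psi>' (\<phi> n x) - \<psi>' (u x)\<bar> \<le> 2 * K" using K[of "\<phi> n x"] K[of "u x"] by linarith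
        then have "norm ((\<psi>' (\<phi> n x) - \<psi>' (u x)) *\<^sub>R g x) \<le> 2 * K * norm (g x)"
          by (simp add: mult_right_mono)
        from power_mono[OF this norm_ge_zero, of 2]
        show "norm ((norm ((\<psi>' (\<phi> n x) - \<psi>' (u x)) *\<^sub>R g x))\<^sup>2) \<le> (2 * K)\<^sup>2 * (norm (g x))\<^sup>2"
          by (simp only: power_mult_distrib real_norm_def abs_power2 abs_of_nonneg[OF zero_le_power2])
      qed
    qed measurable
    have lim: "(\<lambda>n. 2 * (K\<^sup>2 * sqn M (\<lambda>x. grad (\<phi> n) x - g x)) + 2 * sqn M (\<lambda>x. (\<psi>' (\<phi> n x) - \<psi>' (u x)) *\<^sub>R g x)) \<longlonglongrightarrow> 0"
      using tendsto_add[OF tendsto_mult_right_zero[OF tendsto_mult_right_zero[OF \<phi>(3), of "K\<^sup>2"], of 2]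
        tendsto_mult_right_zero[OF l1[simplified], of 2]] by simp
    show "(\<lambda>n. sqn M (\<lambda>x. \<psi>' (\<phi> n x) *\<^sub>R grad (\<phi> n) x - \<psi>' (u x) *\<^sub>R g x)) \<longlonglongrightarrow> 0"
    proof (rule tendsto_sandwich[OF _ _ tendsto_const lim])
      show "\<forall>\<^sub>F n in sequentially. sqn M (\<lambda>x. \<psi>' (\<phi> n x) *\<^sub>R grad (\<phi> n) x - \<psi>' (u x) *\<^sub>R g x)
        \<le> 2 * (K\<^sup>2 * sqn M (\<lambda>x. grad (\<phi> n) x - g x)) + 2 * sqn M (\<lambda>x. (\<psi>' (\<phi> n x) - \<psi>' (u x)) *\<^sub>R g x)"
      proof (intro always_eventually allI)
        fix n
        have eq: "\<psi>' (\<phi> n x) *\<^sub>R grad (\<phi> n) x - \<psi>' (u x) *\<^sub>R g x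
          = \<psi>' (\<phi> n x) *\<^sub>R (grad (\<phi> n) x - g x) + (\<psi>' (\<phi> n x) - \<psi>' (u x)) *\<^sub>R g x" for x
          by (simp add: algebra_simps)
        have La: "L2 M (\<lambda>x. grad (\<phi> n) x - g x)" by (intro L2_diff sqn_test \<phi> L)
        have "L2 M (\<lambda>x. \<psi>' (\<phi> n x) *\<^sub>R (grad (\<phi> n) x - g x))" by (rule LG[OF La]) measurable
        moreover have "L2 M (\<lambda>x. (\<psi>' (\<phi> n x) - \<psi>' (u x)) *\<^sub>R g x)"
          unfolding scaleR_left_diff_distrib by (intro L2_diff LG L) measurable
        ultimately have "sqn M (\<lambda>x. \<psi>' (\<phi> n x) *\<^sub>R grad (\<phi> n) x - \<psi>' (u x) *\<^sub>R g x)
          \<le> 2 * sqn M (\<lambda>x. \<psi>' (\<phi> n x) *\<^sub>R (grad (\<phi> n) x - g x)) + 2 * sqn M (\<lambda>x. (\<psi>' (\<phi> n x) - \<psi>' (u x)) *\<^sub>R g x)"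
          unfolding eq by (rule sqn_add_le)
        moreover have "sqn M (\<lambda>x. \<psi>' (\<phi> n x) *\<^sub>R (grad (\<phi> n) x - g x)) \<le> K\<^sup>2 * sqn M (\<lambda>x. grad (\<phi> n) x - g x)"
          by (rule sqn_le[OF La]) (auto intro!: mult_right_mono K)
        ultimately show "sqn M (\<lambda>x. \<psi>' (\<phi> n x) *\<^sub>R grad (\<phi> n) x - \<psi>' (u x) *\<^sub>R g x)
        \<le> 2 * (K\<^sup>2 * sqn M (\<lambda>x. grad (\<phi> n) x - g x)) + 2 * sqn M (\<lambda>x. (\<psi>' (\<phi> n x) - \<psi>' (u x)) *\<^sub>R g x)"
          by linarith
      qed
    qed (simp only: sqn_nonneg eventually_True)
  qed
qed

end

section \<open>Minimisers of the truncated energy\<close>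

lemma le_if_le_add_mult_small:
  fixes A B C t0 :: real
  assumes "0 < t0" and le: "\<And>t. 0 < t \<Longrightarrow> t < t0 \<Longrightarrow> A \<le> B + t * C"
  shows "A \<le> B"
proof (rule tendsto_le[OF _ _ tendsto_const])
  have "((\<lambda>t. B + t * C) \<longlongrightarrow> B + 0 * C) (at_right 0)"
    by (intro tendsto_intros)
  then show "((\<lambda>t. B + t * C) \<longlongrightarrow> B) (at_right 0)" by simp
  show "\<forall>\<^sub>F t in at_right 0. A \<le> B + t * C"
    using eventually_at_right_real[OF assms(1)] by eventually_elim (use le in auto)
qed simp

lemma minimizing_sequence:
  fixes J :: "'b \<Rightarrow> real"
  assumes ne: "T \<noteq> {}" and low: "\<And>x. x \<in> T \<Longrightarrow> b \<le> J x"
  obtains m w where "\<And>x. x \<in> T \<Longrightarrow> m \<le> J x" "\<And>n. w n \<in> T \<and> J (w n) < m + 1 / real (Suc n)"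
proof -
  have bdd: "bdd_below (J ` T)" using low by (intro bdd_belowI[of _ b]) auto
  have "\<exists>x. x \<in> T \<and> J x < (INF x\<in>T. J x) + 1 / real (Suc n)" for n
    using cINF_less_iff[OF ne bdd, of "(INF x\<in>T. J x) + 1 / real (Suc n)"] by auto
  then have "\<forall>n. \<exists>x. x \<in> T \<and> J x < (INF x\<in>T. J x) + 1 / real (Suc n)" ..
  from choice[OF this] obtain w where "\<forall>n. w n \<in> T \<and> J (w n) < (INF x\<in>T. J x) + 1 / real (Suc n)" ..
  then show ?thesis by (intro that[of "INF x\<in>T. J x" w] cINF_lower[OF bdd]) auto
qed

text \<open>The step and the displacement of the base point are both below 1/(k+1); for Lipschitz
  functions the infimum over k is the Clarke derivative in direction 1. The opposite direction is
  obtained from the negated function.\<close>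

definition quot_sup :: "(real \<Rightarrow> real) \<Rightarrow> nat \<Rightarrow> real \<Rightarrow> real" where
  "quot_sup f k s = (SUP (z, \<tau>) \<in> ball s (1 / real (Suc k)) \<times> {0<..<1 / real (Suc k)}. (f (z + \<tau>) - f z) / \<tau>)"

locale lipschitz_fun =
  fixes \<Phi> :: "real \<Rightarrow> real" and K :: real
  assumes lip: "\<And>s t. \<bar>\<Phi> s - \<Phi> t\<bar> \<le> K * \<bar>s - t\<bar>"
begin

lemma K_nonneg: "0 \<le> K"
  using lip[of 1 0] by (simp add: order_trans[OF abs_ge_zero])

lemma quot_bound: "0 < \<tau> \<Longrightarrow> \<bar>(\<Phi> (z + \<tau>) - \<Phi> z) / \<tau>\<bar> \<le> K"
  using lip[of "z + \<tau>" z] by (simp add: field_simps)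

lemma quot_le: "0 < \<tau> \<Longrightarrow> (\<Phi> (z + \<tau>) - \<Phi> z) / \<tau> \<le> K"
  by (rule order_trans[OF abs_ge_self quot_bound])

lemma quot_bdd: "bdd_above ((\<lambda>(z, \<tau>). (\<Phi> (z + \<tau>) - \<Phi> z) / \<tau>) ` (ball s (1 / real (Suc k)) \<times> {0<..<1 / real (Suc k)}))"
proof (rule bdd_aboveI[of _ K])
  fix q assume "q \<in> (\<lambda>(z, \<tau>). (\<Phi> (z + \<tau>) - \<Phi> z) / \<tau>) ` (ball s (1 / real (Suc k)) \<times> {0<..<1 / real (Suc k)})"
  then obtain z \<tau> where "0 < \<tau>" "q = (\<Phi> (z + \<tau>) - \<Phi> z) / \<tau>" by auto
  with quot_le[of \<tau> z] show "q \<le> K" by simp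
qed

lemma quot_le_sup:
  assumes "\<bar>z - s\<bar> < 1 / real (Suc k)" "0 < \<tau>" "\<tau> < 1 / real (Suc k)"
  shows "(\<Phi> (z + \<tau>) - \<Phi> z) / \<tau> \<le> quot_sup \<Phi> k s"
  unfolding quot_sup_def
  using assms by (intro cSUP_upper2[OF quot_bdd, of "(z, \<tau>)"]) (auto simp: dist_real_def abs_minus_commute)

lemma quot_sup_nonempty: "ball s (1 / real (Suc k)) \<times> {0<..<1 / real (Suc k)} \<noteq> {}"
  by (auto simp: ball_eq_empty)

lemma quot_sup_le:
  assumes "\<And>z \<tau>. \<bar>z - s\<bar> < 1 / real (Suc k) \<Longrightarrow> 0 < \<tau> \<Longrightarrow> \<tau> < 1 / real (Suc k) \<Longrightarrow> (\<Phi> (z + \<tau>) - \<Phi> z) / \<tau> \<le> c"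
  shows "quot_sup \<Phi> k s \<le> c"
  unfolding quot_sup_def
proof (rule cSUP_least[OF quot_sup_nonempty])
  fix p assume p: "p \<in> ball s (1 / real (Suc k)) \<times> {0<..<1 / real (Suc k)}"
  obtain z \<tau> where zt: "p = (z, \<tau>)" by (cases p)
  show "(case p of (z, \<tau>) \<Rightarrow> (\<Phi> (z + \<tau>) - \<Phi> z) / \<tau>) \<le> c"
    using p assms[of z \<tau>] by (simp add: zt dist_real_def abs_minus_commute)
qed

lemma quot_sup_bound: "\<bar>quot_sup \<Phi> k s\<bar> \<le> K"
proof (rule abs_leI)
  show "quot_sup \<Phi> k s \<le> K"
    by (intro quot_sup_le quot_le)
  have "- K \<le> (\<Phi> (s + 1 / (2 * real (Suc k))) - \<Phi> s) / (1 / (2 * real (Suc k)))"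
    using quot_bound[of "1 / (2 * real (Suc k))" s] by (simp add: abs_le_iff)
  also have "\<dots> \<le> quot_sup \<Phi> k s"
    by (rule quot_le_sup) (auto simp: field_simps)
  finally show "- quot_sup \<Phi> k s \<le> K" by simp
qed

text \<open>Superlevel sets are open, since a pair (z, \<tau>) whose quotient exceeds c stays
  admissible for all points near s.\<close>

lemma quot_sup_measurable [measurable]: "quot_sup \<Phi> k \<in> borel_measurable borel"
  unfolding borel_measurable_iff_greater
proof
  fix c :: real
  have "open {s. c < quot_sup \<Phi> k s}"
    unfolding open_contains_ball
  proof (rule ballI)
    fix s assume "s \<in> {s. c < quot_sup \<Phi> k s}"
    then have "c < quot_sup \<Phi> k s" by simp
    then obtain z \<tau> where z: "\<bar>z - s\<bar> < 1 / real (Suc k)" "0 < \<tau>" "\<tau> < 1 / real (Suc k)" "c < (\<Phi> (z + \<tau>) - \<Phi> z) / \<tau>"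
      using quot_sup_le[of s k c] by (force simp: not_less)
    define d where "d = 1 / real (Suc k) - \<bar>z - s\<bar>"
    have "0 < d" using z by (simp add: d_def)
    moreover have "ball s d \<subseteq> {s. c < quot_sup \<Phi> k s}"
    proof
      fix s' assume "s' \<in> ball s d"
      then have "\<bar>z - s'\<bar> < 1 / real (Suc k)" by (auto simp: d_def dist_real_def)
      from quot_le_sup[OF this z(2,3)] z(4) show "s' \<in> {s. c < quot_sup \<Phi> k s}" by simp
    qed
    ultimately show "\<exists>d>0. ball s d \<subseteq> {s. c < quot_sup \<Phi> k s}" by blast
  qed
  then show "{x \<in> space borel. c < quot_sup \<Phi> k x} \<in> sets borel" by simp
qed

lemma \<Phi>_measurable [measurable]: "\<Phi> \<in> borel_measurable borel"
proof (rule borel_measurable_continuous_onI, rule lipschitz_on_continuous_on)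
  show "K-lipschitz_on UNIV \<Phi>"
    using lip K_nonneg by (intro lipschitz_onI) (auto simp: dist_real_def)
qed

lemma neg: "lipschitz_fun (\<lambda>s. - \<Phi> s) K"
  using lip by unfold_locales (simp add: abs_minus_commute)

end

section \<open>Existence of a minimiser\<close>

lemma sqn_parallelogram:
  assumes f: "L2 M f" and g: "L2 M g"
  shows "sqn M (\<lambda>x. f x - g x) = 2 * sqn M f + 2 * sqn M g - sqn M (\<lambda>x. f x + g x)"
proof -
  have "(norm (f x - g x))\<^sup>2 = 2 * (norm (f x))\<^sup>2 + 2 * (norm (g x))\<^sup>2 - (norm (f x + g x))\<^sup>2" for x
    by (simp add: power2_norm_eq_inner inner_diff_left inner_diff_right inner_add_left inner_add_right inner_commute)
  then have "sqn M (\<lambda>x. f x - g x) = (\<integral>x. 2 * (norm (f x))\<^sup>2 + 2 * (norm (g x))\<^sup>2 - (norm (f x + g x))\<^sup>2 \<partial>M)"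
    by simp
  also have "\<dots> = 2 * sqn M f + 2 * sqn M g - sqn M (\<lambda>x. f x + g x)"
    using L2_integrable[OF f] L2_integrable[OF g] L2_integrable[OF L2_add[OF f g]] by simp
  finally show ?thesis .
qed

locale energy = bounded_domain \<Omega> + lipschitz_fun \<Phi> K
  for \<Omega> :: "'a::euclidean_space set" and \<Phi> :: "real \<Rightarrow> real" and K :: real +
  fixes B :: real
  assumes bounded_above: "\<And>s. \<bar>\<Phi> s\<bar> \<le> B"
begin

definition E :: "('a \<Rightarrow> real) \<Rightarrow> ('a \<Rightarrow> 'a) \<Rightarrow> real" where
  "E u g = sqn M g / 2 - (\<integral>x. \<Phi> (u x) \<partial>M)"

lemma \<Phi>_integrable:
  assumes [measurable]: "u \<in> borel_measurable M"
  shows "integrable M (\<lambda>x. \<Phi> (u x))"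
  using bounded_above by (intro integrable_const_bound[of _ B]) auto

text \<open>The bound is stated with the L^1 distance, because that is what \<open>rellich\<close>
  controls.\<close>

lemma \<Phi>_diff_le:
  assumes u: "L2 M u" and v: "L2 M v"
  shows "\<bar>(\<integral>x. \<Phi> (u x) \<partial>M) - (\<integral>x. \<Phi> (v x) \<partial>M)\<bar> \<le> K * (\<integral>x. \<bar>u x - v x\<bar> \<partial>M)"
proof -
  note [measurable] = L2_measurable[OF u] L2_measurable[OF v]
  have i: "integrable M (\<lambda>x. \<Phi> (u x))" "integrable M (\<lambda>x. \<Phi> (v x))"
    by (auto intro!: \<Phi>_integrable)
  have "\<bar>(\<integral>x. \<Phi> (u x) \<partial>M) - (\<integral>x. \<Phi> (v x) \<partial>M)\<bar> = \<bar>\<integral>x. \<Phi> (u x) - \<Phi> (v x) \<partial>M\<bar>"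
    using i by simp
  also have "\<dots> \<le> (\<integral>x. \<bar>\<Phi> (u x) - \<Phi> (v x)\<bar> \<partial>M)"
    by (rule integral_abs_bound)
  also have "\<dots> \<le> (\<integral>x. K * \<bar>u x - v x\<bar> \<partial>M)"
    using i L2_imp_integrable[OF L2_diff[OF u v]] lip by (intro integral_mono) auto
  finally show ?thesis by simp
qed

lemma E_tendsto:
  assumes u: "\<And>n. L2 M (us n)" "L2 M u" "(\<lambda>n. sqn M (\<lambda>x. us n x - u x)) \<longlonglongrightarrow> 0"
    and g: "\<And>n. L2 M (gs n)" "L2 M g" "(\<lambda>n. sqn M (\<lambda>x. gs n x - g x)) \<longlonglongrightarrow> 0"
  shows "(\<lambda>n. E (us n) (gs n)) \<longlonglongrightarrow> E u g"
  unfolding E_def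
proof (intro tendsto_diff tendsto_divide tendsto_const sqn_tendsto[OF g])
  let ?m = "sqrt (measure M (space M))"
  have "(\<lambda>n. K * (sqrt (sqn M (\<lambda>x. us n x - u x)) * ?m)) \<longlonglongrightarrow> 0"
    using tendsto_mult_right_zero[OF tendsto_mult_left_zero[OF tendsto_real_sqrt[OF u(3), simplified], of ?m], of K] by simp
  then have "(\<lambda>n. (\<integral>x. \<Phi> (us n x) \<partial>M) - (\<integral>x. \<Phi> (u x) \<partial>M)) \<longlonglongrightarrow> 0"
  proof (rule Lim_null_comparison[rotated])
    have "norm ((\<integral>x. \<Phi> (us n x) \<partial>M) - (\<integral>x. \<Phi> (u x) \<partial>M)) \<le> K * (sqrt (sqn M (\<lambda>x. us n x - u x)) * ?m)" for n
    proof -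
      have "(\<integral>x. \<bar>us n x - u x\<bar> \<partial>M) \<le> sqrt (sqn M (\<lambda>x. us n x - u x)) * ?m"
        using L1_le_L2[OF L2_diff[OF u(1) u(2), of n]] by simp
      from mult_left_mono[OF this K_nonneg] \<Phi>_diff_le[OF u(1) u(2), of n] show ?thesis by simp
    qed
    then show "\<forall>\<^sub>F n in sequentially. norm ((\<integral>x. \<Phi> (us n x) \<partial>M) - (\<integral>x. \<Phi> (u x) \<partial>M)) \<le> K * (sqrt (sqn M (\<lambda>x. us n x - u x)) * ?m)"
      by (intro always_eventually allI)
  qed
  then show "(\<lambda>n. \<integral>x. \<Phi> (us n x) \<partial>M) \<longlonglongrightarrow> (\<integral>x. \<Phi> (u x) \<partial>M)" by (rule LIM_zero_cancel)
qed simp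

lemma E_lower: "L2 M u \<Longrightarrow> sqn M g / 2 - B * measure M (space M) \<le> E u g"
proof -
  assume u: "L2 M u"
  note [measurable] = L2_measurable[OF u]
  have "(\<integral>x. \<Phi> (u x) \<partial>M) \<le> (\<integral>x. B \<partial>M)"
    using bounded_above by (intro integral_mono \<Phi>_integrable) (auto simp: abs_le_iff)
  then show ?thesis by (simp add: E_def mult.commute)
qed

text \<open>The midpoint of two nearly optimal test functions cannot have energy below the infimum
  m. Uniform convexity of the quadratic part therefore bounds the distance of their gradients by the
  two energy excesses and by the L^1 error in the term with \<Phi>.\<close>

lemma minimizer:
  obtains u g where "H10_pair u g" "\<And>v h. H10_pair v h \<Longrightarrow> E u g \<le> E v h"
proof -
  let ?\<mu> = "measure M (space M)"
  have low: "- (B * ?\<mu>) \<le> E \<phi> (grad \<phi>)" if "test_function \<Omega> \<phi>" for \<phi>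
    using E_lower[OF sqn_test(3)[OF that], of "grad \<phi>"] sqn_nonneg[of M "grad \<phi>"] by linarith
  have "{\<phi>. test_function \<Omega> \<phi>} \<noteq> {}" using test_function_zero[of \<Omega>] by auto
  then obtain m \<phi> where "\<And>\<phi>. \<phi> \<in> {\<phi>. test_function \<Omega> \<phi>} \<Longrightarrow> m \<le> E \<phi> (grad \<phi>)"
    "\<And>n. \<phi> n \<in> {\<phi>. test_function \<Omega> \<phi>} \<and> E (\<phi> n) (grad (\<phi> n)) < m + 1 / real (Suc n)"
    using minimizing_sequence[of "{\<phi>. test_function \<Omega> \<phi>}" "- (B * ?\<mu>)" "\<lambda>\<phi>. E \<phi> (grad \<phi>)"] low by blast
  then have mle: "\<And>\<phi>. test_function \<Omega> \<phi> \<Longrightarrow> m \<le> E \<phi> (grad \<phi>)"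
    and \<phi>: "test_function \<Omega> (\<phi> n)" "E (\<phi> n) (grad (\<phi> n)) < m + 1 / real (Suc n)" for n by auto
  have "sqn M (grad (\<phi> n)) \<le> 2 * (m + 1 + B * ?\<mu>)" for n
  proof -
    have "1 / real (Suc n) \<le> 1" by simp
    moreover have "S \<le> 2 * (m + 1 + X)" if "S / 2 - X \<le> e" "e < m + q" "q \<le> 1" for S X e q :: real
      using that by argo
    ultimately show ?thesis
      using E_lower[OF sqn_test(3)[OF \<phi>(1)[of n]], of "grad (\<phi> n)"] \<phi>(2)[of n] by blast
  qed
  then obtain r where r: "strict_mono (r :: nat \<Rightarrow> nat)"
    "\<forall>e>0. \<exists>N. \<forall>i\<ge>N. \<forall>j\<ge>N. (\<integral>x. \<bar>\<phi> (r i) x - \<phi> (r j) x\<bar> \<partial>M) < e"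
    by (rule rellich[where \<phi>=\<phi>, OF \<phi>(1)]) (rule that)
  define f where "f n = \<phi> (r n)" for n
  have f: "test_function \<Omega> (f n)" for n using \<phi> by (simp add: f_def)
  have fE: "E (f n) (grad (f n)) < m + 1 / real (Suc n)" for n
  proof -
    have "1 / real (Suc (r n)) \<le> 1 / real (Suc n)"
      using seq_suble[OF r(1), of n] by (simp add: frac_le)
    with \<phi>(2)[of "r n"] show ?thesis by (simp add: f_def)
  qed
  note Lf = sqn_test(3,4)[OF f]
  have key: "sqn M (\<lambda>x. grad (f i) x - grad (f j) x)
      \<le> 4 * (1 / real (Suc i)) + 4 * (1 / real (Suc j)) + 4 * (K * (\<integral>x. \<bar>f i x - f j x\<bar> \<partial>M))" for i j
  proof -
    define w where "w x = 1/2 * (f i x + f j x)" for x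
    have w: "test_function \<Omega> w" unfolding w_def by (intro test_function_cmult test_function_add f)
    have gw: "grad w x = (1/2) *\<^sub>R (grad (f i) x + grad (f j) x)" for x
      unfolding w_def[abs_def] by (simp only: grad_cmult[OF test_function_add[OF f f]] grad_add[OF f f])
    have s: "sqn M (grad w) = (1/4) * sqn M (\<lambda>x. grad (f i) x + grad (f j) x)"
      unfolding gw sqn_scaleR by (simp add: power2_eq_square)
    note Lw = sqn_test(3)[OF w]
    have d: "\<bar>f i x - w x\<bar> = 1/2 * \<bar>f i x - f j x\<bar>" "\<bar>f j x - w x\<bar> = 1/2 * \<bar>f i x - f j x\<bar>" for x
      by (simp_all add: w_def field_simps abs_if)
    have "(\<integral>x. \<Phi> (f i x) \<partial>M) - (\<integral>x. \<Phi> (w x) \<partial>M) \<le> 1/2 * (K * (\<integral>x. \<bar>f i x - f j x\<bar> \<partial>M))"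
      "(\<integral>x. \<Phi> (f j x) \<partial>M) - (\<integral>x. \<Phi> (w x) \<partial>M) \<le> 1/2 * (K * (\<integral>x. \<bar>f i x - f j x\<bar> \<partial>M))"
      using order_trans[OF abs_ge_self \<Phi>_diff_le[OF Lf(1)[of i] Lw]]
        order_trans[OF abs_ge_self \<Phi>_diff_le[OF Lf(1)[of j] Lw]] unfolding d by simp_all
    moreover note sqn_parallelogram[OF Lf(2)[of i] Lf(2)[of j]] s fE[of i] fE[of j] mle[OF w]
    ultimately show ?thesis unfolding E_def by linarith
  qed
  have Cg: "\<exists>N. \<forall>i\<ge>N. \<forall>j\<ge>N. sqn M (\<lambda>x. grad (f i) x - grad (f j) x) < e" if e: "e > 0" for e
  proof -
    \<comment> \<open>In \<open>key\<close> every summand carries the factor 4: two terms below e/16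
      and one of at most e/8 add up to less than e. The 1 added to K covers K = 0.\<close>
    have "0 < e / (8 * (K + 1))" using e K_nonneg by simp
    with r(2) obtain N1 where N1: "\<forall>i\<ge>N1. \<forall>j\<ge>N1. (\<integral>x. \<bar>f i x - f j x\<bar> \<partial>M) < e / (8 * (K + 1))"
      unfolding f_def by blast
    obtain N2 :: nat where N2: "16 / e < real N2" using reals_Archimedean2 by blast
    show ?thesis
    proof (intro exI allI impI)
      fix i j assume ij: "max N1 N2 \<le> i" "max N1 N2 \<le> j"
      have a: "1 / real (Suc n) < e / 16" if "max N1 N2 \<le> n" for n
      proof -
        have "16 / e < real (Suc n)" using that N2 by simp
        then show ?thesis using e by (simp add: field_simps)
      qed
      have "K * (\<integral>x. \<bar>f i x - f j x\<bar> \<partial>M) \<le> K * (e / (8 * (K + 1)))"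
        using N1 ij K_nonneg by (intro mult_left_mono) (auto intro: less_imp_le)
      also have "\<dots> \<le> e / 8" using e K_nonneg by (simp add: field_simps)
      finally show "sqn M (\<lambda>x. grad (f i) x - grad (f j) x) < e"
        using key[of i j] a[OF ij(1)] a[OF ij(2)] e by linarith
    qed
  qed
  obtain c where c: "0 < c" "\<And>\<phi>. test_function \<Omega> \<phi> \<Longrightarrow> sqn M \<phi> \<le> c * sqn M (grad \<phi>)"
    by (rule poincare_test) (rule that)
  \<comment> \<open>The L^1 information from Rellich is upgraded to L^2: the Poincare inequality
    transfers the Cauchy property from the gradients to the functions.\<close>
  have Cf: "\<exists>N. \<forall>i\<ge>N. \<forall>j\<ge>N. sqn M (\<lambda>x. f i x - f j x) < e" if e: "e > 0" for e
  proof -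
    have "0 < e / c" using e c by simp
    from Cg[OF this] obtain N where N: "\<forall>i\<ge>N. \<forall>j\<ge>N. sqn M (\<lambda>x. grad (f i) x - grad (f j) x) < e / c" ..
    show ?thesis
    proof (intro exI allI impI)
      fix i j assume ij: "N \<le> i" "N \<le> j"
      have "sqn M (\<lambda>x. f i x - f j x) \<le> c * sqn M (\<lambda>x. grad (f i) x - grad (f j) x)"
        using c(2)[OF test_function_diff[OF f f], of i j] unfolding grad_diff[OF f f] .
      also have "\<dots> < c * (e / c)" using N ij c(1) by (intro mult_strict_left_mono) auto
      finally show "sqn M (\<lambda>x. f i x - f j x) < e" using c(1) by simp
    qed
  qed
  obtain u where u: "L2 M u" "(\<lambda>n. sqn M (\<lambda>x. f n x - u x)) \<longlonglongrightarrow> 0"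
    by (rule L2_complete[OF Lf(1)], erule Cf, rule that)
  obtain g where g: "L2 M g" "(\<lambda>n. sqn M (\<lambda>x. grad (f n) x - g x)) \<longlonglongrightarrow> 0"
    by (rule L2_complete[OF Lf(2)], erule Cg, rule that)
  have ug: "H10_pair u g" by (rule H10_pairI[OF u(1) g(1) f u(2) g(2)])
  have "(\<lambda>n. m + 1 / real (Suc n)) \<longlonglongrightarrow> m + 0"
    using LIMSEQ_inverse_real_of_nat by (intro tendsto_intros) (simp add: inverse_eq_divide)
  then have Em: "E u g \<le> m"
    using LIMSEQ_le[OF E_tendsto[OF Lf(1) u Lf(2) g], of "\<lambda>n. m + 1 / real (Suc n)" m] fE less_imp_le by auto
  have "E u g \<le> E v h" if vh: "H10_pair v h" for v h
  proof -
    obtain \<psi> where \<psi>: "\<And>j. test_function \<Omega> (\<psi> j)" "(\<lambda>j. sqn M (\<lambda>x. \<psi> j x - v x)) \<longlonglongrightarrow> 0"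
      "(\<lambda>j. sqn M (\<lambda>x. grad (\<psi> j) x - h x)) \<longlonglongrightarrow> 0"
      using vh by (rule H10_pairE) (rule that)
    have "m \<le> E v h"
      using mle[OF \<psi>(1)] by (intro LIMSEQ_le_const[OF E_tendsto[OF sqn_test(3)[OF \<psi>(1)] H10_pair_L2(1)[OF vh] \<psi>(2)
            sqn_test(4)[OF \<psi>(1)] H10_pair_L2(2)[OF vh] \<psi>(3)]]) auto
    with Em show ?thesis by simp
  qed
  with ug that show ?thesis by blast
qed

end

section \<open>Representation of a functional bounded by the L^1 norm\<close>

context bounded_domain
begin

text \<open>On a finite measure space the functional is continuous for the L^2 norm, so its Riesz
  representative is the limit of a minimising sequence for half the squared norm minus the
  functional. This limit need not be a test function; hence the approximants are varied, and n tends
  to infinity before t tends to 0.\<close>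

lemma riesz_test:
  assumes g: "L2 M g" and K: "0 \<le> K"
    and bound: "\<And>v. test_function \<Omega> v \<Longrightarrow> \<bar>\<integral>x. g x \<bullet> grad v x \<partial>M\<bar> \<le> K * (\<integral>x. \<bar>v x\<bar> \<partial>M)"
  obtains \<xi> where "L2 M \<xi>" "\<And>v h. H10_pair v h \<Longrightarrow> (\<integral>x. g x \<bullet> h x \<partial>M) = (\<integral>x. \<xi> x * v x \<partial>M)"
proof -
  define l where "l v = (\<integral>x. g x \<bullet> grad v x \<partial>M)" for v
  define J where "J v = sqn M v / 2 - l v" for v :: "'a \<Rightarrow> real"
  note Lt = sqn_test(3) and Lg = sqn_test(4)
  have ladd: "l (\<lambda>x. v x + t * w x) = l v + t * l w" if "test_function \<Omega> v" "test_function \<Omega> w" for v w t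
    unfolding l_def
    using L2_inner_integrable[OF g Lg[OF that(1)]] L2_inner_integrable[OF g Lg[OF that(2)]]
    by (simp add: grad_add[OF that(1) test_function_cmult[OF that(2)]] grad_cmult[OF that(2)] inner_add_right)
  define k where "k = K * sqrt (measure M (space M))"
  \<comment> \<open>Completing the square in the L^2 norm of v gives the lower bound -k^2/2.\<close>
  have low: "- (k\<^sup>2 / 2) \<le> J v" if v: "test_function \<Omega> v" for v
  proof -
    have "l v \<le> K * (\<integral>x. \<bar>v x\<bar> \<partial>M)" using bound[OF v] by (simp add: l_def abs_le_iff)
    also have "\<dots> \<le> K * (sqrt (sqn M v) * sqrt (measure M (space M)))"
      using L1_le_L2[OF Lt[OF v]] K by (intro mult_left_mono) auto
    finally have "l v \<le> k * sqrt (sqn M v)" by (simp add: k_def mult_ac)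
    moreover have "sqn M v = (sqrt (sqn M v))\<^sup>2"
      using real_sqrt_pow2[OF sqn_nonneg[of M v]] by (rule sym)
    moreover have "0 \<le> (sqrt (sqn M v) - k)\<^sup>2" by simp
    ultimately show ?thesis unfolding J_def power2_diff by (simp add: algebra_simps)
  qed
  have "{\<phi>. test_function \<Omega> \<phi>} \<noteq> {}" using test_function_zero[of \<Omega>] by auto
  then obtain m w where "\<And>v. v \<in> {\<phi>. test_function \<Omega> \<phi>} \<Longrightarrow> m \<le> J v"
    "\<And>n. w n \<in> {\<phi>. test_function \<Omega> \<phi>} \<and> J (w n) < m + 1 / real (Suc n)"
    using minimizing_sequence[of "{\<phi>. test_function \<Omega> \<phi>}" "- (k\<^sup>2 / 2)" J] low by blast
  then have mle: "\<And>v. test_function \<Omega> v \<Longrightarrow> m \<le> J v"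
    and w: "test_function \<Omega> (w n)" and wJ: "J (w n) < m + 1 / real (Suc n)" for n by auto
  have key: "sqn M (\<lambda>x. w i x - w j x) \<le> 4 * (1 / real (Suc i)) + 4 * (1 / real (Suc j))" for i j
  proof -
    define h where "h x = 1/2 * (w i x + 1 * w j x)" for x
    have h: "test_function \<Omega> h" unfolding h_def by (intro test_function_cmult test_function_add w)
    have "l h = 1/2 * (l (w i) + 1 * l (w j))"
    proof -
      have "l h = l (\<lambda>x. 0 + 1/2 * (w i x + 1 * w j x))" by (simp add: h_def[abs_def])
      also have "\<dots> = l (\<lambda>x. 0) + 1/2 * l (\<lambda>x. w i x + 1 * w j x)"
        by (intro ladd test_function_zero test_function_add test_function_cmult w)
      also have "l (\<lambda>x. 0) = 0"
        using ladd[OF test_function_zero test_function_zero, of 1] by simp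
      finally show ?thesis by (simp only: ladd[OF w w] add_0_left)
    qed
    moreover have "sqn M h = (1/4) * sqn M (\<lambda>x. w i x + w j x)"
      unfolding h_def[abs_def] using sqn_scaleR[of M "1/2" "\<lambda>x. w i x + w j x"] by (simp add: power2_eq_square)
    moreover have "sqn M (\<lambda>x. w i x - w j x) = 2 * sqn M (w i) + 2 * sqn M (w j) - sqn M (\<lambda>x. w i x + w j x)"
      by (rule sqn_parallelogram[OF Lt[OF w] Lt[OF w]])
    moreover have "S \<le> 4 * e1 + 4 * e2"
      if "lh = 1/2 * (li + 1 * lj)" "H = (1/4) * P" "S = 2 * a + 2 * b - P"
        "a / 2 - li < m + e1" "b / 2 - lj < m + e2" "m \<le> H / 2 - lh"
      for lh li lj H P S a b e1 e2 :: real
      using that by argo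
    ultimately show ?thesis
      using wJ[of i] wJ[of j] mle[OF h] unfolding J_def by blast
  qed
  have C: "\<exists>N. \<forall>i\<ge>N. \<forall>j\<ge>N. sqn M (\<lambda>x. w i x - w j x) < e" if e: "e > 0" for e
  proof -
    obtain N :: nat where N: "8 / e < real N" using reals_Archimedean2 by blast
    show ?thesis
    proof (intro exI allI impI)
      fix i j assume ij: "N \<le> i" "N \<le> j"
      have a: "1 / real (Suc n) < e / 8" if "N \<le> n" for n
      proof -
        have "8 / e < real (Suc n)" using that N by simp
        then show ?thesis using e by (simp add: field_simps)
      qed
      show "sqn M (\<lambda>x. w i x - w j x) < e"
        using key[of i j] a[OF ij(1)] a[OF ij(2)] e by linarith
    qed
  qed
  obtain \<xi> where \<xi>: "L2 M \<xi>" "(\<lambda>n. sqn M (\<lambda>x. w n x - \<xi> x)) \<longlonglongrightarrow> 0"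
    by (rule L2_complete[OF Lt[OF w]], erule C, rule that)
  have test: "l v = (\<integral>x. \<xi> x * v x \<partial>M)" if v: "test_function \<Omega> v" for v
  proof -
    \<comment> \<open>\<open>w n\<close> is optimal up to 1/(n+1), so no variation can lower
      \<open>J\<close> by more than that.\<close>
    have var: "- (1 / real (Suc n)) \<le> t * (\<integral>x. w n x * v x \<partial>M) + t\<^sup>2 / 2 * sqn M v - t * l v" for n t
    proof -
      have "m \<le> J (\<lambda>x. w n x + t * v x)"
        by (intro mle test_function_add test_function_cmult w v)
      moreover have "sqn M (\<lambda>x. w n x + t * v x) = sqn M (w n) + 2 * t * (\<integral>x. w n x * v x \<partial>M) + t\<^sup>2 * sqn M v"
      proof -
        have "sqn M (\<lambda>x. w n x + t * v x) = (\<integral>x. (norm (w n x))\<^sup>2 + 2 * t * (w n x * v x) + t\<^sup>2 * (norm (v x))\<^sup>2 \<partial>M)"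
          by (intro Bochner_Integration.integral_cong) (auto simp: power2_sum power_mult_distrib)
        also have "\<dots> = sqn M (w n) + 2 * t * (\<integral>x. w n x * v x \<partial>M) + t\<^sup>2 * sqn M v"
          using L2_integrable[OF Lt[OF w]] L2_integrable[OF Lt[OF v]] L2_mult_integrable[OF Lt[OF w] Lt[OF v]] by simp
        finally show ?thesis .
      qed
      moreover note wJ[of n] ladd[OF w v, of n t]
      ultimately show ?thesis unfolding J_def by (simp add: algebra_simps)
    qed
    have lim: "(\<lambda>n. t * (\<integral>x. w n x * v x \<partial>M) + t\<^sup>2 / 2 * sqn M v - t * l v) \<longlonglongrightarrow> t * (\<integral>x. \<xi> x * v x \<partial>M) + t\<^sup>2 / 2 * sqn M v - t * l v" for t
      using L2_inner_tendsto[OF Lt[OF w] \<xi> Lt[OF v] Lt[OF v]] by (intro tendsto_intros) simp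
    have lim0: "(\<lambda>n. - (1 / real (Suc n))) \<longlonglongrightarrow> 0"
      using tendsto_minus[OF LIMSEQ_inverse_real_of_nat] by (simp add: inverse_eq_divide)
    have nn: "0 \<le> t * ((\<integral>x. \<xi> x * v x \<partial>M) - l v) + t\<^sup>2 / 2 * sqn M v" for t
      using LIMSEQ_le[OF lim0 lim, of t] var by (auto simp: algebra_simps)
    have "l v \<le> (\<integral>x. \<xi> x * v x \<partial>M)"
    proof (rule le_if_le_add_mult_small[of 1])
      fix t :: real assume t: "0 < t"
      have "0 \<le> t * ((\<integral>x. \<xi> x * v x \<partial>M) - l v + t * (sqn M v / 2))"
        using nn[of t] by (simp add: algebra_simps power2_eq_square)
      then show "l v \<le> (\<integral>x. \<xi> x * v x \<partial>M) + t * (sqn M v / 2)"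
        using t by (simp add: zero_le_mult_iff)
    qed simp
    moreover have "(\<integral>x. \<xi> x * v x \<partial>M) \<le> l v"
    proof (rule le_if_le_add_mult_small[of 1])
      fix t :: real assume t: "0 < t"
      have "0 \<le> t * (l v - (\<integral>x. \<xi> x * v x \<partial>M) + t * (sqn M v / 2))"
        using nn[of "- t"] by (simp add: algebra_simps power2_eq_square)
      then show "(\<integral>x. \<xi> x * v x \<partial>M) \<le> l v + t * (sqn M v / 2)"
        using t by (simp add: zero_le_mult_iff)
    qed simp
    ultimately show ?thesis by simp
  qed
  show ?thesis
  proof (rule that[OF \<xi>(1)])
    fix v h assume vh: "H10_pair v h"
    obtain \<psi> where \<psi>: "\<And>j. test_function \<Omega> (\<psi> j)" "(\<lambda>j. sqn M (\<lambda>x. \<psi> j x - v x)) \<longlonglongrightarrow> 0"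
      "(\<lambda>j. sqn M (\<lambda>x. grad (\<psi> j) x - h x)) \<longlonglongrightarrow> 0"
      using vh by (rule H10_pairE) (rule that)
    have "(\<lambda>j. \<integral>x. g x \<bullet> grad (\<psi> j) x \<partial>M) \<longlonglongrightarrow> (\<integral>x. g x \<bullet> h x \<partial>M)"
      by (rule L2_inner_tendsto[OF g g _ Lg[OF \<psi>(1)] H10_pair_L2(2)[OF vh] \<psi>(3)]) simp
    moreover have "(\<lambda>j. \<integral>x. \<xi> x \<bullet> \<psi> j x \<partial>M) \<longlonglongrightarrow> (\<integral>x. \<xi> x \<bullet> v x \<partial>M)"
      by (rule L2_inner_tendsto[OF \<xi>(1) \<xi>(1) _ Lt[OF \<psi>(1)] H10_pair_L2(1)[OF vh] \<psi>(2)]) simp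
    ultimately show "(\<integral>x. g x \<bullet> h x \<partial>M) = (\<integral>x. \<xi> x * v x \<partial>M)"
      using test[OF \<psi>(1)] unfolding l_def inner_real_def by (auto intro: LIMSEQ_unique)
  qed
qed

end

section \<open>The Euler--Lagrange inclusion\<close>

text \<open>A C^1 replacement for the positive part: it vanishes exactly on the nonpositive
  half-line, and the denominator keeps its derivative within [0, 1].\<close>

definition smooth_ramp :: "real \<Rightarrow> real" where
  "smooth_ramp t = (max 0 t)\<^sup>2 / (1 + (max 0 t)\<^sup>2)"

definition smooth_ramp' :: "real \<Rightarrow> real" where
  "smooth_ramp' t = 2 * max 0 t / (1 + (max 0 t)\<^sup>2)\<^sup>2"

lemma one_add_sq_pos: "0 < 1 + (x::real)\<^sup>2"
  by (simp add: add_pos_nonneg)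

lemma smooth_ramp_deriv: "(smooth_ramp has_real_derivative smooth_ramp' t) (at t)"
proof -
  let ?q = "\<lambda>t::real. (max 0 t)\<^sup>2"
  have ne: "1 + ?q t \<noteq> 0" using one_add_sq_pos[of "max 0 t"] by simp
  have "((\<lambda>t. ?q t / (1 + ?q t)) has_real_derivative
      ((2 * max 0 t) * (1 + ?q t) - ?q t * (0 + 2 * max 0 t)) / ((1 + ?q t) * (1 + ?q t))) (at t)"
    by (intro DERIV_divide DERIV_add DERIV_const DERIV_max_0_power2 ne)
  moreover have "((2 * max 0 t) * (1 + ?q t) - ?q t * (0 + 2 * max 0 t)) / ((1 + ?q t) * (1 + ?q t)) = smooth_ramp' t"
    by (simp add: smooth_ramp'_def power2_eq_square[of "1 + _"] algebra_simps)
  ultimately show ?thesis unfolding smooth_ramp_def[abs_def] by simp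
qed

lemma smooth_ramp'_cont: "continuous_on UNIV smooth_ramp'"
  unfolding smooth_ramp'_def[abs_def]
proof (intro continuous_intros ballI)
  fix t :: real
  show "(1 + (max 0 t)\<^sup>2)\<^sup>2 \<noteq> 0" using one_add_sq_pos[of "max 0 t"] by simp
qed

lemma smooth_ramp'_bound: "0 \<le> smooth_ramp' t" "smooth_ramp' t \<le> 1"
proof -
  let ?m = "max 0 t"
  have "0 \<le> (?m - 1)\<^sup>2" by simp
  then have "2 * ?m \<le> 1 + ?m\<^sup>2" unfolding power2_diff by simp
  also have "\<dots> \<le> (1 + ?m\<^sup>2)\<^sup>2" by (simp add: power2_eq_square[of "1 + _"] algebra_simps)
  finally show "smooth_ramp' t \<le> 1" using one_add_sq_pos[of ?m] by (simp add: smooth_ramp'_def)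
  show "0 \<le> smooth_ramp' t" by (simp add: smooth_ramp'_def)
qed

lemma smooth_ramp_simps: "t \<le> 0 \<Longrightarrow> smooth_ramp t = 0" "0 < t \<Longrightarrow> 0 < smooth_ramp t" "0 \<le> smooth_ramp t"
  using one_add_sq_pos[of t] by (auto simp: smooth_ramp_def)

lemma (in bounded_domain) quot_sup_L2:
  assumes "lipschitz_fun f K" and u: "u \<in> borel_measurable M"
  shows "L2 M (\<lambda>x. quot_sup f k (u x))"
proof -
  interpret lipschitz_fun f K by fact
  have "L2 M (\<lambda>_. 1 :: real)" by (simp add: L2_def)
  then show ?thesis
  proof (rule L2_bound_mult)
    show "(\<lambda>x. quot_sup f k (u x)) \<in> borel_measurable M"
      using u by measurable
    show "norm (quot_sup f k (u x)) \<le> K * norm (1 :: real)" for x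
      using quot_sup_bound by simp
  qed
qed

section \<open>First variation and confinement of the minimiser\<close>

context energy
begin

lemma variation:
  assumes ug: "H10_pair u g" and min: "\<And>v h. H10_pair v h \<Longrightarrow> E u g \<le> E v h"
    and v: "test_function \<Omega> v"
  shows "0 \<le> t * (\<integral>x. g x \<bullet> grad v x \<partial>M) + t\<^sup>2 / 2 * sqn M (grad v)
    - ((\<integral>x. \<Phi> (u x + t * v x) \<partial>M) - (\<integral>x. \<Phi> (u x) \<partial>M))"
proof -
  note L = H10_pair_L2[OF ug] and Lv = sqn_test(4)[OF v]
  have "sqn M (\<lambda>x. g x + t *\<^sub>R grad v x)
    = (\<integral>x. (norm (g x))\<^sup>2 + 2 * t * (g x \<bullet> grad v x) + t\<^sup>2 * (norm (grad v x))\<^sup>2 \<partial>M)"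
    by (intro Bochner_Integration.integral_cong)
      (simp_all only: power2_norm_eq_inner inner_add_left inner_add_right inner_scaleR_left inner_scaleR_right
        inner_commute[of "grad v _" "g _"] power2_eq_square[of t], simp add: algebra_simps)
  also have "\<dots> = sqn M g + 2 * t * (\<integral>x. g x \<bullet> grad v x \<partial>M) + t\<^sup>2 * sqn M (grad v)"
    using L2_integrable[OF L(2)] L2_integrable[OF Lv] L2_inner_integrable[OF L(2) Lv] by simp
  finally have "sqn M (\<lambda>x. g x + t *\<^sub>R grad v x) = \<dots>" .
  with min[OF H10_pair_add_cmult[OF ug H10_pair_test[OF v], of t]]
  show ?thesis unfolding E_def by (simp add: field_simps)
qed

text \<open>For nonnegative v the competitor u - t v gives the upper bound: \<Phi>(u) - \<Phi>(u - t
  v) is a forward difference whose base point u - t v is close to u, hence controlled by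
  \<open>quot_sup\<close>. The competitor u + t v gives the lower bound in the same way for the
  negated function.\<close>

lemma euler_lagrange:
  assumes ug: "H10_pair u g" and min: "\<And>v h. H10_pair v h \<Longrightarrow> E u g \<le> E v h"
  obtains \<xi> where "L2 M \<xi>" "\<And>v h. H10_pair v h \<Longrightarrow> (\<integral>x. g x \<bullet> h x \<partial>M) = (\<integral>x. \<xi> x * v x \<partial>M)"
    "AE x in M. \<forall>k. \<xi> x \<le> quot_sup \<Phi> k (u x) \<and> - \<xi> x \<le> quot_sup (\<lambda>s. - \<Phi> s) k (u x)"
proof -
  interpret neg: lipschitz_fun "\<lambda>s. - \<Phi> s" K by (rule neg)
  note L = H10_pair_L2[OF ug]
  note [measurable] = L2_measurable[OF L(1)]
  have var: "0 \<le> t * (\<integral>x. g x \<bullet> grad v x \<partial>M) + t\<^sup>2 / 2 * sqn M (grad v)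
    - ((\<integral>x. \<Phi> (u x + t * v x) \<partial>M) - (\<integral>x. \<Phi> (u x) \<partial>M))" if "test_function \<Omega> v" for v t
    by (rule variation[OF ug _ that]) (rule min)
  note LQ = quot_sup_L2[OF lipschitz_fun_axioms L2_measurable[OF L(1)]] quot_sup_L2[OF neg L2_measurable[OF L(1)]]
  have iQ: "integrable M (\<lambda>x. quot_sup \<Phi> k (u x))" "integrable M (\<lambda>x. quot_sup (\<lambda>s. - \<Phi> s) k (u x))" for k
    by (intro L2_imp_integrable LQ)+
  have ivQ: "integrable M (\<lambda>x. v x * quot_sup \<Phi> k (u x))" "integrable M (\<lambda>x. v x * quot_sup (\<lambda>s. - \<Phi> s) k (u x))"
    if v: "test_function \<Omega> v" for v k
    by (intro L2_mult_integrable sqn_test v LQ)+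
  have i\<Phi>: "integrable M (\<lambda>x. \<Phi> (u x + t * v x))" if "test_function \<Omega> v" for v t
    by (intro \<Phi>_integrable borel_measurable_add borel_measurable_times borel_measurable_const
        L2_measurable[OF L(1)] L2_measurable[OF sqn_test(3)[OF that]])
  have i\<Phi>u: "integrable M (\<lambda>x. \<Phi> (u x))" by (intro \<Phi>_integrable) measurable
  have small: "\<bar>t * v x\<bar> < 1 / real (Suc k)"
    if "\<And>x. norm (v x) \<le> V" "0 < V" "0 < t" "t < 1 / (real (Suc k) * V)" for v :: "'a \<Rightarrow> real" and V t k x
  proof -
    have "\<bar>t * v x\<bar> \<le> t * V" using that(1)[of x] that(3) by (simp add: abs_mult mult_left_mono)
    also have "\<dots> < 1 / (real (Suc k) * V) * V" using that by (intro mult_strict_right_mono)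
    finally show ?thesis using that(2) by simp
  qed
  \<comment> \<open>The sign \<sigma> treats both competitors at once; its square is 1, so the
    quadratic term is that of t in either case, and it disappears with t after division.\<close>
  have dir: "- (\<sigma> * (\<integral>x. g x \<bullet> grad v x \<partial>M)) \<le> (\<integral>x. q x \<partial>M)"
    if v: "test_function \<Omega> v" and \<sigma>: "\<sigma> * \<sigma> = 1" and q: "integrable M q" and t0: "0 < t0"
      and pt: "\<And>t x. 0 < t \<Longrightarrow> t < t0 \<Longrightarrow> \<Phi> (u x) - \<Phi> (u x + (\<sigma> * t) * v x) \<le> t * q x"
    for v \<sigma> q t0
  proof (rule le_if_le_add_mult_small[OF t0])
    fix t :: real assume t: "0 < t" "t < t0"
    have sq: "(\<sigma> * t)\<^sup>2 = t\<^sup>2"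
      using \<sigma> by (simp add: power_mult_distrib power2_eq_square)
    have "(\<integral>x. \<Phi> (u x) - \<Phi> (u x + (\<sigma> * t) * v x) \<partial>M) \<le> (\<integral>x. t * q x \<partial>M)"
      by (intro integral_mono Bochner_Integration.integrable_diff integrable_mult_right i\<Phi>u i\<Phi>[OF v] q pt[OF t])
    moreover have "(\<integral>x. \<Phi> (u x) - \<Phi> (u x + (\<sigma> * t) * v x) \<partial>M)
        = (\<integral>x. \<Phi> (u x) \<partial>M) - (\<integral>x. \<Phi> (u x + (\<sigma> * t) * v x) \<partial>M)"
      by (rule Bochner_Integration.integral_diff[OF i\<Phi>u i\<Phi>[OF v]])
    moreover note var[OF v, of "\<sigma> * t", unfolded sq]
    ultimately have "0 \<le> t * ((\<integral>x. q x \<partial>M) + t * (sqn M (grad v) / 2) - - (\<sigma> * (\<integral>x. g x \<bullet> grad v x \<partial>M)))"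
      by (simp add: algebra_simps power2_eq_square[of t])
    then show "- (\<sigma> * (\<integral>x. g x \<bullet> grad v x \<partial>M)) \<le> (\<integral>x. q x \<partial>M) + t * (sqn M (grad v) / 2)"
      using t by (simp add: zero_le_mult_iff)
  qed
  have up_dn: "(\<integral>x. g x \<bullet> grad v x \<partial>M) \<le> (\<integral>x. v x * quot_sup \<Phi> k (u x) \<partial>M)
      \<and> - (\<integral>x. g x \<bullet> grad v x \<partial>M) \<le> (\<integral>x. v x * quot_sup (\<lambda>s. - \<Phi> s) k (u x) \<partial>M)"
    if v: "test_function \<Omega> v" and v0: "\<And>x. 0 \<le> v x" for v k
  proof -
    obtain V where V: "0 < V" "\<And>x. norm (v x) \<le> V"
      using cont_csupp_bounded[OF test_function_cont_csupp(1)[OF v]] by metis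
    \<comment> \<open>Below this bound the step t * v x is shorter than 1/(k+1), so that both the
      base point and the step are admissible in \<open>quot_sup\<close>.\<close>
    define t0 where "t0 = 1 / (real (Suc k) * V)"
    have t0: "0 < t0" using V by (simp add: t0_def)
    have pt: "\<Phi> (u x) - \<Phi> (u x + (- 1 * t) * v x) \<le> t * (v x * quot_sup \<Phi> k (u x))
        \<and> \<Phi> (u x) - \<Phi> (u x + (1 * t) * v x) \<le> t * (v x * quot_sup (\<lambda>s. - \<Phi> s) k (u x))"
      if t: "0 < t" "t < t0" for t x
    proof (cases "v x = 0")
      case False
      then have p: "0 < t * v x" using v0[of x] t by (simp add: less_le)
      have sm: "\<bar>t * v x\<bar> < 1 / real (Suc k)" by (rule small[OF V(2,1) t[unfolded t0_def]])
      have "(\<Phi> ((u x - t * v x) + t * v x) - \<Phi> (u x - t * v x)) / (t * v x) \<le> quot_sup \<Phi> k (u x)"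
        using sm p by (intro quot_le_sup) linarith+
      moreover have "(- \<Phi> (u x + t * v x) - - \<Phi> (u x)) / (t * v x) \<le> quot_sup (\<lambda>s. - \<Phi> s) k (u x)"
        using sm p by (intro neg.quot_le_sup) linarith+
      ultimately show ?thesis using p by (simp add: field_simps)
    qed simp
    show ?thesis
      using dir[OF v _ ivQ(1)[OF v] t0, of "- 1" k] dir[OF v _ ivQ(2)[OF v] t0, of 1 k] pt by simp
  qed
  note up = up_dn[THEN conjunct1] and dn = up_dn[THEN conjunct2]
  \<comment> \<open>The same comparison with the plain Lipschitz estimate yields the L^1 bound that
    \<open>riesz_test\<close> asks for.\<close>
  have bound: "\<bar>\<integral>x. g x \<bullet> grad v x \<partial>M\<bar> \<le> K * (\<integral>x. \<bar>v x\<bar> \<partial>M)" if v: "test_function \<Omega> v" for v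
  proof -
    have "- (\<sigma> * (\<integral>x. g x \<bullet> grad v x \<partial>M)) \<le> (\<integral>x. K * \<bar>v x\<bar> \<partial>M)" if \<sigma>: "\<bar>\<sigma>\<bar> = 1" for \<sigma>
    proof (rule dir[OF v _ _ zero_less_one])
      show "\<sigma> * \<sigma> = 1" using \<sigma> by (metis abs_mult_self_eq mult_1)
      show "integrable M (\<lambda>x. K * \<bar>v x\<bar>)"
        using L2_imp_integrable[OF sqn_test(3)[OF v]] by simp
      fix t x assume "0 < (t::real)"
      then show "\<Phi> (u x) - \<Phi> (u x + (\<sigma> * t) * v x) \<le> t * (K * \<bar>v x\<bar>)"
        using lip[of "u x" "u x + (\<sigma> * t) * v x"] \<sigma> by (simp add: abs_mult mult_ac)
    qed
    from this[of 1] this[of "- 1"] show ?thesis by (simp add: abs_le_iff)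
  qed
  obtain \<xi> where \<xi>: "L2 M \<xi>" "\<And>v h. H10_pair v h \<Longrightarrow> (\<integral>x. g x \<bullet> h x \<partial>M) = (\<integral>x. \<xi> x * v x \<partial>M)"
    using riesz_test[OF L(2) K_nonneg bound] by blast
  have "AE x in M. 0 \<le> quot_sup \<Phi> k (u x) - \<xi> x" for k
  proof (rule fundamental_nonneg)
    show "integrable M (\<lambda>x. quot_sup \<Phi> k (u x) - \<xi> x)"
      using iQ L2_imp_integrable[OF \<xi>(1)] by auto
    fix v :: "'a \<Rightarrow> real" assume v: "test_function \<Omega> v" "\<And>x. 0 \<le> v x"
    have "(\<integral>x. (quot_sup \<Phi> k (u x) - \<xi> x) * v x \<partial>M) = (\<integral>x. v x * quot_sup \<Phi> k (u x) - \<xi> x * v x \<partial>M)"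
      by (simp add: algebra_simps)
    also have "\<dots> = (\<integral>x. v x * quot_sup \<Phi> k (u x) \<partial>M) - (\<integral>x. \<xi> x * v x \<partial>M)"
      by (rule Bochner_Integration.integral_diff[OF ivQ(1)[OF v(1)] L2_mult_integrable[OF \<xi>(1) sqn_test(3)[OF v(1)]]])
    finally show "0 \<le> (\<integral>x. (quot_sup \<Phi> k (u x) - \<xi> x) * v x \<partial>M)"
      using up[OF v, of k] \<xi>(2)[OF H10_pair_test[OF v(1)]] by simp
  qed
  moreover have "AE x in M. 0 \<le> quot_sup (\<lambda>s. - \<Phi> s) k (u x) + \<xi> x" for k
  proof (rule fundamental_nonneg)
    show "integrable M (\<lambda>x. quot_sup (\<lambda>s. - \<Phi> s) k (u x) + \<xi> x)"
      using iQ L2_imp_integrable[OF \<xi>(1)] by auto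
    fix v :: "'a \<Rightarrow> real" assume v: "test_function \<Omega> v" "\<And>x. 0 \<le> v x"
    have "(\<integral>x. (quot_sup (\<lambda>s. - \<Phi> s) k (u x) + \<xi> x) * v x \<partial>M) = (\<integral>x. v x * quot_sup (\<lambda>s. - \<Phi> s) k (u x) + \<xi> x * v x \<partial>M)"
      by (simp add: algebra_simps)
    also have "\<dots> = (\<integral>x. v x * quot_sup (\<lambda>s. - \<Phi> s) k (u x) \<partial>M) + (\<integral>x. \<xi> x * v x \<partial>M)"
      by (rule Bochner_Integration.integral_add[OF ivQ(2)[OF v(1)] L2_mult_integrable[OF \<xi>(1) sqn_test(3)[OF v(1)]]])
    finally show "0 \<le> (\<integral>x. (quot_sup (\<lambda>s. - \<Phi> s) k (u x) + \<xi> x) * v x \<partial>M)"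
      using dn[OF v, of k] \<xi>(2)[OF H10_pair_test[OF v(1)]] by simp
  qed
  ultimately have "AE x in M. \<forall>k. 0 \<le> quot_sup \<Phi> k (u x) - \<xi> x \<and> 0 \<le> quot_sup (\<lambda>s. - \<Phi> s) k (u x) + \<xi> x"
    unfolding AE_all_countable by (intro allI AE_conjI)
  then have "AE x in M. \<forall>k. \<xi> x \<le> quot_sup \<Phi> k (u x) \<and> - \<xi> x \<le> quot_sup (\<lambda>s. - \<Phi> s) k (u x)"
  proof (rule eventually_mono, intro allI)
    fix x k assume "\<forall>k. 0 \<le> quot_sup \<Phi> k (u x) - \<xi> x \<and> 0 \<le> quot_sup (\<lambda>s. - \<Phi> s) k (u x) + \<xi> x"
    then have "0 \<le> quot_sup \<Phi> k (u x) - \<xi> x \<and> 0 \<le> quot_sup (\<lambda>s. - \<Phi> s) k (u x) + \<xi> x" ..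
    then show "\<xi> x \<le> quot_sup \<Phi> k (u x) \<and> - \<xi> x \<le> quot_sup (\<lambda>s. - \<Phi> s) k (u x)" by linarith
  qed
  with \<xi> show ?thesis by (rule that)
qed

text \<open>Testing with \<psi>(u) gives the integral of \<psi>'(u) |g|^2 on one side and something
  nonpositive on the other. So the gradient \<psi>'(u) g of \<psi>(u) vanishes, and
  \<open>H10_pair_poincare\<close> applies.\<close>

lemma truncation_zero:
  assumes ug: "H10_pair u g" and \<xi>: "\<And>v h. H10_pair v h \<Longrightarrow> (\<integral>x. g x \<bullet> h x \<partial>M) = (\<integral>x. \<xi> x * v x \<partial>M)"
    and d: "\<And>t. (\<psi> has_real_derivative \<psi>' t) (at t)" and c: "continuous_on UNIV \<psi>'" and z: "\<psi> 0 = 0"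
    and \<psi>': "\<And>t. 0 \<le> \<psi>' t" "\<And>t. \<psi>' t \<le> 1"
    and neg: "AE x in M. \<xi> x * \<psi> (u x) \<le> 0"
  shows "AE x in M. \<psi> (u x) = 0"
proof -
  have "\<bar>\<psi>' t\<bar> \<le> 1" for t using \<psi>'[of t] by simp
  from H10_pair_chain[OF ug d c z this]
  have p: "H10_pair (\<lambda>x. \<psi> (u x)) (\<lambda>x. \<psi>' (u x) *\<^sub>R g x)" .
  have "(\<integral>x. g x \<bullet> (\<psi>' (u x) *\<^sub>R g x) \<partial>M) \<le> 0"
  proof -
    have "0 \<le> (\<integral>x. - (\<xi> x * \<psi> (u x)) \<partial>M)"
      using neg by (intro integral_nonneg_AE) (auto elim: eventually_mono)
    then show ?thesis unfolding \<xi>[OF p] by simp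
  qed
  moreover have nn: "0 \<le> g x \<bullet> (\<psi>' (u x) *\<^sub>R g x)" for x using \<psi>'(1) by simp
  moreover have i: "integrable M (\<lambda>x. g x \<bullet> (\<psi>' (u x) *\<^sub>R g x))"
    by (rule L2_inner_integrable[OF H10_pair_L2(2)[OF ug] H10_pair_L2(2)[OF p]])
  ultimately have "(\<integral>x. g x \<bullet> (\<psi>' (u x) *\<^sub>R g x) \<partial>M) = 0"
    by (intro antisym integral_nonneg_AE AE_I2)
  then have "AE x in M. g x \<bullet> (\<psi>' (u x) *\<^sub>R g x) = 0"
    using integral_nonneg_eq_0_iff_AE[OF i] nn by auto
  then have "AE x in M. (norm (\<psi>' (u x) *\<^sub>R g x))\<^sup>2 = 0"
    by (rule eventually_mono) auto
  then have "sqn M (\<lambda>x. \<psi>' (u x) *\<^sub>R g x) = 0"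
    by (rule integral_eq_zero_AE)
  from H10_pair_poincare[OF p this] show ?thesis .
qed

text \<open>Above a the forward quotients near u are nonpositive and so is \<xi>; below 0 they
  vanish and \<xi> is nonnegative. Ramps that are active only in one of these regions satisfy the
  sign condition of \<open>truncation_zero\<close>.\<close>

lemma minimizer_range:
  assumes ug: "H10_pair u g" and \<xi>: "\<And>v h. H10_pair v h \<Longrightarrow> (\<integral>x. g x \<bullet> h x \<partial>M) = (\<integral>x. \<xi> x * v x \<partial>M)"
    and Q: "AE x in M. \<forall>k. \<xi> x \<le> quot_sup \<Phi> k (u x) \<and> - \<xi> x \<le> quot_sup (\<lambda>s. - \<Phi> s) k (u x)"
    and a: "0 \<le> a" and const: "\<And>s. s \<le> 0 \<Longrightarrow> \<Phi> s = \<Phi> 0" and anti: "\<And>s t. a \<le> s \<Longrightarrow> s \<le> t \<Longrightarrow> \<Phi> t \<le> \<Phi> s"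
  shows "AE x in M. 0 \<le> u x \<and> u x \<le> a"
proof -
  interpret neg: lipschitz_fun "\<lambda>s. - \<Phi> s" K by (rule neg)
  \<comment> \<open>The factor 2 leaves room for a displacement of the base point and a step, each
    shorter than 1/(k+1).\<close>
  have arch: "\<exists>k. 2 / real (Suc k) < e" if "0 < e" for e :: real
  proof -
    obtain k :: nat where "2 / e < real k" using reals_Archimedean2 by blast
    then have "2 / real (Suc k) < e" using that by (simp add: field_simps)
    then show ?thesis ..
  qed
  have up: "AE x in M. smooth_ramp (u x - a) = 0"
  proof (rule truncation_zero[OF ug \<xi>, where \<psi>'="\<lambda>t. smooth_ramp' (t - a)"])
    show "((\<lambda>t. smooth_ramp (t - a)) has_real_derivative smooth_ramp' (t - a)) (at t)" for t
    proof -
      have "((\<lambda>t. t - a) has_real_derivative 1) (at t)" by (auto intro!: derivative_eq_intros)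
      from DERIV_chain2[where f=smooth_ramp and g="\<lambda>t. t - a", OF smooth_ramp_deriv this]
      show ?thesis by simp
    qed
    show "continuous_on UNIV (\<lambda>t. smooth_ramp' (t - a))"
      by (rule continuous_on_compose2[OF smooth_ramp'_cont]) (auto intro!: continuous_intros)
    show "smooth_ramp (0 - a) = 0" using a by (simp add: smooth_ramp_simps)
    show "AE x in M. \<xi> x * smooth_ramp (u x - a) \<le> 0"
      using Q
    proof (rule eventually_mono)
      fix x assume Qx: "\<forall>k. \<xi> x \<le> quot_sup \<Phi> k (u x) \<and> - \<xi> x \<le> quot_sup (\<lambda>s. - \<Phi> s) k (u x)"
      show "\<xi> x * smooth_ramp (u x - a) \<le> 0"
      proof (cases "u x \<le> a")
        case False
        then obtain k where k: "2 / real (Suc k) < u x - a" using arch[of "u x - a"] by auto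
        have "quot_sup \<Phi> k (u x) \<le> 0"
        proof (rule quot_sup_le)
          fix z \<tau> assume "\<bar>z - u x\<bar> < 1 / real (Suc k)" "0 < \<tau>" "\<tau> < 1 / real (Suc k)"
          moreover have "2 / real (Suc k) = 1 / real (Suc k) + 1 / real (Suc k)" by simp
          ultimately have "a \<le> z" using k by linarith
          then show "(\<Phi> (z + \<tau>) - \<Phi> z) / \<tau> \<le> 0"
            using anti[of z "z + \<tau>"] \<open>0 < \<tau>\<close> by (simp add: divide_le_0_iff)
        qed
        then have "\<xi> x \<le> 0" using Qx order_trans by blast
        then show ?thesis using smooth_ramp_simps(3) by (simp add: mult_nonpos_nonneg)
      qed (simp add: smooth_ramp_simps)
    qed
  qed (use smooth_ramp'_bound in auto)
  have dn: "AE x in M. - smooth_ramp (- u x) = 0"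
  proof (rule truncation_zero[OF ug \<xi>, where \<psi>="\<lambda>t. - smooth_ramp (- t)" and \<psi>'="\<lambda>t. smooth_ramp' (- t)"])
    show "((\<lambda>t. - smooth_ramp (- t)) has_real_derivative smooth_ramp' (- t)) (at t)" for t
    proof -
      have "((\<lambda>t. - t) has_real_derivative - 1) (at t)" by (auto intro!: derivative_eq_intros)
      from DERIV_minus[OF DERIV_chain2[where f=smooth_ramp and g="\<lambda>t. - t", OF smooth_ramp_deriv this]]
      show ?thesis by simp
    qed
    show "continuous_on UNIV (\<lambda>t. smooth_ramp' (- t))"
      by (rule continuous_on_compose2[OF smooth_ramp'_cont]) (auto intro!: continuous_intros)
    show "AE x in M. \<xi> x * - smooth_ramp (- u x) \<le> 0"
      using Q
    proof (rule eventually_mono)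
      fix x assume Qx: "\<forall>k. \<xi> x \<le> quot_sup \<Phi> k (u x) \<and> - \<xi> x \<le> quot_sup (\<lambda>s. - \<Phi> s) k (u x)"
      show "\<xi> x * - smooth_ramp (- u x) \<le> 0"
      proof (cases "0 \<le> u x")
        case False
        then obtain k where k: "2 / real (Suc k) < - u x" using arch[of "- u x"] by auto
        have le: "z + \<tau> \<le> 0 \<and> z \<le> 0" if "\<bar>z - u x\<bar> < 1 / real (Suc k)" "0 < \<tau>" "\<tau> < 1 / real (Suc k)" for z \<tau>
        proof -
          have "2 / real (Suc k) = 1 / real (Suc k) + 1 / real (Suc k)" by simp
          with that k show ?thesis by linarith
        qed
        have "quot_sup (\<lambda>s. - \<Phi> s) k (u x) \<le> 0"
        proof (rule neg.quot_sup_le)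
          fix z \<tau> assume "\<bar>z - u x\<bar> < 1 / real (Suc k)" "0 < \<tau>" "\<tau> < 1 / real (Suc k)"
          with le have "z + \<tau> \<le> 0" "z \<le> 0" by blast+
          with const[of "z + \<tau>"] const[of z]
          show "(- \<Phi> (z + \<tau>) - - \<Phi> z) / \<tau> \<le> 0" by simp
        qed
        then have "0 \<le> \<xi> x" using Qx by (metis neg_le_0_iff_le order_trans)
        then show ?thesis using smooth_ramp_simps(3) by (simp add: mult_nonneg_nonneg)
      qed (simp add: smooth_ramp_simps)
    qed
  qed (use smooth_ramp'_bound in \<open>auto simp: smooth_ramp_simps\<close>)
  show ?thesis
    using up dn
  proof eventually_elim
    case (elim x)
    have "\<not> 0 < u x - a" "\<not> 0 < - u x"
      using elim smooth_ramp_simps(2)[of "u x - a"] smooth_ramp_simps(2)[of "- u x"] by auto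
    then show ?case by simp
  qed
qed

end

section \<open>Generalized gradients of Lipschitz functions\<close>

context lipschitz_fun
begin

lemma quot_sup_antimono:
  assumes "k \<le> m"
  shows "quot_sup \<Phi> m s \<le> quot_sup \<Phi> k s"
proof (rule quot_sup_le)
  fix z \<tau> assume "\<bar>z - s\<bar> < 1 / real (Suc m)" "0 < \<tau>" "\<tau> < 1 / real (Suc m)"
  moreover have "1 / real (Suc m) \<le> 1 / real (Suc k)" using assms by (simp add: frac_le)
  ultimately show "(\<Phi> (z + \<tau>) - \<Phi> z) / \<tau> \<le> quot_sup \<Phi> k s"
    by (intro quot_le_sup) linarith+
qed

text \<open>A single difference quotient based at s itself lies between the two sides; the larger
  index makes it admissible for both. It follows that the left end of the gradient does not exceed
  the right end.\<close>

lemma neg_quot_sup_le: "- quot_sup (\<lambda>s. - \<Phi> s) j s \<le> quot_sup \<Phi> k s"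
proof -
  interpret neg: lipschitz_fun "\<lambda>s. - \<Phi> s" K by (rule neg)
  define m where "m = max j k"
  define \<tau> where "\<tau> = 1 / (2 * real (Suc m))"
  have \<tau>: "0 < \<tau>" "\<tau> < 1 / real (Suc m)" by (auto simp: \<tau>_def field_simps)
  have "(\<Phi> (s + \<tau>) - \<Phi> s) / \<tau> \<le> quot_sup \<Phi> m s"
    using \<tau> by (intro quot_le_sup) auto
  also have "\<dots> \<le> quot_sup \<Phi> k s" by (rule quot_sup_antimono) (simp add: m_def)
  finally have 1: "(\<Phi> (s + \<tau>) - \<Phi> s) / \<tau> \<le> quot_sup \<Phi> k s" .
  have "(- \<Phi> (s + \<tau>) - - \<Phi> s) / \<tau> \<le> quot_sup (\<lambda>s. - \<Phi> s) m s"
    using \<tau> by (intro neg.quot_le_sup) auto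
  also have "\<dots> \<le> quot_sup (\<lambda>s. - \<Phi> s) j s" by (rule neg.quot_sup_antimono) (simp add: m_def)
  finally have "- ((\<Phi> (s + \<tau>) - \<Phi> s) / \<tau>) \<le> quot_sup (\<lambda>s. - \<Phi> s) j s"
    by (simp add: minus_divide_left)
  with 1 show ?thesis by linarith
qed

text \<open>The Clarke derivative in direction 1 as a real number; \<open>max_clarke_eq\<close>
  shows that it is the right end of the generalized gradient.\<close>

definition upper_deriv :: "real \<Rightarrow> real" where
  "upper_deriv s = (INF k. quot_sup \<Phi> k s)"

lemma upper_deriv_bdd: "bdd_below (range (\<lambda>k. quot_sup \<Phi> k s))"
  using quot_sup_bound by (intro bdd_belowI[of _ "- K"]) (auto simp: abs_le_iff minus_le_iff)

lemma upper_deriv_le: "upper_deriv s \<le> quot_sup \<Phi> k s"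
  unfolding upper_deriv_def by (rule cINF_lower[OF upper_deriv_bdd]) simp

lemma le_upper_deriv: "(\<And>k. c \<le> quot_sup \<Phi> k s) \<Longrightarrow> c \<le> upper_deriv s"
  unfolding upper_deriv_def by (rule cINF_greatest) auto

lemma upper_deriv_less:
  assumes "upper_deriv s < c"
  obtains k where "quot_sup \<Phi> k s < c"
  using assms cINF_less_iff[OF _ upper_deriv_bdd, of s c] unfolding upper_deriv_def by auto

lemma clarke_derivative_1_le: "clarke_derivative \<Phi> s 1 \<le> ereal (quot_sup \<Phi> k s)"
  unfolding clarke_derivative_def
proof (rule Limsup_bounded)
  have "\<forall>\<^sub>F z in nhds s. \<bar>z - s\<bar> < 1 / real (Suc k)"
    unfolding eventually_nhds_metric by (intro exI[of _ "1 / real (Suc k)"]) (auto simp: dist_real_def)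
  moreover have "\<forall>\<^sub>F \<tau> in at_right 0. \<tau> \<in> {0<..<1 / real (Suc k)}"
    by (rule eventually_at_right_real) simp
  ultimately have "\<forall>\<^sub>F p in nhds s \<times>\<^sub>F at_right 0. \<bar>fst p - s\<bar> < 1 / real (Suc k) \<and> snd p \<in> {0<..<1 / real (Suc k)}"
    by (rule eventually_prodI)
  then show "\<forall>\<^sub>F p in nhds s \<times>\<^sub>F at_right 0. (case p of (z, \<tau>) \<Rightarrow> ereal ((\<Phi> (z + \<tau> * 1) - \<Phi> z) / \<tau>)) \<le> ereal (quot_sup \<Phi> k s)"
  proof eventually_elim
    case (elim p)
    then show ?case using quot_le_sup[of "fst p" s k "snd p"] by (simp add: case_prod_beta)
  qed
qed

text \<open>Positive homogeneity in the direction: a step \<tau> in direction 1 is a step \<tau> / v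
  in direction v.\<close>

lemma quot_sup_le_if_clarke_less:
  assumes "clarke_derivative \<Phi> s v < ereal c" "0 < v"
  obtains k where "quot_sup \<Phi> k s \<le> c / v"
proof -
  have "\<forall>\<^sub>F p in nhds s \<times>\<^sub>F at_right 0. (case p of (z, \<tau>) \<Rightarrow> ereal ((\<Phi> (z + \<tau> * v) - \<Phi> z) / \<tau>)) < ereal c"
    using assms(1) unfolding clarke_derivative_def by (rule Limsup_lessD)
  then obtain P Q where P: "eventually P (nhds s)" "eventually Q (at_right 0)"
    "\<And>z \<tau>. P z \<Longrightarrow> Q \<tau> \<Longrightarrow> (\<Phi> (z + \<tau> * v) - \<Phi> z) / \<tau> < c"
    unfolding eventually_prod_filter by auto
  obtain d where d: "0 < d" "\<And>z. dist z s < d \<Longrightarrow> P z"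
    using P(1) unfolding eventually_nhds_metric by auto
  obtain e where e: "0 < e" "\<And>\<tau>. 0 < \<tau> \<Longrightarrow> \<tau> < e \<Longrightarrow> Q \<tau>"
    using P(2) unfolding eventually_at_right_field by auto
  \<comment> \<open>The bound e * v makes \<tau> / v shorter than e.\<close>
  obtain k :: nat where k: "1 / min d (e * v) < real k" using reals_Archimedean2 by blast
  have m: "0 < min d (e * v)" using d e assms by simp
  have "1 / real (Suc k) < min d (e * v)"
  proof -
    have "1 / min d (e * v) < real (Suc k)" using k by simp
    then show ?thesis using m by (simp add: field_simps del: min_less_iff_conj of_nat_Suc)
  qed
  then have k: "1 / real (Suc k) < d" "1 / real (Suc k) < e * v" by auto
  have "quot_sup \<Phi> k s \<le> c / v"
  proof (rule quot_sup_le)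
    fix z \<tau> assume z: "\<bar>z - s\<bar> < 1 / real (Suc k)" and \<tau>: "0 < \<tau>" "\<tau> < 1 / real (Suc k)"
    have "P z" using z k by (intro d) (simp add: dist_real_def)
    moreover have "Q (\<tau> / v)"
    proof (rule e)
      show "\<tau> / v < e" using order.strict_trans[OF \<tau>(2) k(2)] assms(2) by (simp add: pos_divide_less_eq)
    qed (use \<tau> assms in simp)
    ultimately have "(\<Phi> (z + \<tau> / v * v) - \<Phi> z) / (\<tau> / v) < c" by (rule P(3))
    then show "(\<Phi> (z + \<tau>) - \<Phi> z) / \<tau> \<le> c / v"
      using \<tau> assms(2) by (simp add: field_simps)
  qed
  with that show ?thesis by blast
qed

text \<open>A backward step from z + \<tau> is a forward step from z with the opposite sign, so
  direction -w leads to the negated function. Moving the base point to z + \<tau> costs half of the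
  neighbourhood, whence d / 2.\<close>

lemma clarke_reflect:
  assumes "0 < w" "clarke_derivative \<Phi> s (- w) < ereal c"
  obtains k where "quot_sup (\<lambda>s. - \<Phi> s) k s \<le> c / w"
proof -
  interpret neg: lipschitz_fun "\<lambda>s. - \<Phi> s" K by (rule neg)
  have "\<forall>\<^sub>F p in nhds s \<times>\<^sub>F at_right 0. (case p of (z, \<tau>) \<Rightarrow> ereal ((\<Phi> (z + \<tau> * - w) - \<Phi> z) / \<tau>)) < ereal c"
    using assms(2) unfolding clarke_derivative_def by (rule Limsup_lessD)
  then obtain P Q where P: "eventually P (nhds s)" "eventually Q (at_right 0)"
    "\<And>z \<tau>. P z \<Longrightarrow> Q \<tau> \<Longrightarrow> (\<Phi> (z + \<tau> * - w) - \<Phi> z) / \<tau> < c"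
    unfolding eventually_prod_filter by auto
  obtain d where d: "0 < d" "\<And>z. dist z s < d \<Longrightarrow> P z"
    using P(1) unfolding eventually_nhds_metric by auto
  obtain e where e: "0 < e" "\<And>\<tau>. 0 < \<tau> \<Longrightarrow> \<tau> < e \<Longrightarrow> Q \<tau>"
    using P(2) unfolding eventually_at_right_field by auto
  obtain k :: nat where k: "1 / min (d / 2) (e * w) < real k" using reals_Archimedean2 by blast
  have m: "0 < min (d / 2) (e * w)" using d e assms by simp
  have "1 / real (Suc k) < min (d / 2) (e * w)"
  proof -
    have "1 / min (d / 2) (e * w) < real (Suc k)" using k by simp
    then show ?thesis using m by (simp add: field_simps del: min_less_iff_conj of_nat_Suc)
  qed
  then have k: "1 / real (Suc k) < d / 2" "1 / real (Suc k) < e * w" by auto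
  have "quot_sup (\<lambda>s. - \<Phi> s) k s \<le> c / w"
  proof (rule neg.quot_sup_le)
    fix z \<tau> assume z: "\<bar>z - s\<bar> < 1 / real (Suc k)" and \<tau>: "0 < \<tau>" "\<tau> < 1 / real (Suc k)"
    have "\<bar>(z + \<tau>) - s\<bar> < d" using z k \<tau> by linarith
    then have "P (z + \<tau>)" by (intro d) (simp add: dist_real_def)
    moreover have "Q (\<tau> / w)"
    proof (rule e)
      show "\<tau> / w < e" using order.strict_trans[OF \<tau>(2) k(2)] assms(1) by (simp add: pos_divide_less_eq)
    qed (use \<tau> assms in simp)
    ultimately have "(\<Phi> ((z + \<tau>) + \<tau> / w * - w) - \<Phi> (z + \<tau>)) / (\<tau> / w) < c" by (rule P(3))
    then show "(- \<Phi> (z + \<tau>) - - \<Phi> z) / \<tau> \<le> c / w"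
      using \<tau> assms(1) by (simp add: field_simps)
  qed
  with that show ?thesis by blast
qed

text \<open>On the line every direction is 0 or a positive multiple of 1 or -1, so two families of
  inequalities decide membership.\<close>

lemma clarke_gradient_memI:
  assumes "\<And>k. \<xi> \<le> quot_sup \<Phi> k s" "\<And>k. - \<xi> \<le> quot_sup (\<lambda>s. - \<Phi> s) k s"
  shows "\<xi> \<in> clarke_gradient \<Phi> s"
  unfolding clarke_gradient_def
proof (intro CollectI allI)
  fix v
  show "ereal (\<xi> * v) \<le> clarke_derivative \<Phi> s v"
  proof (rule ccontr)
    assume "\<not> ?thesis"
    then have "clarke_derivative \<Phi> s v < ereal (\<xi> * v)" by simp
    then obtain c where c: "clarke_derivative \<Phi> s v < ereal c" "c < \<xi> * v"
      using ereal_dense2[of "clarke_derivative \<Phi> s v" "ereal (\<xi> * v)"] by auto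
    consider "v = 0" | "0 < v" | "0 < - v" by linarith
    then show False
    proof cases
      case 1
      have ne: "nhds s \<times>\<^sub>F at_right (0::real) \<noteq> bot" by (simp add: prod_filter_eq_bot)
      have "clarke_derivative \<Phi> s v = Limsup (nhds s \<times>\<^sub>F at_right (0::real)) (\<lambda>_. 0)"
        unfolding clarke_derivative_def using 1 by (intro Limsup_eq) (auto simp: zero_ereal_def)
      also have "\<dots> = 0" by (rule Limsup_const[OF ne])
      finally show False using c 1 by (simp add: zero_ereal_def)
    next
      case 2
      obtain k where "quot_sup \<Phi> k s \<le> c / v" using quot_sup_le_if_clarke_less[OF c(1) 2] .
      also have "c / v < \<xi>" using c 2 by (simp add: divide_less_eq)
      finally show False using assms(1)[of k] by simp
    next
      case 3
      obtain k where "quot_sup (\<lambda>s. - \<Phi> s) k s \<le> c / - v" using clarke_reflect[OF 3, of s c] c by auto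
      also have "c / - v < - \<xi>" using c 3 by (simp add: field_simps)
      finally show False using assms(2)[of k] by simp
    qed
  qed
qed

text \<open>By \<open>neg_quot_sup_le\<close> the upper derivative satisfies both families of
  inequalities, so it belongs to the gradient and the greatest element is attained.\<close>

lemma max_clarke_eq: "max_clarke \<Phi> s = upper_deriv s"
  unfolding max_clarke_def
proof (rule Greatest_equality)
  interpret neg: lipschitz_fun "\<lambda>s. - \<Phi> s" K by (rule neg)
  show "upper_deriv s \<in> clarke_gradient \<Phi> s"
  proof (rule clarke_gradient_memI[OF upper_deriv_le])
    fix k
    have "- quot_sup (\<lambda>s. - \<Phi> s) k s \<le> upper_deriv s"
      by (rule le_upper_deriv[OF neg_quot_sup_le])
    then show "- upper_deriv s \<le> quot_sup (\<lambda>s. - \<Phi> s) k s" by simp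
  qed
  fix \<xi> assume "\<xi> \<in> clarke_gradient \<Phi> s"
  then have "ereal (\<xi> * 1) \<le> clarke_derivative \<Phi> s 1"
    unfolding clarke_gradient_def by blast
  from order_trans[OF this clarke_derivative_1_le]
  show "\<xi> \<le> upper_deriv s" by (intro le_upper_deriv) simp
qed

end

section \<open>Locality and the sum rule\<close>

lemma clarke_derivative_cong:
  assumes "\<forall>\<^sub>F t in nhds s. f t = g t"
  shows "clarke_derivative f s = clarke_derivative g s"
proof (rule ext)
  fix v
  obtain d where d: "0 < d" "\<And>t. dist t s < d \<Longrightarrow> f t = g t"
    using assms unfolding eventually_nhds_metric by auto
  have "\<forall>\<^sub>F z in nhds s. \<bar>z - s\<bar> < d / 2"
    unfolding eventually_nhds_metric using d by (intro exI[of _ "d / 2"]) (auto simp: dist_real_def)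
  \<comment> \<open>With this bound on \<tau> the point z + \<tau> * v stays within d of s; the 1
    added to |v| covers v = 0.\<close>
  moreover have "\<forall>\<^sub>F \<tau> in at_right 0. \<tau> \<in> {0<..<d / (2 * (\<bar>v\<bar> + 1))}"
    by (rule eventually_at_right_real) (use d in simp)
  ultimately have "\<forall>\<^sub>F p in nhds s \<times>\<^sub>F at_right 0. \<bar>fst p - s\<bar> < d / 2 \<and> snd p \<in> {0<..<d / (2 * (\<bar>v\<bar> + 1))}"
    by (rule eventually_prodI)
  then show "clarke_derivative f s v = clarke_derivative g s v"
    unfolding clarke_derivative_def
  proof (intro Limsup_eq, eventually_elim)
    case (elim p)
    obtain z \<tau> where p: "p = (z, \<tau>)" by (cases p)
    have z: "\<bar>z - s\<bar> < d / 2" and \<tau>: "0 < \<tau>" "\<tau> < d / (2 * (\<bar>v\<bar> + 1))" using elim by (auto simp: p)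
    have "\<bar>\<tau> * v\<bar> \<le> \<tau> * (\<bar>v\<bar> + 1)" using \<tau> by (simp add: abs_mult)
    also have "\<dots> < d / 2" using \<tau> by (simp add: field_simps)
    finally have "\<bar>z + \<tau> * v - s\<bar> < d" "\<bar>z - s\<bar> < d" using z d(1) by linarith+
    then show ?case using d(2)[of "z + \<tau> * v"] d(2)[of z] by (simp add: p dist_real_def)
  qed
qed

lemma clarke_gradient_cong:
  "\<forall>\<^sub>F t in nhds s. f t = g t \<Longrightarrow> clarke_gradient f s = clarke_gradient g s"
  by (simp add: clarke_gradient_def clarke_derivative_cong)

lemma max_clarke_cong:
  "\<forall>\<^sub>F t in nhds s. f t = g t \<Longrightarrow> max_clarke f s = max_clarke g s"
  by (simp add: max_clarke_def clarke_gradient_cong)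

lemma lipschitz_fun_add_cmult:
  assumes "lipschitz_fun f K" "lipschitz_fun g L" "0 \<le> lam"
  shows "lipschitz_fun (\<lambda>s. f s + lam * g s) (K + lam * L)"
proof
  fix s t
  have "f s + lam * g s - (f t + lam * g t) = (f s - f t) + lam * (g s - g t)"
    by (simp add: algebra_simps)
  then have "\<bar>f s + lam * g s - (f t + lam * g t)\<bar> \<le> \<bar>f s - f t\<bar> + \<bar>lam * (g s - g t)\<bar>"
    by (simp only: abs_triangle_ineq)
  also have "\<dots> = \<bar>f s - f t\<bar> + lam * \<bar>g s - g t\<bar>"
    using assms(3) by (simp add: abs_mult)
  also have "\<dots> \<le> K * \<bar>s - t\<bar> + lam * (L * \<bar>s - t\<bar>)"
    using assms unfolding lipschitz_fun_def by (intro add_mono mult_left_mono) auto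
  finally show "\<bar>f s + lam * g s - (f t + lam * g t)\<bar> \<le> (K + lam * L) * \<bar>s - t\<bar>"
    by (simp add: algebra_simps)
qed

text \<open>Upper derivatives are subadditive, so \<xi> lies between the combinations of the left
  ends and of the right ends of the two gradients. Each gradient contains the interval between its
  ends, and a point of a sum of intervals splits accordingly.\<close>

lemma clarke_sum:
  assumes f: "lipschitz_fun f K" and g: "lipschitz_fun g L" and lam: "0 \<le> lam"
    and \<xi>: "\<And>k. \<xi> \<le> quot_sup (\<lambda>s. f s + lam * g s) k s"
      "\<And>k. - \<xi> \<le> quot_sup (\<lambda>s. - (f s + lam * g s)) k s"
  shows "\<exists>a b. a \<in> clarke_gradient f s \<and> b \<in> clarke_gradient g s \<and> \<xi> = a + lam * b"
proof -
  have sum: "\<xi> \<le> lipschitz_fun.upper_deriv f s + lam * lipschitz_fun.upper_deriv g s"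
    if f: "lipschitz_fun f K" and g: "lipschitz_fun g L"
      and \<xi>: "\<And>k. \<xi> \<le> quot_sup (\<lambda>s. f s + lam * g s) k s" for f g \<xi>
  proof -
    interpret f: lipschitz_fun f K by fact
    interpret g: lipschitz_fun g L by fact
    interpret fg: lipschitz_fun "\<lambda>s. f s + lam * g s" "K + lam * L"
      by (rule lipschitz_fun_add_cmult) fact+
    have le: "\<xi> \<le> quot_sup f j s + lam * quot_sup g k s" for j k
    proof -
      \<comment> \<open>The two infima range over separate indices; at the larger index both terms
        are bounded by monotonicity.\<close>
      define m where "m = max j k"
      have "quot_sup (\<lambda>s. f s + lam * g s) m s \<le> quot_sup f m s + lam * quot_sup g m s"
      proof (rule fg.quot_sup_le)
        fix z \<tau> assume z: "\<bar>z - s\<bar> < 1 / real (Suc m)" "0 < \<tau>" "\<tau> < 1 / real (Suc m)"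
        have "(f (z + \<tau>) + lam * g (z + \<tau>) - (f z + lam * g z)) / \<tau>
            = (f (z + \<tau>) - f z) / \<tau> + lam * ((g (z + \<tau>) - g z) / \<tau>)"
          by (simp add: diff_divide_distrib add_divide_distrib right_diff_distrib)
        also have "\<dots> \<le> quot_sup f m s + lam * quot_sup g m s"
          using lam by (intro add_mono mult_left_mono f.quot_le_sup g.quot_le_sup z)
        finally show "(f (z + \<tau>) + lam * g (z + \<tau>) - (f z + lam * g z)) / \<tau> \<le> quot_sup f m s + lam * quot_sup g m s" .
      qed
      also have "\<dots> \<le> quot_sup f j s + lam * quot_sup g k s"
        using lam by (intro add_mono mult_left_mono f.quot_sup_antimono g.quot_sup_antimono) (auto simp: m_def)
      finally show ?thesis using \<xi>[of m] by simp
    qed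
    have "\<xi> - lam * quot_sup g k s \<le> f.upper_deriv s" for k
      using le by (intro f.le_upper_deriv) (simp add: algebra_simps)
    then have le2: "\<xi> - f.upper_deriv s \<le> lam * quot_sup g k s" for k
      by (simp add: algebra_simps)
    show ?thesis
    proof (cases "lam = 0")
      case True
      then show ?thesis using le2[of 0] by simp
    next
      case False
      then have l: "0 < lam" using lam by simp
      have "(\<xi> - f.upper_deriv s) / lam \<le> g.upper_deriv s"
        using le2 l by (intro g.le_upper_deriv) (simp add: divide_le_eq mult.commute)
      then show ?thesis using l by (simp add: field_simps)
    qed
  qed
  interpret f: lipschitz_fun f K by fact
  interpret g: lipschitz_fun g L by fact
  interpret nf: lipschitz_fun "\<lambda>s. - f s" K by (rule f.neg)
  interpret ng: lipschitz_fun "\<lambda>s. - g s" L by (rule g.neg)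
  have up: "\<xi> \<le> f.upper_deriv s + lam * g.upper_deriv s" by (rule sum[OF f g \<xi>(1)])
  have "- \<xi> \<le> nf.upper_deriv s + lam * ng.upper_deriv s"
  proof (rule sum[OF f.neg g.neg])
    show "- \<xi> \<le> quot_sup (\<lambda>s. - f s + lam * - g s) k s" for k
      using \<xi>(2)[of k] by simp
  qed
  then have dn: "- nf.upper_deriv s - lam * ng.upper_deriv s \<le> \<xi>" by simp
  have ordf: "- nf.upper_deriv s \<le> f.upper_deriv s"
  proof (rule f.le_upper_deriv)
    fix k
    have "- quot_sup f k s \<le> nf.upper_deriv s"
      using f.neg_quot_sup_le by (intro nf.le_upper_deriv) (metis minus_le_iff)
    then show "- nf.upper_deriv s \<le> quot_sup f k s" by simp
  qed
  have ordg: "- ng.upper_deriv s \<le> g.upper_deriv s"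
  proof (rule g.le_upper_deriv)
    fix k
    have "- quot_sup g k s \<le> ng.upper_deriv s"
      using g.neg_quot_sup_le by (intro ng.le_upper_deriv) (metis minus_le_iff)
    then show "- ng.upper_deriv s \<le> quot_sup g k s" by simp
  qed
  have memf: "a \<in> clarke_gradient f s" if "- nf.upper_deriv s \<le> a" "a \<le> f.upper_deriv s" for a
    using that f.upper_deriv_le[of s] nf.upper_deriv_le[of s]
    by (intro f.clarke_gradient_memI) (auto intro: order_trans simp: minus_le_iff)
  have memg: "a \<in> clarke_gradient g s" if "- ng.upper_deriv s \<le> a" "a \<le> g.upper_deriv s" for a
    using that g.upper_deriv_le[of s] ng.upper_deriv_le[of s]
    by (intro g.clarke_gradient_memI) (auto intro: order_trans simp: minus_le_iff)
  show ?thesis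
  proof (cases "lam = 0")
    case True
    have "\<xi> \<in> clarke_gradient f s" using up dn True by (intro memf) auto
    \<comment> \<open>A member of the gradient of g must still be exhibited, although it is
      multiplied by 0.\<close>
    moreover have "g.upper_deriv s \<in> clarke_gradient g s" using ordg by (intro memg) auto
    ultimately show ?thesis using True by force
  next
    case False
    then have l: "0 < lam" using lam by simp
    \<comment> \<open>The least admissible a: not below the left end of the gradient of f, and large
      enough for the rest to be at most lam times the right end of the gradient of g.\<close>
    define a where "a = max (- nf.upper_deriv s) (\<xi> - lam * g.upper_deriv s)"
    define b where "b = (\<xi> - a) / lam"
    have "a \<in> clarke_gradient f s" using ordf up by (intro memf) (auto simp: a_def)
    moreover have "b \<in> clarke_gradient g s"
    proof (rule memg)
      have "lam * - ng.upper_deriv s \<le> lam * g.upper_deriv s"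
        using ordg lam by (rule mult_left_mono)
      then have "lam * - ng.upper_deriv s \<le> \<xi> - a" using dn by (simp add: a_def max_def)
      then show "- ng.upper_deriv s \<le> b" using l by (simp add: b_def field_simps)
      have "\<xi> - a \<le> lam * g.upper_deriv s" by (simp add: a_def max_def)
      then show "b \<le> g.upper_deriv s" using l by (simp add: b_def field_simps)
    qed
    moreover have "\<xi> = a + lam * b" using l by (simp add: b_def)
    ultimately show ?thesis by blast
  qed
qed

section \<open>Truncated problems\<close>

text \<open>Clamping the argument keeps the Lipschitz constant of [0, M] and makes the function
  constant on either side, hence also bounded.\<close>

definition trunc :: "real \<Rightarrow> (real \<Rightarrow> real) \<Rightarrow> real \<Rightarrow> real" where
  "trunc M f s = f (max 0 (min s M))"

lemma locally_lipschitz_imp_lipschitz: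
  assumes "locally_lipschitz_on {0..} f"
  obtains L where "\<And>s t. s \<in> {0..M} \<Longrightarrow> t \<in> {0..M} \<Longrightarrow> \<bar>f s - f t\<bar> \<le> L * \<bar>s - t\<bar>" "0 \<le> L"
proof -
  have "local_lipschitz {0::real} {0..M} (\<lambda>_. f)"
    using assms by (rule local_lipschitz_subset) auto
  then obtain L where "\<And>t. t \<in> {0::real} \<Longrightarrow> L-lipschitz_on {0..M} f"
    by (rule local_lipschitz_compact_implies_lipschitz[where T="{0::real}" and X="{0..M}" and f="\<lambda>_. f"]) auto
  then have L: "L-lipschitz_on {0..M} f" by simp
  show ?thesis
    by (rule that[of L]) (use L in \<open>auto simp: lipschitz_on_def dist_real_def\<close>)
qed

lemma trunc_lipschitz:
  assumes "locally_lipschitz_on {0..} f" "0 \<le> M"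
  obtains K where "lipschitz_fun (trunc M f) K"
proof -
  obtain L where L: "\<And>s t. s \<in> {0..M} \<Longrightarrow> t \<in> {0..M} \<Longrightarrow> \<bar>f s - f t\<bar> \<le> L * \<bar>s - t\<bar>" "0 \<le> L"
    using locally_lipschitz_imp_lipschitz[OF assms(1), of M] by blast
  have "lipschitz_fun (trunc M f) L"
  proof
    fix s t :: real
    have "\<bar>trunc M f s - trunc M f t\<bar> \<le> L * \<bar>max 0 (min s M) - max 0 (min t M)\<bar>"
      unfolding trunc_def using assms(2) by (intro L(1)) auto
    also have "\<dots> \<le> L * \<bar>s - t\<bar>" using L(2) by (intro mult_left_mono) (auto simp: max_def min_def)
    finally show "\<bar>trunc M f s - trunc M f t\<bar> \<le> L * \<bar>s - t\<bar>" .
  qed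
  with that show ?thesis by blast
qed

lemma locally_lipschitz_bounded:
  assumes "locally_lipschitz_on {0..} f"
  obtains B where "0 \<le> B" "\<And>s. s \<in> {0..M} \<Longrightarrow> \<bar>f s\<bar> \<le> B"
proof -
  obtain L where L: "\<And>s t. s \<in> {0..M} \<Longrightarrow> t \<in> {0..M} \<Longrightarrow> \<bar>f s - f t\<bar> \<le> L * \<bar>s - t\<bar>" "0 \<le> L"
    using locally_lipschitz_imp_lipschitz[OF assms(1), of M] by blast
  have "\<bar>f s\<bar> \<le> \<bar>f 0\<bar> + L * \<bar>M\<bar>" if "s \<in> {0..M}" for s
  proof -
    have "\<bar>f s - f 0\<bar> \<le> L * \<bar>s - 0\<bar>" using that by (intro L) auto
    also have "\<dots> \<le> L * \<bar>M\<bar>" using that L(2) by (intro mult_left_mono) auto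
    finally show ?thesis by linarith
  qed
  moreover have "0 \<le> \<bar>f 0\<bar> + L * \<bar>M\<bar>" using L(2) by simp
  ultimately show ?thesis by (intro that[of "\<bar>f 0\<bar> + L * \<bar>M\<bar>"]) auto
qed

text \<open>Because f 0 = 0 the agreement holds across 0 as well, so the gradients at the value 0
  are those of the zero extension.\<close>

lemma trunc_eq_zero_extension:
  assumes "s < M" "f 0 = 0" "0 < M"
  shows "\<forall>\<^sub>F t in nhds s. trunc M f t = zero_extension f t"
proof -
  have "\<forall>\<^sub>F t in nhds s. t \<in> {..<M}"
    using assms(1) by (intro eventually_nhds_in_open) auto
  then show ?thesis
    by eventually_elim (use assms in \<open>auto simp: trunc_def zero_extension_def\<close>)
qed

text \<open>A negative right end of the gradient makes some \<open>quot_sup\<close> negative, and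
  this supremum bounds all short quotients with base points near s, not only those at s.\<close>

lemma negative_max_clarke:
  assumes ll: "locally_lipschitz_on {0..} f" and f0: "f 0 = 0" and s: "0 < s"
    and max_neg: "max_clarke (zero_extension f) s < 0"
  obtains \<delta> c where "0 < \<delta>" "\<delta> < s" "0 < c"
    "\<And>r t. s - \<delta> \<le> r \<Longrightarrow> r \<le> t \<Longrightarrow> t \<le> s \<Longrightarrow> f t - f r \<le> - c * (t - r)"
proof -
  \<comment> \<open>Truncating at s + 1 leaves the function unchanged in a neighbourhood of
    s.\<close>
  obtain K where "lipschitz_fun (trunc (s + 1) f) K"
    using trunc_lipschitz[OF ll, of "s + 1"] s by auto
  then interpret lipschitz_fun "trunc (s + 1) f" K .
  have "max_clarke (zero_extension f) s = max_clarke (trunc (s + 1) f) s"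
    by (rule sym, rule max_clarke_cong, rule trunc_eq_zero_extension) (use s f0 in auto)
  with max_neg have "upper_deriv s < 0" by (simp add: max_clarke_eq)
  then obtain k where k: "quot_sup (trunc (s + 1) f) k s < 0" by (rule upper_deriv_less)
  define c where "c = - quot_sup (trunc (s + 1) f) k s"
  \<comment> \<open>The bound s / 2 keeps \<delta> below s; half of 1/(k+1) makes the base point r
    and the step t - r strictly admissible.\<close>
  define \<delta> where "\<delta> = min (s / 2) (1 / (2 * real (Suc k)))"
  have \<delta>: "0 < \<delta>" "\<delta> < s" "\<delta> < 1 / real (Suc k)"
    using s by (auto simp: \<delta>_def min_less_iff_disj field_simps)
  have "f t - f r \<le> - c * (t - r)" if "s - \<delta> \<le> r" "r \<le> t" "t \<le> s" for r t
  proof (cases "r = t")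
    case False
    then have rt: "0 < t - r" using that by simp
    have "(trunc (s + 1) f (r + (t - r)) - trunc (s + 1) f r) / (t - r) \<le> - c"
      unfolding c_def minus_minus using that \<delta> rt by (intro quot_le_sup) linarith+
    moreover have "trunc (s + 1) f (r + (t - r)) = f t" "trunc (s + 1) f r = f r"
      using that \<delta> by (auto simp: trunc_def)
    ultimately show ?thesis using rt by (simp add: divide_le_eq)
  qed simp
  then show ?thesis
    using \<delta> k by (intro that[of \<delta> c]) (auto simp: c_def)
qed

context bounded_domain
begin

text \<open>Decrease on [s - \<delta>, s] suffices, because the truncation is constant beyond s. The
  strict gap \<delta> matters at the end: equal gradients require equal functions in a neighbourhood
  of the value u x.\<close>

lemma truncated_solution:
  assumes F: "locally_lipschitz_on {0..} F" "F 0 = 0" and G: "locally_lipschitz_on {0..} G" "G 0 = 0"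
    and \<delta>: "0 < \<delta>" "\<delta> \<le> s" and lam: "0 \<le> lam"
    and anti: "\<And>r t. s - \<delta> \<le> r \<Longrightarrow> r \<le> t \<Longrightarrow> t \<le> s \<Longrightarrow> F t + lam * G t \<le> F r + lam * G r"
  obtains u g where "H10_pair u g" "weak_solution \<Omega> F G lam u" "AE x in M. 0 \<le> u x \<and> u x \<le> s"
    "\<And>v h. H10_pair v h \<Longrightarrow> sqn M g / 2 - (\<integral>x. trunc s F (u x) + lam * trunc s G (u x) \<partial>M)
       \<le> sqn M h / 2 - (\<integral>x. trunc s F (v x) + lam * trunc s G (v x) \<partial>M)"
proof -
  have s: "0 < s" using \<delta> by simp
  then have s0: "0 \<le> s" by simp
  obtain K where K: "lipschitz_fun (trunc s F) K" by (rule trunc_lipschitz[OF F(1) s0])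
  obtain L where L: "lipschitz_fun (trunc s G) L" by (rule trunc_lipschitz[OF G(1) s0])
  obtain BF where BF: "0 \<le> BF" "\<And>t. t \<in> {0..s} \<Longrightarrow> \<bar>F t\<bar> \<le> BF"
    by (rule locally_lipschitz_bounded[OF F(1)]) (rule that)
  obtain BG where BG: "0 \<le> BG" "\<And>t. t \<in> {0..s} \<Longrightarrow> \<bar>G t\<bar> \<le> BG"
    by (rule locally_lipschitz_bounded[OF G(1)]) (rule that)
  define \<Phi> where "\<Phi> t = trunc s F t + lam * trunc s G t" for t
  have clamp: "max 0 (min t s) \<in> {0..s}" for t using s by auto
  have "energy \<Omega> \<Phi> (K + lam * L) (BF + lam * BG)"
  proof (intro energy.intro bounded_domain_axioms energy_axioms.intro)
    show "lipschitz_fun \<Phi> (K + lam * L)"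
      unfolding \<Phi>_def[abs_def] by (rule lipschitz_fun_add_cmult[OF K L lam])
    fix t
    have "\<bar>\<Phi> t\<bar> \<le> \<bar>trunc s F t\<bar> + lam * \<bar>trunc s G t\<bar>"
      using lam abs_triangle_ineq[of "trunc s F t" "lam * trunc s G t"] by (simp add: \<Phi>_def abs_mult)
    also have "\<dots> \<le> BF + lam * BG"
      unfolding trunc_def using lam BF(2)[OF clamp] BG(2)[OF clamp] by (intro add_mono mult_left_mono)
    finally show "\<bar>\<Phi> t\<bar> \<le> BF + lam * BG" .
  qed
  then interpret energy \<Omega> \<Phi> "K + lam * L" "BF + lam * BG" .
  obtain u g where ug: "H10_pair u g" and min: "\<And>v h. H10_pair v h \<Longrightarrow> E u g \<le> E v h"
    using minimizer by blast
  obtain \<xi> where \<xi>: "L2 M \<xi>" "\<And>v h. H10_pair v h \<Longrightarrow> (\<integral>x. g x \<bullet> h x \<partial>M) = (\<integral>x. \<xi> x * v x \<partial>M)"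
    "AE x in M. \<forall>k. \<xi> x \<le> quot_sup \<Phi> k (u x) \<and> - \<xi> x \<le> quot_sup (\<lambda>s. - \<Phi> s) k (u x)"
    using euler_lagrange[OF ug min] by blast
  have range: "AE x in M. 0 \<le> u x \<and> u x \<le> s - \<delta>"
  proof (rule minimizer_range[OF ug \<xi>(2,3)])
    show "\<Phi> t = \<Phi> 0" if "t \<le> 0" for t
      using that s by (simp add: \<Phi>_def trunc_def)
    show "\<Phi> t \<le> \<Phi> r" if "s - \<delta> \<le> r" "r \<le> t" for r t
      unfolding \<Phi>_def trunc_def using that \<delta> by (intro anti) auto
  qed (use \<delta> in auto)
  have memb: "AE x in M. \<xi> x \<in> {a + lam * b | a b. a \<in> clarke_gradient (zero_extension F) (u x) \<and>
      b \<in> clarke_gradient (zero_extension G) (u x)}"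
    using range \<xi>(3)
  proof eventually_elim
    case (elim x)
    have "\<exists>a b. a \<in> clarke_gradient (trunc s F) (u x) \<and> b \<in> clarke_gradient (trunc s G) (u x) \<and> \<xi> x = a + lam * b"
      using elim(2) by (intro clarke_sum[OF K L lam]) (auto simp: \<Phi>_def[abs_def])
    moreover have "u x < s" using elim(1) \<delta> by simp
    then have "clarke_gradient (trunc s F) (u x) = clarke_gradient (zero_extension F) (u x)"
      "clarke_gradient (trunc s G) (u x) = clarke_gradient (zero_extension G) (u x)"
      using F G s by (auto intro!: clarke_gradient_cong trunc_eq_zero_extension)
    ultimately show ?case by auto
  qed
  have weak: "weak_solution \<Omega> F G lam u"
    unfolding weak_solution_def
  proof (intro conjI bexI[of _ \<xi>] ballI)
    show "u \<in> H10 \<Omega>" using ug H10_iff_pair by blast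
    show "AE x in M. 0 \<le> u x" using range by (rule eventually_mono) simp
    show "\<xi> \<in> borel_measurable M" by (rule L2_measurable[OF \<xi>(1)])
    fix v assume "v \<in> H10 \<Omega>"
    then obtain h where vh: "H10_pair v h" using H10_iff_pair by blast
    show "integrable M (\<lambda>x. \<xi> x * v x)"
      by (rule L2_mult_integrable[OF \<xi>(1) H10_pair_L2(1)[OF vh]])
    have meas: "weak_gradient \<Omega> w \<in> borel_measurable M" if "H10_pair w f" for w f
    proof -
      have "is_weak_gradient \<Omega> w (weak_gradient \<Omega> w)"
        unfolding weak_gradient_def using someI[of "is_weak_gradient \<Omega> w" f] H10_pair_weak_gradient[OF that] by blast
      then show ?thesis by (auto simp: is_weak_gradient_def square_integrable_def)
    qed
    have "(\<integral>x. weak_gradient \<Omega> u x \<bullet> weak_gradient \<Omega> v x \<partial>M) = (\<integral>x. g x \<bullet> h x \<partial>M)"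
    proof (rule integral_cong_AE)
      show "AE x in M. weak_gradient \<Omega> u x \<bullet> weak_gradient \<Omega> v x = g x \<bullet> h x"
        using weak_gradient_AE[OF H10_pair_weak_gradient[OF ug]] weak_gradient_AE[OF H10_pair_weak_gradient[OF vh]]
        by eventually_elim simp
    qed (use meas[OF ug] meas[OF vh] L2_measurable[OF H10_pair_L2(2)[OF ug]] L2_measurable[OF H10_pair_L2(2)[OF vh]] in auto)
    also have "\<dots> = (\<integral>x. \<xi> x * v x \<partial>M)" by (rule \<xi>(2)[OF vh])
    finally show "(\<integral>x. weak_gradient \<Omega> u x \<bullet> weak_gradient \<Omega> v x \<partial>M) = (\<integral>x. \<xi> x * v x \<partial>M)" .
  qed (rule memb)
  show ?thesis
  proof (rule that[OF ug weak])
    show "AE x in M. 0 \<le> u x \<and> u x \<le> s" using range by (rule eventually_mono) (use \<delta> in auto)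
    show "sqn M g / 2 - (\<integral>x. trunc s F (u x) + lam * trunc s G (u x) \<partial>M)
       \<le> sqn M h / 2 - (\<integral>x. trunc s F (v x) + lam * trunc s G (v x) \<partial>M)" if "H10_pair v h" for v h
      using min[OF that] unfolding E_def \<Phi>_def .
  qed
qed

text \<open>Multiples \<tau> w take the exact value \<tau> on a set whose measure does not depend on
  \<tau>, so that a large F(\<tau>) pays off there. The plateau comes from composing a bump with a
  C^1 function that equals 1 from c onwards.\<close>

lemma plateau_function:
  assumes "\<Omega> \<noteq> {}"
  obtains w h where "H10_pair w h" "\<And>x. 0 \<le> w x" "\<And>x. w x \<le> 1" "0 < measure M {x \<in> space M. w x = 1}"
proof -
  obtain x r where xr: "0 < r" "cball x r \<subseteq> \<Omega>"
    using assms open_dom open_contains_cball by blast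
  obtain \<eta> where \<eta>: "test_function \<Omega> \<eta>" "\<And>x. 0 \<le> \<eta> x" "\<And>x. \<eta> x \<le> 1" "{x. \<eta> x \<noteq> 0} = ball x r"
    by (rule test_function_bump[OF xr(2,1)]) (rule that)
  have "x \<in> {x. \<eta> x \<noteq> 0}" unfolding \<eta>(4) using xr by simp
  then have pos: "0 < \<eta> x" using \<eta>(2)[of x] by simp
  \<comment> \<open>Half of the central value, so that the bump exceeds c on a whole ball.\<close>
  define c where "c = \<eta> x / 2"
  have c: "0 < c" using pos by (simp add: c_def)
  define \<psi> where "\<psi> t = 1 - (max 0 (1 - t / c))\<^sup>2" for t
  define \<psi>' where "\<psi>' t = 2 * max 0 (1 - t / c) / c" for t
  have "H10_pair (\<lambda>x. \<psi> (\<eta> x)) (\<lambda>x. \<psi>' (\<eta> x) *\<^sub>R grad \<eta> x)"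
  proof (rule H10_pair_chain_test[OF \<eta>(1)])
    show "(\<psi> has_real_derivative \<psi>' t) (at t)" for t
    proof -
      have "((\<lambda>t. 1 - t / c) has_real_derivative - (1 / c)) (at t)"
        using c by (auto intro!: derivative_eq_intros)
      from DERIV_diff[OF DERIV_const[of 1] DERIV_chain2[where f="\<lambda>t. (max 0 t)\<^sup>2" and g="\<lambda>t. 1 - t / c", OF DERIV_max_0_power2 this]]
      show ?thesis by (simp add: \<psi>_def[abs_def] \<psi>'_def)
    qed
    show "continuous_on UNIV \<psi>'"
      unfolding \<psi>'_def[abs_def] by (intro continuous_intros ballI) (use c in auto)
    show "\<psi> 0 = 0" by (simp add: \<psi>_def)
  qed
  moreover have "0 \<le> \<psi> (\<eta> y)" "\<psi> (\<eta> y) \<le> 1" for y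
  proof -
    have "0 \<le> max 0 (1 - \<eta> y / c)" "max 0 (1 - \<eta> y / c) \<le> 1" using \<eta>(2)[of y] c by auto
    from power_le_one[OF this, of 2] show "0 \<le> \<psi> (\<eta> y)" by (simp add: \<psi>_def)
    show "\<psi> (\<eta> y) \<le> 1" by (simp add: \<psi>_def)
  qed
  moreover have "0 < measure M {y \<in> space M. \<psi> (\<eta> y) = 1}"
  proof -
    have cont: "continuous_on UNIV \<eta>" using test_function_cont_csupp[OF \<eta>(1)] cont_csuppD_cont by blast
    then have "open {y. c < \<eta> y}" by (intro open_Collect_less continuous_intros)
    then have o: "open ({y. c < \<eta> y} \<inter> \<Omega>)" using open_dom by (rule open_Int)
    have "x \<in> {y. c < \<eta> y} \<inter> \<Omega>" using pos xr by (auto simp: c_def)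
    then obtain e where e: "0 < e" "ball x e \<subseteq> {y. c < \<eta> y} \<inter> \<Omega>"
      using o open_contains_ball by blast
    have one: "\<psi> (\<eta> y) = 1" if "y \<in> ball x e" for y
    proof -
      have "c < \<eta> y" using that e by auto
      then have "1 - \<eta> y / c < 0" using c by (simp add: field_simps)
      then show ?thesis by (simp add: \<psi>_def)
    qed
    have "0 < measure lebesgue (ball x e)" using content_ball_pos[OF e(1), of x] by simp
    also have "\<dots> = measure M (ball x e)"
      using e by (subst measure_restrict_space) auto
    also have "\<dots> \<le> measure M {y \<in> space M. \<psi> (\<eta> y) = 1}"
    proof (rule finite_measure_mono)
      show "ball x e \<subseteq> {y \<in> space M. \<psi> (\<eta> y) = 1}" using e one by auto
      have [measurable]: "(\<lambda>y. \<psi> (\<eta> y)) \<in> borel_measurable M"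
        unfolding \<psi>_def using test_measurable[OF \<eta>(1)] by simp
      show "{y \<in> space M. \<psi> (\<eta> y) = 1} \<in> sets M" by measurable
    qed
    finally show ?thesis .
  qed
  ultimately show ?thesis using that by blast
qed

end

section \<open>Choice of the truncation levels\<close>

text \<open>Off the plateau of a competitor, F must be bounded below at all values between 0 and the
  height. The lower limit controls large values, local Lipschitz continuity the others.\<close>

lemma lower_quadratic_bound:
  assumes ll: "locally_lipschitz_on {0..} F" and lim: "- \<infinity> < Liminf at_top (\<lambda>s. ereal (F s / s\<^sup>2))"
  obtains C where "0 \<le> C" "\<And>s. 0 \<le> s \<Longrightarrow> - C * (1 + s\<^sup>2) \<le> F s"
proof -
  obtain c where c: "ereal c < Liminf at_top (\<lambda>s. ereal (F s / s\<^sup>2))"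
    using lim ereal_dense2[of "- \<infinity>"] by auto
  then have "\<forall>\<^sub>F s in at_top. c < F s / s\<^sup>2"
    using less_LiminfD[OF c] by simp
  then obtain S where S: "\<And>s. S \<le> s \<Longrightarrow> c < F s / s\<^sup>2"
    unfolding eventually_at_top_linorder by blast
  obtain B where B: "0 \<le> B" "\<And>s. s \<in> {0..max S 1} \<Longrightarrow> \<bar>F s\<bar> \<le> B"
    by (rule locally_lipschitz_bounded[OF ll]) (rule that)
  show ?thesis
  proof
    show "0 \<le> \<bar>c\<bar> + B" using B by simp
    fix s :: real assume s: "0 \<le> s"
    show "- (\<bar>c\<bar> + B) * (1 + s\<^sup>2) \<le> F s"
    proof (cases "s \<le> max S 1")
      case True
      have "(\<bar>c\<bar> + B) * 1 \<le> (\<bar>c\<bar> + B) * (1 + s\<^sup>2)" using B by (intro mult_left_mono) auto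
      then have "- (\<bar>c\<bar> + B) * (1 + s\<^sup>2) \<le> - (\<bar>c\<bar> + B)"
        by (simp only: mult_minus_left mult_1_right neg_le_iff_le)
      moreover have "\<bar>F s\<bar> \<le> B" using s True by (intro B(2)) simp
      ultimately show ?thesis by linarith
    next
      case False
      then have "c < F s / s\<^sup>2" "0 < s\<^sup>2" using S[of s] s by auto
      then have "c * s\<^sup>2 < F s" by (simp add: pos_less_divide_eq)
      moreover have "- (\<bar>c\<bar> + B) * (1 + s\<^sup>2) \<le> c * s\<^sup>2"
      proof -
        have "(\<bar>c\<bar> + B) * (1 + s\<^sup>2) + c * s\<^sup>2 = (\<bar>c\<bar> + c) * s\<^sup>2 + (\<bar>c\<bar> + B * (1 + s\<^sup>2))"
          by (simp add: algebra_simps)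
        moreover have "0 \<le> (\<bar>c\<bar> + c) * s\<^sup>2" by (intro mult_nonneg_nonneg) (linarith, simp)
        moreover have "0 \<le> B * (1 + s\<^sup>2)" using B by simp
        ultimately show ?thesis by (simp only: mult_minus_left)
      qed
      ultimately show ?thesis by simp
    qed
  qed
qed

lemma frequently_large:
  fixes P :: "real \<Rightarrow> bool"
  assumes "\<exists>\<^sub>F s in at_top. P s"
  obtains s where "A \<le> s" "P s"
proof -
  have "\<exists>\<^sub>F s in at_top. P s \<and> A \<le> s"
    using frequently_eventually_frequently[OF assms eventually_ge_at_top] .
  then show ?thesis using that frequently_ex by blast
qed

lemma large_quadratic_quotient:
  assumes "Limsup at_top (\<lambda>s. ereal (F s / s\<^sup>2)) = \<infinity>"
  obtains s where "A \<le> s" "N < F s / s\<^sup>2"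
proof (rule frequently_large)
  show "\<exists>\<^sub>F s in at_top. N < F s / s\<^sup>2"
  proof (rule ccontr)
    assume "\<not> ?thesis"
    then have "\<forall>\<^sub>F s in at_top. ereal (F s / s\<^sup>2) \<le> ereal N" by (simp add: not_frequently not_less)
    then have "Limsup at_top (\<lambda>s. ereal (F s / s\<^sup>2)) \<le> ereal N" by (rule Limsup_bounded)
    with assms show False by simp
  qed
qed (rule that)

lemma large_negative_max_clarke:
  assumes "Liminf at_top (\<lambda>s. ereal (max_clarke f s / s)) < 0"
  obtains s where "A \<le> s" "0 < s" "max_clarke f s < 0"
proof -
  have "\<exists>\<^sub>F s in at_top. max_clarke f s / s < 0"
  proof (rule ccontr)
    assume "\<not> ?thesis"
    then have "\<forall>\<^sub>F s in at_top. 0 \<le> ereal (max_clarke f s / s)" by (simp add: not_frequently not_less)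
    then have "0 \<le> Liminf at_top (\<lambda>s. ereal (max_clarke f s / s))" by (rule Liminf_bounded)
    with assms show False by simp
  qed
  \<comment> \<open>The lower bound 1 makes s positive, so the sign of the quotient is that of its
    numerator.\<close>
  then obtain s where s: "max A 1 \<le> s" "max_clarke f s / s < 0" by (rule frequently_large)
  then show ?thesis by (intro that[of s]) (auto simp: divide_less_0_iff)
qed

section \<open>Competitors of low energy and admissible levels\<close>

context bounded_domain
begin

abbreviation (input) vol :: real where "vol \<equiv> measure M (space M)"

text \<open>The truncations of \<open>F\<close> to \<open>[0, s]\<close> have the same value at \<open>\<tau> w \<le> s\<close>, so \<open>\<tau>\<close> can be
  chosen before \<open>s\<close>.\<close>

lemma low_energy:
  assumes ne: "\<Omega> \<noteq> {}" and ll: "locally_lipschitz_on {0..} F"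
    and inf: "- \<infinity> < Liminf at_top (\<lambda>s. ereal (F s / s\<^sup>2))"
    and sup: "Limsup at_top (\<lambda>s. ereal (F s / s\<^sup>2)) = \<infinity>"
  obtains \<tau> v h where "A \<le> \<tau>" "H10_pair v h" "\<And>x. 0 \<le> v x" "\<And>x. v x \<le> \<tau>"
    "\<And>s. \<tau> \<le> s \<Longrightarrow> sqn M h / 2 - (\<integral>x. trunc s F (v x) \<partial>M) < - D"
proof -
  obtain w g where w: "H10_pair w g" "\<And>x. 0 \<le> w x" "\<And>x. w x \<le> 1" "0 < measure M {x \<in> space M. w x = 1}"
    by (rule plateau_function[OF ne]) (rule that)
  define P where "P = {x \<in> space M. w x = 1}"
  have [measurable]: "w \<in> borel_measurable M" by (rule L2_measurable[OF H10_pair_L2(1)[OF w(1)]])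
  have Pm: "P \<in> sets M" unfolding P_def by measurable
  have P: "0 < measure M P" using w(4) by (simp add: P_def)
  obtain C where C: "0 \<le> C" "\<And>s. 0 \<le> s \<Longrightarrow> - C * (1 + s\<^sup>2) \<le> F s"
    by (rule lower_quadratic_bound[OF ll inf]) (rule that)
  \<comment> \<open>Multiplied by \<tau>^2 and the measure of P, the summands pay for the gradient
    and for the quadratic lower bound on F, and leave the surplus \<tau>^2, which exceeds D.\<close>
  define N where "N = (sqn M g / 2 + 2 * C * vol + 1) / measure M P"
  have N0: "0 \<le> N"
    unfolding N_def using C(1) P by (intro divide_nonneg_pos add_nonneg_nonneg mult_nonneg_nonneg) auto
  \<comment> \<open>The bound 1 gives 1 + \<tau>^2 \<le> 2 \<tau>^2 and \<tau> \<le> \<tau>^2; with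
    the bound |D| + 1 the latter yields D < \<tau>^2.\<close>
  obtain \<tau> where \<tau>: "max A (max 1 (\<bar>D\<bar> + 1)) \<le> \<tau>" "N < F \<tau> / \<tau>\<^sup>2"
    by (rule large_quadratic_quotient[OF sup]) (rule that)
  then have \<tau>1: "1 \<le> \<tau>" "A \<le> \<tau>" "\<bar>D\<bar> + 1 \<le> \<tau>" by auto
  have NF: "N * \<tau>\<^sup>2 < F \<tau>" using \<tau>(2) \<tau>1(1) by (simp add: pos_less_divide_eq)
  have p: "H10_pair (\<lambda>x. \<tau> * w x) (\<lambda>x. \<tau> *\<^sub>R g x)"
    using H10_pair_add_cmult[OF H10_pair_test[OF test_function_zero] w(1), of \<tau>]
    by (simp add: grad_def frechet_derivative_const)
  show ?thesis
  proof (rule that[OF \<tau>1(2) p])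
    show "0 \<le> \<tau> * w x" "\<tau> * w x \<le> \<tau>" for x using w(2,3)[of x] \<tau>1(1) by (auto simp: mult_left_le)
    fix s assume s: "\<tau> \<le> s"
    then have s0: "0 \<le> s" using \<tau>1 by simp
    obtain K where "lipschitz_fun (trunc s F) K" by (rule trunc_lipschitz[OF ll s0])
    then interpret lipschitz_fun "trunc s F" K .
    have tr: "trunc s F (\<tau> * w x) = F (\<tau> * w x)" for x
    proof -
      have "\<tau> * w x \<le> \<tau> * 1" using w(3)[of x] \<tau>1(1) by (intro mult_left_mono) auto
      with s have "min (\<tau> * w x) s = \<tau> * w x" by simp
      moreover have "0 \<le> \<tau> * w x" using w(2)[of x] \<tau>1(1) by simp
      ultimately show ?thesis by (simp add: trunc_def)
    qed
    obtain B where B: "0 \<le> B" "\<And>t. t \<in> {0..s} \<Longrightarrow> \<bar>F t\<bar> \<le> B"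
      by (rule locally_lipschitz_bounded[OF ll]) (rule that)
    have int: "integrable M (\<lambda>x. trunc s F (\<tau> * w x))"
    proof (rule integrable_const_bound[where B=B])
      show "AE x in M. norm (trunc s F (\<tau> * w x)) \<le> B"
        unfolding trunc_def using s0 by (auto intro!: B(2))
    qed measurable
    \<comment> \<open>On P the value is F \<tau>; elsewhere the quadratic bound at \<tau> * w x is
      weakened to the one at \<tau>.\<close>
    have pt: "(F \<tau> + C * (1 + \<tau>\<^sup>2)) * indicator P x - C * (1 + \<tau>\<^sup>2) \<le> trunc s F (\<tau> * w x)" if "x \<in> space M" for x
    proof (cases "x \<in> P")
      case True
      then have "w x = 1" by (simp add: P_def)
      with tr[of x] have "trunc s F (\<tau> * w x) = F \<tau>" by simp
      with True show ?thesis by simp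
    next
      case False
      have "(\<tau> * w x)\<^sup>2 \<le> \<tau>\<^sup>2" using w(2,3)[of x] \<tau>1(1) by (intro power_mono) (auto simp: mult_left_le)
      then have "C * (1 + (\<tau> * w x)\<^sup>2) \<le> C * (1 + \<tau>\<^sup>2)" using C(1) by (intro mult_left_mono) auto
      moreover have "- C * (1 + (\<tau> * w x)\<^sup>2) \<le> F (\<tau> * w x)" using w(2)[of x] \<tau>1(1) by (intro C(2)) simp
      ultimately show ?thesis using False by (simp add: tr)
    qed
    have iP: "integrable M (\<lambda>x. (F \<tau> + C * (1 + \<tau>\<^sup>2)) * indicator P x)"
      using Pm by (intro integrable_mult_right integrable_real_indicator) (auto simp: emeasure_eq_measure)
    have "(\<integral>x. (F \<tau> + C * (1 + \<tau>\<^sup>2)) * indicator P x - C * (1 + \<tau>\<^sup>2) \<partial>M) \<le> (\<integral>x. trunc s F (\<tau> * w x) \<partial>M)"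
      using iP int pt by (intro integral_mono) auto
    moreover have "(\<integral>x. (F \<tau> + C * (1 + \<tau>\<^sup>2)) * indicator P x - C * (1 + \<tau>\<^sup>2) \<partial>M)
        = (F \<tau> + C * (1 + \<tau>\<^sup>2)) * measure M P - C * (1 + \<tau>\<^sup>2) * vol"
    proof -
      have "(\<integral>x. (F \<tau> + C * (1 + \<tau>\<^sup>2)) * indicator P x - C * (1 + \<tau>\<^sup>2) \<partial>M)
          = (\<integral>x. (F \<tau> + C * (1 + \<tau>\<^sup>2)) * indicator P x \<partial>M) - (\<integral>x. C * (1 + \<tau>\<^sup>2) \<partial>M)"
        by (rule Bochner_Integration.integral_diff[OF iP]) simp
      also have "(\<integral>x. (F \<tau> + C * (1 + \<tau>\<^sup>2)) * indicator P x \<partial>M) = (F \<tau> + C * (1 + \<tau>\<^sup>2)) * measure M P"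
        using Pm sets.sets_into_space[OF Pm] by (simp add: Int_absorb2)
      finally show ?thesis by simp
    qed
    moreover have "N * \<tau>\<^sup>2 * measure M P \<le> (F \<tau> + C * (1 + \<tau>\<^sup>2)) * measure M P"
      using NF C(1) by (intro mult_right_mono) (auto intro: add_increasing2)
    moreover have "N * \<tau>\<^sup>2 * measure M P = (sqn M g / 2 + 2 * C * vol + 1) * \<tau>\<^sup>2"
      using P by (simp add: N_def)
    moreover have "C * (1 + \<tau>\<^sup>2) * vol \<le> 2 * C * vol * \<tau>\<^sup>2"
    proof -
      have "1 \<le> \<tau>\<^sup>2" using \<tau>1(1) by (rule one_le_power)
      then have "(1 + \<tau>\<^sup>2) * (C * vol) \<le> (2 * \<tau>\<^sup>2) * (C * vol)" using C(1) by (intro mult_right_mono) auto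
      then show ?thesis by (simp add: mult_ac)
    qed
    moreover have "sqn M (\<lambda>x. \<tau> *\<^sub>R g x) = \<tau>\<^sup>2 * sqn M g" by (rule sqn_scaleR)
    moreover have "D < \<tau>\<^sup>2"
    proof -
      have "D < \<tau>" using \<tau>1(3) by simp
      also have "\<tau> \<le> \<tau>\<^sup>2" using \<tau>1(1) by (simp add: self_le_power)
      finally show ?thesis .
    qed
    ultimately show "sqn M (\<lambda>x. \<tau> *\<^sub>R g x) / 2 - (\<integral>x. trunc s F (\<tau> * w x) \<partial>M) < - D"
      by (simp add: algebra_simps)
  qed
qed

text \<open>Here a is the previous level and s the next one. For lam = 0 a function with values in
  [0, a] has energy at least -B * vol, and the competitor lies below this by a margin of 1. This
  margin and the slope c are the slack later spent on lam * G.\<close>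

definition good_level :: "(real \<Rightarrow> real) \<Rightarrow> real \<Rightarrow> real \<Rightarrow> bool" where
  "good_level F a s \<longleftrightarrow> a + 1 \<le> s \<and>
     (\<exists>B. (\<forall>t\<in>{0..a}. \<bar>F t\<bar> \<le> B) \<and>
       (\<exists>v h. H10_pair v h \<and> sqn M h / 2 - (\<integral>x. trunc s F (v x) \<partial>M) < - (B * vol) - 1)) \<and>
     (\<exists>\<delta> c. 0 < \<delta> \<and> \<delta> < s \<and> 0 < c \<and>
       (\<forall>r t. s - \<delta> \<le> r \<longrightarrow> r \<le> t \<longrightarrow> t \<le> s \<longrightarrow> F t - F r \<le> - c * (t - r)))"

lemma good_level_exists:
  assumes ne: "\<Omega> \<noteq> {}" and ll: "locally_lipschitz_on {0..} F" and F0: "F 0 = 0"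
    and inf: "- \<infinity> < Liminf at_top (\<lambda>s. ereal (F s / s\<^sup>2))"
    and sup: "Limsup at_top (\<lambda>s. ereal (F s / s\<^sup>2)) = \<infinity>"
    and neg: "Liminf at_top (\<lambda>s. ereal (max_clarke (zero_extension F) s / s)) < 0"
  shows "\<exists>s. good_level F a s"
proof -
  obtain B where B: "0 \<le> B" "\<And>t. t \<in> {0..a} \<Longrightarrow> \<bar>F t\<bar> \<le> B"
    by (rule locally_lipschitz_bounded[OF ll]) (rule that)
  obtain \<tau> v h where v: "a + 1 \<le> \<tau>" "H10_pair v h"
    "\<And>s. \<tau> \<le> s \<Longrightarrow> sqn M h / 2 - (\<integral>x. trunc s F (v x) \<partial>M) < - (B * vol + 1)"
    by (rule low_energy[OF ne ll inf sup]) (rule that)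
  obtain s where s: "\<tau> \<le> s" "0 < s" "max_clarke (zero_extension F) s < 0"
    by (rule large_negative_max_clarke[OF neg]) (rule that)
  obtain \<delta> c where \<delta>: "0 < \<delta>" "\<delta> < s" "0 < c"
    "\<And>r t. s - \<delta> \<le> r \<Longrightarrow> r \<le> t \<Longrightarrow> t \<le> s \<Longrightarrow> F t - F r \<le> - c * (t - r)"
    using negative_max_clarke[OF ll F0 s(2,3)] by blast
  have "good_level F a s"
    unfolding good_level_def
  proof (intro conjI)
    show "a + 1 \<le> s" using v(1) s(1) by simp
    have "sqn M h / 2 - (\<integral>x. trunc s F (v x) \<partial>M) < - (B * vol) - 1" using v(3)[OF s(1)] by simp
    with v(2) B(2) show "\<exists>B. (\<forall>t\<in>{0..a}. \<bar>F t\<bar> \<le> B) \<and>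
        (\<exists>v h. H10_pair v h \<and> sqn M h / 2 - (\<integral>x. trunc s F (v x) \<partial>M) < - (B * vol) - 1)"
      by blast
    show "\<exists>\<delta> c. 0 < \<delta> \<and> \<delta> < s \<and> 0 < c \<and>
        (\<forall>r t. s - \<delta> \<le> r \<longrightarrow> r \<le> t \<longrightarrow> t \<le> s \<longrightarrow> F t - F r \<le> - c * (t - r))"
      using \<delta> by blast
  qed
  then show ?thesis ..
qed

end

section \<open>Choice of the bound on lam and separation of the solutions\<close>

theorem theorem2p4:
  fixes \<Omega> :: "(real ^ 'n) set"
    and p c_lo c_hi :: real
    and F G :: "real \<Rightarrow> real"
  assumes "CARD('n) \<ge> 2"
    and "open \<Omega>" and "connected \<Omega>" and "\<Omega> \<noteq> {}" and "bounded \<Omega>"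
    and "p > 1"
    and "locally_lipschitz_on {0..} F" and "locally_lipschitz_on {0..} G"
    and "F 0 = 0"
    and "- \<infinity> < Liminf at_top (\<lambda>s. ereal (F s / s\<^sup>2))"
    and "Limsup at_top (\<lambda>s. ereal (F s / s\<^sup>2)) = \<infinity>"
    and "Liminf at_top (\<lambda>s. ereal (max_clarke (zero_extension F) s / s)) < 0"
    and "G 0 = 0"
    and "ereal c_lo = Liminf at_top (\<lambda>s. ereal (min_clarke (zero_extension G) s / s powr p))"
    and "Liminf at_top (\<lambda>s. ereal (min_clarke (zero_extension G) s / s powr p))
           \<le> Limsup at_top (\<lambda>s. ereal (max_clarke (zero_extension G) s / s powr p))"
    and "Limsup at_top (\<lambda>s. ereal (max_clarke (zero_extension G) s / s powr p)) = ereal c_hi"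
  shows "\<forall>k \<ge> (1::nat). \<exists>lam_k > (0::real). \<forall>lam \<in> {0..lam_k}. \<exists>u :: nat \<Rightarrow> real ^ 'n \<Rightarrow> real.
           (\<forall>i \<in> {1..k}. weak_solution \<Omega> F G lam (u i)) \<and>
           (\<forall>i \<in> {1..k}. \<forall>j \<in> {1..k}. i \<noteq> j \<longrightarrow> \<not> (AE x in lebesgue_on \<Omega>. u i x = u j x)) \<and>
           (\<forall>i \<in> {1..k}. ereal (real i - 1) < Linfty_norm \<Omega> (u i) \<and> Linfty_norm \<Omega> (u i) < \<infinity>)"
proof (intro allI impI)
  fix k :: nat
  assume "1 \<le> k"
  interpret bounded_domain \<Omega> by unfold_locales fact+
  note F = assms(7,9) and G = assms(8,13)
  have "\<forall>a. \<exists>s. good_level F a s"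
    using good_level_exists[OF assms(4) F assms(10-12)] by blast
  from choice[OF this] obtain next_level where next_level: "\<And>a. good_level F a (next_level a)" by blast
  \<comment> \<open>Starting at 0, each step rises by at least 1, whence S i \<ge> i; this is the
    source of the lower bound i - 1 on the norms.\<close>
  define S where "S = rec_nat 0 (\<lambda>_. next_level)"
  have S0: "S 0 = 0" and S_Suc: "good_level F (S i) (S (Suc i))" for i
    using next_level by (simp_all add: S_def)
  have S_step: "S i + 1 \<le> S (Suc i)" for i
    using S_Suc[of i] by (simp add: good_level_def)
  have S_ge: "real i \<le> S i" for i
  proof (induction i)
    case (Suc i)
    with S_step[of i] show ?case by simp
  qed (simp add: S0)
  have S_mono: "S i \<le> S j" if "i \<le> j" for i j
    using that by (rule lift_Suc_mono_le[rotated]) (use S_step in \<open>smt (verit)\<close>)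
  have S_nonneg: "0 \<le> S i" for i using S_ge[of i] by (rule order_trans[rotated]) simp
  have "\<forall>i. \<exists>c>0. \<exists>\<delta>. 0 < \<delta> \<and> \<delta> < S (Suc i) \<and>
      (\<forall>r t. S (Suc i) - \<delta> \<le> r \<longrightarrow> r \<le> t \<longrightarrow> t \<le> S (Suc i) \<longrightarrow> F t - F r \<le> - c * (t - r))"
    using S_Suc unfolding good_level_def by blast
  from choice[OF this] obtain c where c: "\<And>i. 0 < c i"
    "\<And>i. \<exists>\<delta>. 0 < \<delta> \<and> \<delta> < S (Suc i) \<and>
      (\<forall>r t. S (Suc i) - \<delta> \<le> r \<longrightarrow> r \<le> t \<longrightarrow> t \<le> S (Suc i) \<longrightarrow> F t - F r \<le> - c i * (t - r))"
    by blast
  \<comment> \<open>All levels in use lie in [0, S k], so one bound and one Lipschitz constant of G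
    serve every i.\<close>
  obtain B where B: "0 \<le> B" "\<And>s. s \<in> {0..S k} \<Longrightarrow> \<bar>G s\<bar> \<le> B"
    by (rule locally_lipschitz_bounded[OF G(1)]) (rule that)
  obtain L where L: "\<And>s t. s \<in> {0..S k} \<Longrightarrow> t \<in> {0..S k} \<Longrightarrow> \<bar>G s - G t\<bar> \<le> L * \<bar>s - t\<bar>" "0 \<le> L"
    using locally_lipschitz_imp_lipschitz[OF G(1), of "S k"] by blast
  \<comment> \<open>A positive lower bound for the slopes at the k levels, as a minimum of finitely
    many positive numbers.\<close>
  define m where "m = Min (insert 1 (c ` {..<k}))"
  have m: "0 < m" "\<And>i. i < k \<Longrightarrow> m \<le> c i"
    using c(1) by (auto simp: m_def)
  \<comment> \<open>The first bound keeps lam * L below every slope c i, so F + lam G still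
    decreases; the second keeps each G-term of the energy within 1/4. The summands 1 avoid division
    by 0.\<close>
  define lam_k where "lam_k = min (m / (L + 1)) (1 / (4 * (B * vol + 1)))"
  have V0: "0 \<le> B * vol" using B(1) by simp
  have lam_k: "0 < lam_k" using m(1) L(2) V0 by (simp add: lam_k_def)
  have sol: "\<exists>u. weak_solution \<Omega> F G lam u \<and> u \<in> borel_measurable M \<and> (AE x in M. 0 \<le> u x \<and> u x \<le> S (Suc i)) \<and>
      \<not> (AE x in M. u x \<le> S i)" if lam: "lam \<in> {0..lam_k}" and i: "i < k" for lam i
  proof -
    have lam0: "0 \<le> lam" using lam by simp
    have "lam * (L + 1) \<le> m"
      using lam L(2) by (simp add: lam_k_def pos_le_divide_eq)
    then have lamL: "lam * L \<le> c i" using m(2)[OF i] lam0 by (simp add: distrib_left)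
    have "lam * (B * vol + 1) \<le> 1 / 4"
      using lam V0 by (simp add: lam_k_def pos_le_divide_eq mult_ac)
    then have lamB: "lam * B * vol \<le> 1 / 4" using lam0 by (simp add: distrib_left mult.assoc)
    have Sk: "S (Suc i) \<le> S k" using i by (intro S_mono) simp
    obtain \<delta> where \<delta>: "0 < \<delta>" "\<delta> < S (Suc i)"
      "\<And>r t. S (Suc i) - \<delta> \<le> r \<Longrightarrow> r \<le> t \<Longrightarrow> t \<le> S (Suc i) \<Longrightarrow> F t - F r \<le> - c i * (t - r)"
      using c(2)[of i] by blast
    have anti: "F t + lam * G t \<le> F r + lam * G r" if "S (Suc i) - \<delta> \<le> r" "r \<le> t" "t \<le> S (Suc i)" for r t
    proof -
      have "G t - G r \<le> L * (t - r)"
        using L(1)[of t r] that \<delta> Sk by auto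
      then have "lam * (G t - G r) \<le> lam * (L * (t - r))" using lam0 by (rule mult_left_mono)
      also have "\<dots> \<le> c i * (t - r)" using lamL that(2) by (simp add: mult_right_mono flip: mult.assoc)
      finally show ?thesis using \<delta>(3)[OF that] by (simp add: algebra_simps)
    qed
    obtain u g where u: "H10_pair u g" "weak_solution \<Omega> F G lam u" "AE x in M. 0 \<le> u x \<and> u x \<le> S (Suc i)"
      and min: "\<And>v h. H10_pair v h \<Longrightarrow>
        sqn M g / 2 - (\<integral>x. trunc (S (Suc i)) F (u x) + lam * trunc (S (Suc i)) G (u x) \<partial>M)
        \<le> sqn M h / 2 - (\<integral>x. trunc (S (Suc i)) F (v x) + lam * trunc (S (Suc i)) G (v x) \<partial>M)"
      using truncated_solution[OF F G \<delta>(1) less_imp_le[OF \<delta>(2)] lam0 anti] by blast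
    have um: "u \<in> borel_measurable M" by (rule L2_measurable[OF H10_pair_L2(1)[OF u(1)]])
    have intF: "integrable M (\<lambda>x. trunc (S (Suc i)) f (w x))"
      and bound: "\<And>B. (\<And>s. s \<in> {0..S (Suc i)} \<Longrightarrow> \<bar>f s\<bar> \<le> B) \<Longrightarrow> \<bar>\<integral>x. trunc (S (Suc i)) f (w x) \<partial>M\<bar> \<le> B * vol"
      if f: "locally_lipschitz_on {0..} f" and w: "w \<in> borel_measurable M" for f w
    proof -
      obtain K where "lipschitz_fun (trunc (S (Suc i)) f) K" by (rule trunc_lipschitz[OF f S_nonneg])
      then interpret lipschitz_fun "trunc (S (Suc i)) f" K .
      have clamp: "max 0 (min t (S (Suc i))) \<in> {0..S (Suc i)}" for t using S_nonneg[of "Suc i"] by auto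
      obtain B where B: "0 \<le> B" "\<And>s. s \<in> {0..S (Suc i)} \<Longrightarrow> \<bar>f s\<bar> \<le> B"
        by (rule locally_lipschitz_bounded[OF f]) (rule that)
      show int: "integrable M (\<lambda>x. trunc (S (Suc i)) f (w x))"
      proof (rule integrable_const_bound[where B=B])
        show "AE x in M. norm (trunc (S (Suc i)) f (w x)) \<le> B"
          unfolding trunc_def by (intro AE_I2) (simp only: real_norm_def B(2)[OF clamp])
        show "(\<lambda>x. trunc (S (Suc i)) f (w x)) \<in> borel_measurable M" using w by measurable
      qed
      fix B assume B: "\<And>s. s \<in> {0..S (Suc i)} \<Longrightarrow> \<bar>f s\<bar> \<le> B"
      have "\<bar>\<integral>x. trunc (S (Suc i)) f (w x) \<partial>M\<bar> \<le> (\<integral>x. \<bar>trunc (S (Suc i)) f (w x)\<bar> \<partial>M)"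
        by (rule integral_abs_bound)
      also have "\<dots> \<le> (\<integral>x. B \<partial>M)"
        using int by (intro integral_mono) (auto simp: trunc_def intro!: B clamp)
      finally show "\<bar>\<integral>x. trunc (S (Suc i)) f (w x) \<partial>M\<bar> \<le> B * vol" by (simp add: mult.commute)
    qed
    have BG: "\<bar>\<integral>x. trunc (S (Suc i)) G (w x) \<partial>M\<bar> \<le> B * vol" if "w \<in> borel_measurable M" for w
      using Sk by (intro bound[OF G(1) that] B(2)) auto
    \<comment> \<open>The comparison involves this term once for u and once for the competitor;
      together they contribute at most 1/2, less than the margin 1.\<close>
    have lamG: "\<bar>lam * (\<integral>x. trunc (S (Suc i)) G (w x) \<partial>M)\<bar> \<le> 1 / 4" if "w \<in> borel_measurable M" for w
    proof -
      have "\<bar>lam * (\<integral>x. trunc (S (Suc i)) G (w x) \<partial>M)\<bar> \<le> lam * (B * vol)"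
        using lam0 BG[OF that] by (simp add: abs_mult mult_left_mono)
      with lamB show ?thesis by (simp add: mult.assoc)
    qed
    have split: "(\<integral>x. trunc (S (Suc i)) F (w x) + lam * trunc (S (Suc i)) G (w x) \<partial>M)
        = (\<integral>x. trunc (S (Suc i)) F (w x) \<partial>M) + lam * (\<integral>x. trunc (S (Suc i)) G (w x) \<partial>M)"
      if "w \<in> borel_measurable M" for w
      using intF[OF F(1) that] intF[OF G(1) that] by simp
    obtain B' v h where v: "\<forall>t\<in>{0..S i}. \<bar>F t\<bar> \<le> B'" "H10_pair v h"
      "sqn M h / 2 - (\<integral>x. trunc (S (Suc i)) F (v x) \<partial>M) < - (B' * vol) - 1"
      using S_Suc[of i] unfolding good_level_def by blast
    have vm: "v \<in> borel_measurable M" by (rule L2_measurable[OF H10_pair_L2(1)[OF v(2)]])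
    have "\<not> (AE x in M. u x \<le> S i)"
    proof
      assume ae: "AE x in M. u x \<le> S i"
      have "(\<integral>x. trunc (S (Suc i)) F (u x) \<partial>M) \<le> (\<integral>x. B' \<partial>M)"
      proof (rule integral_mono_AE)
        show "AE x in M. trunc (S (Suc i)) F (u x) \<le> B'"
          using ae u(3)
        proof eventually_elim
          case (elim x)
          then have "trunc (S (Suc i)) F (u x) = F (u x)" by (simp add: trunc_def)
          with v(1) elim show ?case by (auto simp: abs_le_iff)
        qed
      qed (use intF[OF F(1) um] in auto)
      then have "(\<integral>x. trunc (S (Suc i)) F (u x) \<partial>M) \<le> B' * vol" by (simp add: mult.commute)
      with min[OF v(2)] v(3) lamG[OF um] lamG[OF vm] sqn_nonneg[of M g]
      show False unfolding split[OF um] split[OF vm] by (simp only: abs_le_iff) argo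
    qed
    with u um show ?thesis by blast
  qed
  show "\<exists>lam_k>0. \<forall>lam\<in>{0..lam_k}. \<exists>u.
      (\<forall>i\<in>{1..k}. weak_solution \<Omega> F G lam (u i)) \<and>
      (\<forall>i\<in>{1..k}. \<forall>j\<in>{1..k}. i \<noteq> j \<longrightarrow> \<not> (AE x in M. u i x = u j x)) \<and>
      (\<forall>i\<in>{1..k}. ereal (real i - 1) < Linfty_norm \<Omega> (u i) \<and> Linfty_norm \<Omega> (u i) < \<infinity>)"
  proof (intro exI[of _ lam_k] conjI lam_k ballI)
    fix lam assume lam: "lam \<in> {0..lam_k}"
    \<comment> \<open>The guard inside the existential makes the claim hold for all indices, as
      \<open>choice\<close> demands.\<close>
    have "\<forall>i. \<exists>u. i < k \<longrightarrow> weak_solution \<Omega> F G lam u \<and> u \<in> borel_measurable M \<and>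
        (AE x in M. 0 \<le> u x \<and> u x \<le> S (Suc i)) \<and> \<not> (AE x in M. u x \<le> S i)"
      using sol[OF lam] by blast
    from choice[OF this] obtain w where w: "\<forall>i. i < k \<longrightarrow> weak_solution \<Omega> F G lam (w i) \<and> w i \<in> borel_measurable M \<and>
        (AE x in M. 0 \<le> w i x \<and> w i x \<le> S (Suc i)) \<and> \<not> (AE x in M. w i x \<le> S i)" ..
    \<comment> \<open>Solutions are numbered from 1: the i-th one exceeds S (i - 1) and is at most S
      i.\<close>
    define u where "u i = w (i - 1)" for i
    have u: "weak_solution \<Omega> F G lam (u i)" "u i \<in> borel_measurable M"
      "AE x in M. 0 \<le> u i x \<and> u i x \<le> S i" "\<not> (AE x in M. u i x \<le> S (i - 1))" if "i \<in> {1..k}" for i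
    proof -
      have "i - 1 < k" "Suc (i - 1) = i" using that by auto
      with w show "weak_solution \<Omega> F G lam (u i)" "u i \<in> borel_measurable M"
        "AE x in M. 0 \<le> u i x \<and> u i x \<le> S i" "\<not> (AE x in M. u i x \<le> S (i - 1))"
        unfolding u_def by metis+
    qed
    have ne: "\<not> (AE x in M. u i x = u j x)" if ij: "i \<in> {1..k}" "j \<in> {1..k}" "i < j" for i j
    proof
      assume "AE x in M. u i x = u j x"
      with u(3)[OF ij(1)] have "AE x in M. u j x \<le> S (j - 1)"
      proof eventually_elim
        case (elim x)
        \<comment> \<open>Since i < j, the range of the i-th solution ends at or below the level
          that the j-th one exceeds.\<close>
        moreover have "S i \<le> S (j - 1)" using ij by (intro S_mono) auto
        ultimately show ?case by simp
      qed
      with u(4)[OF ij(2)] show False by simp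
    qed
    show "\<exists>u. (\<forall>i\<in>{1..k}. weak_solution \<Omega> F G lam (u i)) \<and>
      (\<forall>i\<in>{1..k}. \<forall>j\<in>{1..k}. i \<noteq> j \<longrightarrow> \<not> (AE x in M. u i x = u j x)) \<and>
      (\<forall>i\<in>{1..k}. ereal (real i - 1) < Linfty_norm \<Omega> (u i) \<and> Linfty_norm \<Omega> (u i) < \<infinity>)"
    proof (intro exI[of _ u] conjI ballI impI)
      fix i assume i: "i \<in> {1..k}"
      show "weak_solution \<Omega> F G lam (u i)" by (rule u(1)[OF i])
      have "Linfty_norm \<Omega> (u i) \<le> ereal (S i)"
        unfolding Linfty_norm_def
      proof (rule esssup_I)
        show "(\<lambda>x. ereal \<bar>u i x\<bar>) \<in> borel_measurable M" using u(2)[OF i] by simp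
        show "AE x in M. ereal \<bar>u i x\<bar> \<le> ereal (S i)" using u(3)[OF i] by (rule eventually_mono) simp
      qed
      then show "Linfty_norm \<Omega> (u i) < \<infinity>" by (rule order_le_less_trans) simp
      show "ereal (real i - 1) < Linfty_norm \<Omega> (u i)"
      proof (rule ccontr)
        assume "\<not> ?thesis"
        then have le: "Linfty_norm \<Omega> (u i) \<le> ereal (real i - 1)" by simp
        \<comment> \<open>A norm of at most i - 1 would keep u i at or below S (i - 1), a level that
          it exceeds on a set of positive measure.\<close>
        have "real i - 1 \<le> S (i - 1)" using S_ge[of "i - 1"] i by (simp add: of_nat_diff)
        have "AE x in M. ereal \<bar>u i x\<bar> \<le> Linfty_norm \<Omega> (u i)"
          unfolding Linfty_norm_def by (rule esssup_AE)
        then have "AE x in M. u i x \<le> S (i - 1)"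
        proof (rule eventually_mono)
          fix x assume "ereal \<bar>u i x\<bar> \<le> Linfty_norm \<Omega> (u i)"
          from order_trans[OF this le] have "\<bar>u i x\<bar> \<le> real i - 1" by simp
          with \<open>real i - 1 \<le> S (i - 1)\<close> show "u i x \<le> S (i - 1)" by simp
        qed
        with u(4)[OF i] show False by simp
      qed
    next
      fix i j assume ij: "i \<in> {1..k}" "j \<in> {1..k}" "i \<noteq> j"
      show "\<not> (AE x in M. u i x = u j x)"
      proof (cases "i < j")
        case True
        then show ?thesis using ne[OF ij(1,2)] by simp
      next
        case False
        then have "j < i" using ij(3) by simp
        from ne[OF ij(2,1) this] show ?thesis by (simp add: eq_commute)
      qed
    qed
  qed
qed

end
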